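(* Let $\delta=1$ (resp. $\delta=-1$) and let $\eta\in\mathbb{R}$. Consider a system $$z_{1,t}=F(z,z_1,y,y_1),\qquad y_{1,t}=G(z,z_1,y,y_1)\qquad (z=u,\ z_1=u_x,\ y=v,\ y_1=v_x),$$ with $F,G$ smooth, satisfying $F_z^2+F_y^2+G_z^2+G_y^2\neq 0$ up to a set of measure zero. Then the system describes pseudospherical surfaces (resp. spherical surfaces) with associated smooth functions $f_{ij}(z,z_1,y,y_1)$ such that $f_{11}=\eta$ if and only if one of the following two cases occurs (locally, i.e. after possibly shrinking the domain): (i) The system is $$z_{1,t}=\tfrac1W\big[-a(bz_1+ay_1)\phi''(\xi)+\eta(\mu h_{y_1}-\delta\lambda g_{y_1})\phi'(\xi)-\tfrac12(h^2-\delta g^2)_{y_1}\phi(\xi)\big],$$ $$y_{1,t}=\tfrac1W\big[b(bz_1+ay_1)\phi''(\xi)-\eta(\mu h_{z_1}-\delta\lambda g_{z_1})\phi'(\xi)+\tfrac12(h^2-\delta g^2)_{z_1}\phi(\xi)\big],$$ where $a,b,\mu,\lambda\in\mathbb{R}$; $g(z_1,y_1)$, $h(z_1,y_1)$ are smooth functions and $\phi(\xi)$, $\xi=ay+bz$, is a smooth strictly monotone function of $\xi$, such that $$a^2+b^2\neq0,\quad \mu^2+\lambda^2\neq0,\quad W=g_{z_1}h_{y_1}-g_{y_1}h_{z_1}\neq0,\quad \mu g-\lambda h=ay_1+bz_1,\quad g\neq\lambda\eta\frac{\phi'(\xi)}{\phi(\xi)}.$$ In this case the associated functions are $$f_{11}=\eta,\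 f_{12}=\phi(\xi),\ f_{21}=g,\ f_{22}=\lambda\phi'(\xi),\ f_{31}=-h,\ f_{32}=-\mu\phi'(\xi).$$ (ii) The system is $$z_{1,t}=-\frac{z_1}{\gamma}(p_{zy}+\tau p)-\frac{y_1}{\gamma}(p_{yy}+\beta p)+\frac{\eta}{\gamma^2}(\beta p_z-\tau p_y),$$ $$y_{1,t}=\frac{z_1}{\gamma}(p_{zz}+\alpha p)+\frac{y_1}{\gamma}(p_{zy}+\tau p)-\frac{\eta}{\gamma^2}(\tau p_z-\alpha p_y),$$ where $a_1,b_1,a_3,b_3\in\mathbb{R}$, $\gamma:=a_1b_3-b_1a_3\neq0$, $\alpha=a_3^2-\delta a_1^2$, $\beta=b_3^2-\delta b_1^2$, $\tau=a_3b_3-\delta a_1b_1$, and $p(z,y)$ is a smooth function such that $p_z$ and $p_y$ are not proportional. In this case the associated functions are $$f_{11}=\eta,\quad f_{12}=p,\quad f_{21}=a_1z_1+b_1y_1,\quad f_{22}=\tfrac1\gamma(b_1p_z-a_1p_y),\quad f_{31}=-a_3z_1-b_3y_1,\quad f_{32}=-\tfrac1\gamma(b_3p_z-a_3p_y).$$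
   Context: Subscripts $z,z_1,y,y_1$ on functions denote partial derivatives, and $z,z_1,y,y_1$ are treated as independent variables on an open connected subset of $\mathbb{R}^4$; primes denote derivatives with respect to $\xi$. "$p_z$ and $p_y$ not proportional" means linearly independent over $\mathbb{R}$ as functions. Definition. A system of PDEs for $u(x,t),v(x,t)$ describes pseudospherical surfaces (take $\delta=1$), resp. spherical surfaces (take $\delta=-1$), with associated functions $f_{ij}$, $1\le i\le 3$, $1\le j\le 2$, if the system is equivalent to (i.e. has exactly the same solutions $(u,v)$ as) the structure equations $d\omega_1=\omega_3\wedge\omega_2$, $d\omega_2=\omega_1\wedge\omega_3$, $d\omega_3=\delta\,\omega_1\wedge\omega_2$ of a surface with Gaussian curvature $K=-\delta$, where $\omega_i=f_{i1}dx+f_{i2}dt$ and $f_{ij}$ are evaluated on $u,v$ and their derivatives, with $\omega_1\wedge\omega_2\ne 0$, i.e. $f_{11}f_{22}-f_{12}f_{21}\neq0$. Everything is local and generic: non-vanishing conditions (including $f_{11}f_{22}-f_{12}f_{21}\ne0$) are understood up to a set of measure zero, and the domain may be replaced by a smaller open connected set. *)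

theory Defs
  imports "HOL-Analysis.Analysis"
begin

subsection \<open>Smooth functions, partial derivatives, domains\<close>

text \<open>Both notions are meant for open sets \<open>S\<close>, the only ones they are used for.\<close>

primrec ndiff_on :: "nat \<Rightarrow> ('a::real_normed_vector \<Rightarrow> real) \<Rightarrow> 'a set \<Rightarrow> bool" where
  "ndiff_on 0 f S \<longleftrightarrow> continuous_on S f"
| "ndiff_on (Suc k) f S \<longleftrightarrow>
     (\<forall>x\<in>S. f differentiable (at x)) \<and> (\<forall>v. ndiff_on k (\<lambda>x. frechet_derivative f (at x) v) S)"

definition smooth_on :: "('a::real_normed_vector \<Rightarrow> real) \<Rightarrow> 'a set \<Rightarrow> bool" where
  "smooth_on f S \<longleftrightarrow> (\<forall>k. ndiff_on k f S)"

definition pd1 :: "(real \<times> real \<Rightarrow> real) \<Rightarrow> real \<times> real \<Rightarrow> real" where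
  "pd1 f = (\<lambda>(r, s). deriv (\<lambda>r'. f (r', s)) r)"

definition pd2 :: "(real \<times> real \<Rightarrow> real) \<Rightarrow> real \<times> real \<Rightarrow> real" where
  "pd2 f = (\<lambda>(r, s). deriv (\<lambda>s'. f (r, s')) s)"

text \<open>Points of \<open>jet_pt\<close> are quadruples \<open>(z, z1, y, y1)\<close>.\<close>

type_synonym jet_pt = "real \<times> real \<times> real \<times> real"

definition pdz :: "(jet_pt \<Rightarrow> real) \<Rightarrow> jet_pt \<Rightarrow> real" where
  "pdz F = (\<lambda>(z, z1, y, y1). deriv (\<lambda>s. F (s, z1, y, y1)) z)"

definition pdy :: "(jet_pt \<Rightarrow> real) \<Rightarrow> jet_pt \<Rightarrow> real" where
  "pdy F = (\<lambda>(z, z1, y, y1). deriv (\<lambda>s. F (z, z1, s, y1)) y)"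

definition is_domain :: "jet_pt set \<Rightarrow> bool" where
  "is_domain D \<longleftrightarrow> open D \<and> connected D \<and> D \<noteq> {}"

definition generically_nonzero :: "jet_pt set \<Rightarrow> (jet_pt \<Rightarrow> real) \<Rightarrow> bool" where
  "generically_nonzero D e \<longleftrightarrow> negligible {X \<in> D. e X = 0}"

text \<open>Local validity of a property of domains, i.e. validity after shrinking \<open>D\<close>. In a statement
  quantified over all domains \<open>D\<close> it may in particular be applied to arbitrarily small
  neighbourhoods of any given point.\<close>

definition after_shrinking :: "jet_pt set \<Rightarrow> (jet_pt set \<Rightarrow> bool) \<Rightarrow> bool" where
  "after_shrinking D P \<longleftrightarrow> (\<exists>D'. is_domain D' \<and> D' \<subseteq> D \<and> P D')"

subsection \<open>Systems describing (pseudo)spherical surfaces\<close>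

text \<open>Functions of two variables \<open>u, v\<close> have arguments \<open>(x, t)\<close>, so \<open>pd1\<close> is the derivative in
  \<open>x\<close> and \<open>pd2\<close> the one in \<open>t\<close>.\<close>

definition jet :: "(real \<times> real \<Rightarrow> real) \<Rightarrow> (real \<times> real \<Rightarrow> real) \<Rightarrow> real \<times> real \<Rightarrow> jet_pt" where
  "jet u v q = (u q, pd1 u q, v q, pd1 v q)"

definition solves_system ::
  "(jet_pt \<Rightarrow> real) \<Rightarrow> (jet_pt \<Rightarrow> real) \<Rightarrow> (real \<times> real) set
    \<Rightarrow> (real \<times> real \<Rightarrow> real) \<Rightarrow> (real \<times> real \<Rightarrow> real) \<Rightarrow> bool" where
  "solves_system F G Q u v \<longleftrightarrow>
     (\<forall>q\<in>Q. pd2 (pd1 u) q = F (jet u v q) \<and> pd2 (pd1 v) q = G (jet u v q))"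

text \<open>A pair \<open>(P, R)\<close> stands for the one-form \<open>P dx + R dt\<close>; a two-form is represented by its
  coefficient with respect to \<open>dx \<and> dt\<close>.\<close>

type_synonym one_form = "(real \<times> real \<Rightarrow> real) \<times> (real \<times> real \<Rightarrow> real)"

definition ext_d :: "one_form \<Rightarrow> real \<times> real \<Rightarrow> real" where
  "ext_d = (\<lambda>(P, R) q. pd1 R q - pd2 P q)"

definition wedge :: "one_form \<Rightarrow> one_form \<Rightarrow> real \<times> real \<Rightarrow> real" where
  "wedge = (\<lambda>(P, R) (P', R') q. P q * R' q - R q * P' q)"

text \<open>\<open>f i j\<close> is \<open>f\<^sub>i\<^sub>j\<close>; only the values for \<open>i \<in> {1,2,3}\<close>, \<open>j \<in> {1,2}\<close> are relevant.\<close>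

type_synonym assoc_funs = "nat \<Rightarrow> nat \<Rightarrow> jet_pt \<Rightarrow> real"

definition omega ::
  "assoc_funs \<Rightarrow> (real \<times> real \<Rightarrow> real) \<Rightarrow> (real \<times> real \<Rightarrow> real) \<Rightarrow> nat \<Rightarrow> one_form" where
  "omega f u v i = (\<lambda>q. f i 1 (jet u v q), \<lambda>q. f i 2 (jet u v q))"

definition structure_equations ::
  "real \<Rightarrow> assoc_funs \<Rightarrow> (real \<times> real) set
    \<Rightarrow> (real \<times> real \<Rightarrow> real) \<Rightarrow> (real \<times> real \<Rightarrow> real) \<Rightarrow> bool" where
  "structure_equations \<delta> f Q u v \<longleftrightarrow>
     (let \<omega> = omega f u v in
      \<forall>q\<in>Q. ext_d (\<omega> 1) q = wedge (\<omega> 3) (\<omega> 2) q \<and>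
            ext_d (\<omega> 2) q = wedge (\<omega> 1) (\<omega> 3) q \<and>
            ext_d (\<omega> 3) q = \<delta> * wedge (\<omega> 1) (\<omega> 2) q)"

text \<open>\<open>\<delta> = 1\<close>: pseudospherical surfaces; \<open>\<delta> = -1\<close>: spherical surfaces. Solutions are smooth, are
  defined on an open set of the \<open>(x, t)\<close>-plane and have their jets in the domain \<open>D\<close> of the
  system.\<close>

definition describes_surfaces ::
  "real \<Rightarrow> jet_pt set \<Rightarrow> (jet_pt \<Rightarrow> real) \<Rightarrow> (jet_pt \<Rightarrow> real) \<Rightarrow> assoc_funs \<Rightarrow> bool" where
  "describes_surfaces \<delta> D F G f \<longleftrightarrow>
     (\<forall>i\<in>{1,2,3}. \<forall>j\<in>{1,2}. smooth_on (f i j) D) \<and>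
     generically_nonzero D (\<lambda>X. f 1 1 X * f 2 2 X - f 1 2 X * f 2 1 X) \<and>
     (\<forall>Q u v. open Q \<and> smooth_on u Q \<and> smooth_on v Q \<and> jet u v ` Q \<subseteq> D \<longrightarrow>
        (solves_system F G Q u v \<longleftrightarrow> structure_equations \<delta> f Q u v))"

subsection \<open>The two normal forms\<close>

text \<open>Functions of \<open>(z1, y1)\<close>, of \<open>(z, y)\<close> and of \<open>\<xi> = a y + b z\<close> live on the images of the
  domain under the corresponding projections.\<close>

definition proj1 :: "jet_pt set \<Rightarrow> (real \<times> real) set" where
  "proj1 D = (\<lambda>(z, z1, y, y1). (z1, y1)) ` D"

definition proj0 :: "jet_pt set \<Rightarrow> (real \<times> real) set" where
  "proj0 D = (\<lambda>(z, z1, y, y1). (z, y)) ` D"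

definition xi_range :: "real \<Rightarrow> real \<Rightarrow> jet_pt set \<Rightarrow> real set" where
  "xi_range a b D = (\<lambda>(z, z1, y, y1). a * y + b * z) ` D"

definition Wdet :: "(real \<times> real \<Rightarrow> real) \<Rightarrow> (real \<times> real \<Rightarrow> real) \<Rightarrow> real \<times> real \<Rightarrow> real" where
  "Wdet g h w = pd1 g w * pd2 h w - pd2 g w * pd1 h w"

definition data_i ::
  "real \<Rightarrow> jet_pt set \<Rightarrow> real \<Rightarrow> real \<Rightarrow> real \<Rightarrow> real
    \<Rightarrow> (real \<times> real \<Rightarrow> real) \<Rightarrow> (real \<times> real \<Rightarrow> real) \<Rightarrow> (real \<Rightarrow> real) \<Rightarrow> bool" where
  "data_i \<eta> D a b \<mu> lam g h \<phi> \<longleftrightarrow>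
     smooth_on g (proj1 D) \<and> smooth_on h (proj1 D) \<and> smooth_on \<phi> (xi_range a b D) \<and>
     (strict_mono_on (xi_range a b D) \<phi> \<or> strict_antimono_on (xi_range a b D) \<phi>) \<and>
     a\<^sup>2 + b\<^sup>2 \<noteq> 0 \<and> \<mu>\<^sup>2 + lam\<^sup>2 \<noteq> 0 \<and>
     generically_nonzero D (\<lambda>(z, z1, y, y1). Wdet g h (z1, y1)) \<and>
     (\<forall>(z1, y1)\<in>proj1 D. \<mu> * g (z1, y1) - lam * h (z1, y1) = a * y1 + b * z1) \<and>
     generically_nonzero D (\<lambda>(z, z1, y, y1).
       let \<xi> = a * y + b * z in g (z1, y1) - lam * \<eta> * (deriv \<phi> \<xi> / \<phi> \<xi>))"

text \<open>As \<open>W\<close> is only required to be nonzero off a null set, the formulas with the factor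
  \<open>1 / W\<close> are imposed where \<open>W \<noteq> 0\<close>.\<close>

definition system_i ::
  "real \<Rightarrow> real \<Rightarrow> jet_pt set \<Rightarrow> (jet_pt \<Rightarrow> real) \<Rightarrow> (jet_pt \<Rightarrow> real)
    \<Rightarrow> real \<Rightarrow> real \<Rightarrow> real \<Rightarrow> real
    \<Rightarrow> (real \<times> real \<Rightarrow> real) \<Rightarrow> (real \<times> real \<Rightarrow> real) \<Rightarrow> (real \<Rightarrow> real) \<Rightarrow> bool" where
  "system_i \<delta> \<eta> D F G a b \<mu> lam g h \<phi> \<longleftrightarrow>
     (\<forall>(z, z1, y, y1)\<in>D.
        let w = (z1, y1); \<xi> = a * y + b * z; W = Wdet g h w;
            k = (\<lambda>w. (h w)\<^sup>2 - \<delta> * (g w)\<^sup>2)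
        in W \<noteq> 0 \<longrightarrow>
           F (z, z1, y, y1) =
             1 / W * (- a * (b * z1 + a * y1) * deriv (deriv \<phi>) \<xi>
                      + \<eta> * (\<mu> * pd2 h w - \<delta> * lam * pd2 g w) * deriv \<phi> \<xi>
                      - 1 / 2 * pd2 k w * \<phi> \<xi>) \<and>
           G (z, z1, y, y1) =
             1 / W * (b * (b * z1 + a * y1) * deriv (deriv \<phi>) \<xi>
                      - \<eta> * (\<mu> * pd1 h w - \<delta> * lam * pd1 g w) * deriv \<phi> \<xi>
                      + 1 / 2 * pd1 k w * \<phi> \<xi>))"

definition assoc_i ::
  "real \<Rightarrow> jet_pt set \<Rightarrow> assoc_funs \<Rightarrow> real \<Rightarrow> real \<Rightarrow> real \<Rightarrow> real
    \<Rightarrow> (real \<times> real \<Rightarrow> real) \<Rightarrow> (real \<times> real \<Rightarrow> real) \<Rightarrow> (real \<Rightarrow> real) \<Rightarrow> bool" where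
  "assoc_i \<eta> D f a b \<mu> lam g h \<phi> \<longleftrightarrow>
     (\<forall>(z, z1, y, y1)\<in>D.
        let X = (z, z1, y, y1); \<xi> = a * y + b * z in
        f 1 1 X = \<eta> \<and> f 1 2 X = \<phi> \<xi> \<and>
        f 2 1 X = g (z1, y1) \<and> f 2 2 X = lam * deriv \<phi> \<xi> \<and>
        f 3 1 X = - h (z1, y1) \<and> f 3 2 X = - \<mu> * deriv \<phi> \<xi>)"

text \<open>The last conjunct is the linear independence of \<open>p\<^sub>z\<close> and \<open>p\<^sub>y\<close> over the reals.\<close>

definition data_ii ::
  "jet_pt set \<Rightarrow> real \<Rightarrow> real \<Rightarrow> real \<Rightarrow> real \<Rightarrow> (real \<times> real \<Rightarrow> real) \<Rightarrow> bool" where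
  "data_ii D a1 b1 a3 b3 p \<longleftrightarrow>
     a1 * b3 - b1 * a3 \<noteq> 0 \<and> smooth_on p (proj0 D) \<and>
     (\<forall>c d. (\<forall>w\<in>proj0 D. c * pd1 p w + d * pd2 p w = 0) \<longrightarrow> c = 0 \<and> d = 0)"

definition system_ii ::
  "real \<Rightarrow> real \<Rightarrow> jet_pt set \<Rightarrow> (jet_pt \<Rightarrow> real) \<Rightarrow> (jet_pt \<Rightarrow> real)
    \<Rightarrow> real \<Rightarrow> real \<Rightarrow> real \<Rightarrow> real \<Rightarrow> (real \<times> real \<Rightarrow> real) \<Rightarrow> bool" where
  "system_ii \<delta> \<eta> D F G a1 b1 a3 b3 p \<longleftrightarrow>
     (\<forall>(z, z1, y, y1)\<in>D.
        let \<gamma> = a1 * b3 - b1 * a3; \<alpha> = a3\<^sup>2 - \<delta> * a1\<^sup>2; \<beta> = b3\<^sup>2 - \<delta> * b1\<^sup>2;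
            \<tau> = a3 * b3 - \<delta> * a1 * b1;
            P = p (z, y); pz = pd1 p (z, y); py = pd2 p (z, y);
            pzz = pd1 (pd1 p) (z, y); pzy = pd2 (pd1 p) (z, y); pyy = pd2 (pd2 p) (z, y)
        in F (z, z1, y, y1) =
             - z1 / \<gamma> * (pzy + \<tau> * P) - y1 / \<gamma> * (pyy + \<beta> * P) + \<eta> / \<gamma>\<^sup>2 * (\<beta> * pz - \<tau> * py) \<and>
           G (z, z1, y, y1) =
             z1 / \<gamma> * (pzz + \<alpha> * P) + y1 / \<gamma> * (pzy + \<tau> * P) - \<eta> / \<gamma>\<^sup>2 * (\<tau> * pz - \<alpha> * py))"

definition assoc_ii ::
  "real \<Rightarrow> jet_pt set \<Rightarrow> assoc_funs \<Rightarrow> real \<Rightarrow> real \<Rightarrow> real \<Rightarrow> real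
    \<Rightarrow> (real \<times> real \<Rightarrow> real) \<Rightarrow> bool" where
  "assoc_ii \<eta> D f a1 b1 a3 b3 p \<longleftrightarrow>
     (\<forall>(z, z1, y, y1)\<in>D.
        let X = (z, z1, y, y1); \<gamma> = a1 * b3 - b1 * a3;
            pz = pd1 p (z, y); py = pd2 p (z, y) in
        f 1 1 X = \<eta> \<and> f 1 2 X = p (z, y) \<and>
        f 2 1 X = a1 * z1 + b1 * y1 \<and> f 2 2 X = 1 / \<gamma> * (b1 * pz - a1 * py) \<and>
        f 3 1 X = - a3 * z1 - b3 * y1 \<and> f 3 2 X = - (1 / \<gamma>) * (b3 * pz - a3 * py))"

end

theory Submission imports Defs begin

text \<open>
  At every point of the domain and for every choice of \<open>u\<^sub>t, v\<^sub>t, u\<^sub>x\<^sub>x, v\<^sub>x\<^sub>x\<close> the system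
  \<open>u\<^sub>x\<^sub>t = F, v\<^sub>x\<^sub>t = G\<close> has a local smooth solution with these derivatives at the given jet
  (\<open>goursat_smooth\<close>: a Goursat problem with data on the two characteristic axes). Along solutions
  the structure equations are affine in these four quantities, so, if the system describes
  surfaces, their coefficients vanish identically (\<open>describes_surfaces_pointwise\<close>). With
  \<open>f\<^sub>1\<^sub>1 = \<eta>\<close> this means that \<open>f\<^sub>1\<^sub>2 = p\<close>, \<open>f\<^sub>2\<^sub>2 = q\<close>, \<open>f\<^sub>3\<^sub>2 = s\<close> depend on \<open>(z, y)\<close> only and
  \<open>f\<^sub>2\<^sub>1 = g\<close>, \<open>f\<^sub>3\<^sub>1 = -h\<close> on \<open>(z1, y1)\<close> only (\<open>describes_surfaces_separated\<close>). What remains of the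
  structure equations is one identity,

    \<open>z1 p\<^sub>z + y1 p\<^sub>y + h q + g s = 0\<close>,

  and two equations that are linear in \<open>z\<^sub>1\<^sub>,\<^sub>t, y\<^sub>1\<^sub>,\<^sub>t\<close> with determinant
  \<open>W = g\<^bsub>z1\<^esub> h\<^bsub>y1\<^esub> - g\<^bsub>y1\<^esub> h\<^bsub>z1\<^esub>\<close>. This determinant is not identically zero: otherwise a kernel
  field could be added to \<open>(F, G)\<close>, and the solutions of the modified system would satisfy the
  structure equations without satisfying the original system
  (\<open>describes_surfaces_Wdet_nonzero\<close>).

  The identity says that the vectors \<open>(p\<^sub>z, p\<^sub>y, q, s)\<close>, as \<open>(z, y)\<close> varies, are orthogonal in
  four-space to the vectors \<open>(z1, y1, h, g)\<close>, as \<open>(z1, y1)\<close> varies. The latter span at least a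
  plane, so the former span at most a plane. If \<open>p\<^sub>z\<close> and \<open>p\<^sub>y\<close> are linearly independent, both
  spans are planes, hence \<open>g\<close> and \<open>h\<close> are linear in \<open>z1, y1\<close>, and \<open>q, s\<close> are determined by the
  gradient of \<open>p\<close>: this is the second normal form (\<open>ii_from_independence\<close>). If they are
  dependent, then, as \<open>W \<noteq> 0\<close>, all vectors \<open>(p\<^sub>z, p\<^sub>y, q, s)\<close> are multiples
  \<open>\<psi> (b, a, \<lambda>, -\<mu>)\<close> of one constant vector. Here \<open>\<psi>\<close> is not identically zero, because otherwise
  \<open>F\<close> and \<open>G\<close> would not depend on \<open>z\<close> and \<open>y\<close>; so \<open>p = \<phi>(a y + b z)\<close> with \<open>\<phi>' = \<psi>\<close>, and this is
  the first normal form (\<open>i_from_dependence\<close>). In both cases Cramer's rule turns the two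
  remaining equations into the formulas for the system (\<open>solve_i\<close>, \<open>solve_ii\<close>).

  Conversely, for both normal forms the identity holds, and where \<open>W \<noteq> 0\<close> the two linear
  equations are equivalent to the system by Cramer's rule
  (\<open>case_i_describes_surfaces\<close>, \<open>case_ii_describes_surfaces\<close>).

  The analytic part is the smoothness of the Goursat solution. A continuous solution comes from
  a contraction on a small square. The \<open>x\<close>-derivatives of \<open>u\<^sub>x, v\<^sub>x\<close> solve an equation of the
  same kind as \<open>u\<^sub>x, v\<^sub>x\<close> themselves, with the same bound, so that one square serves for all orders
  (\<open>flow_differentiable_in_x\<close>, \<open>flow_ndiff\<close>).
\<close>

section \<open>Calculus of smooth functions\<close>

abbreviation fd :: "('a::real_normed_vector \<Rightarrow> real) \<Rightarrow> 'a \<Rightarrow> 'a \<Rightarrow> real" where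
  "fd f x v \<equiv> frechet_derivative f (at x) v"

lemma fd_has_derivative:
  "f differentiable (at x) \<Longrightarrow> (f has_derivative fd f x) (at x)"
  by (simp add: frechet_derivative_works)

lemma fd_eqI: "(f has_derivative f') (at x) \<Longrightarrow> fd f x v = f' v"
  by (metis frechet_derivative_at)

lemma ndiff_on_cong:
  assumes "open S" "\<And>x. x \<in> S \<Longrightarrow> f x = g x"
  shows "ndiff_on k f S \<longleftrightarrow> ndiff_on k g S"
  using assms(2)
proof (induction k arbitrary: f g)
  case 0
  then show ?case by (simp cong: continuous_on_cong)
next
  case (Suc k)
  have d: "f differentiable (at x) \<longleftrightarrow> g differentiable (at x)" if "x \<in> S" for x
    using that Suc.prems assms(1)
    by (metis (no_types, lifting) differentiable_def has_derivative_transform_within_open)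
  have e: "fd f x v = fd g x v" if "x \<in> S" "f differentiable (at x)" for x v
    using frechet_derivative_transform_within_open[OF that(2) assms(1) that(1)] Suc.prems by simp
  have "ndiff_on k (\<lambda>x. fd f x v) S \<longleftrightarrow> ndiff_on k (\<lambda>x. fd g x v) S"
    if "\<forall>x\<in>S. f differentiable (at x)" for v
    by (rule Suc.IH) (use e that in auto)
  then show ?case using d by auto
qed

lemma ndiff_on_subset: "ndiff_on k f S \<Longrightarrow> S' \<subseteq> S \<Longrightarrow> ndiff_on k f S'"
  by (induction k arbitrary: f) (auto intro: continuous_on_subset)

lemma ndiff_on_SucD: "ndiff_on (Suc k) f S \<Longrightarrow> ndiff_on k f S"
proof (induction k arbitrary: f)
  case 0
  then show ?case
    by (simp add: continuous_at_imp_continuous_on differentiable_imp_continuous_within)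
qed auto

lemma ndiff_on_le: "ndiff_on k f S \<Longrightarrow> j \<le> k \<Longrightarrow> ndiff_on j f S"
  by (induction k) (auto simp: le_Suc_eq dest: ndiff_on_SucD simp del: ndiff_on.simps(2))

lemma ndiff_on_continuous: "ndiff_on k f S \<Longrightarrow> continuous_on S f"
  using ndiff_on_le[of k f S 0] by simp

lemma ndiff_on_const: "ndiff_on k (\<lambda>x. c) S"
  by (induction k arbitrary: c) (auto simp: frechet_derivative_const)

lemma ndiff_on_linear:
  assumes "bounded_linear f" shows "ndiff_on k f S"
proof (cases k)
  case 0
  then show ?thesis using assms by (simp add: linear_continuous_on)
next
  case (Suc j)
  have "fd f x = f" for x
    by (metis assms bounded_linear_imp_has_derivative frechet_derivative_at)
  then show ?thesis
    using Suc assms by (auto simp: ndiff_on_const bounded_linear_imp_differentiable)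
qed

lemma ndiff_on_add:
  assumes "open S"
  shows "ndiff_on k f S \<Longrightarrow> ndiff_on k g S \<Longrightarrow> ndiff_on k (\<lambda>x. f x + g x) S"
proof (induction k arbitrary: f g)
  case 0
  then show ?case by (simp add: continuous_on_add)
next
  case (Suc k)
  have "fd (\<lambda>x. f x + g x) x v = fd f x v + fd g x v" if "x \<in> S" for x v
    by (rule fd_eqI) (use that Suc.prems in \<open>auto intro!: derivative_eq_intros fd_has_derivative\<close>)
  then have "ndiff_on k (\<lambda>x. fd (\<lambda>x. f x + g x) x v) S" for v
    by (subst ndiff_on_cong[OF assms, where g = "\<lambda>x. fd f x v + fd g x v"]) (use Suc in auto)
  then show ?case using Suc.prems by auto
qed

lemma ndiff_on_mult:
  assumes "open S"
  shows "ndiff_on k f S \<Longrightarrow> ndiff_on k g S \<Longrightarrow> ndiff_on k (\<lambda>x. f x * g x) S"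
proof (induction k arbitrary: f g)
  case 0
  then show ?case by (simp add: continuous_on_mult)
next
  case (Suc k)
  have "fd (\<lambda>x. f x * g x) x v = f x * fd g x v + fd f x v * g x" if "x \<in> S" for x v
    by (rule fd_eqI) (use that Suc.prems in \<open>auto intro!: derivative_eq_intros fd_has_derivative\<close>)
  moreover have "ndiff_on k (\<lambda>x. f x * fd g x v + fd f x v * g x) S" for v
    using Suc.prems ndiff_on_SucD[OF Suc.prems(1)] ndiff_on_SucD[OF Suc.prems(2)]
    by (intro ndiff_on_add[OF assms] Suc.IH) auto
  ultimately have "ndiff_on k (\<lambda>x. fd (\<lambda>x. f x * g x) x v) S" for v
    by (subst ndiff_on_cong[OF assms, where g = "\<lambda>x. f x * fd g x v + fd f x v * g x"]) auto
  then show ?case using Suc.prems by auto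
qed

lemma ndiff_on_sum:
  assumes "open S" "\<And>i. i \<in> I \<Longrightarrow> ndiff_on k (f i) S"
  shows "ndiff_on k (\<lambda>x. \<Sum>i\<in>I. f i x) S"
  using assms(2)
  by (induction I rule: infinite_finite_induct) (auto intro!: ndiff_on_add[OF assms(1)] simp: ndiff_on_const)

lemma componentwise_has_derivative:
  fixes g :: "'a::real_normed_vector \<Rightarrow> 'b::euclidean_space"
  assumes "\<And>b. b \<in> Basis \<Longrightarrow> (\<lambda>x. g x \<bullet> b) differentiable (at x)"
  shows "(g has_derivative (\<lambda>v. \<Sum>b\<in>Basis. fd (\<lambda>x. g x \<bullet> b) x v *\<^sub>R b)) (at x)"
  unfolding has_derivative_componentwise_within[where f = g]
  using assms by (auto simp: inner_sum_left inner_Basis if_distrib cong: if_cong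
      intro: fd_has_derivative)

text \<open>The chain rule expresses a directional derivative of \<open>f \<circ> g\<close> as a sum of products of
  a composite with \<open>g\<close> and a derivative of a component of \<open>g\<close>; so the order of
  differentiability goes up by one whenever it does for both factors.\<close>

lemma ndiff_on_compose:
  fixes g :: "'a::real_normed_vector \<Rightarrow> 'b::euclidean_space"
  assumes S: "open S" and gST: "g ` S \<subseteq> T"
  shows "ndiff_on k f T \<Longrightarrow> (\<And>b. b \<in> Basis \<Longrightarrow> ndiff_on k (\<lambda>x. g x \<bullet> b) S)
    \<Longrightarrow> ndiff_on k (\<lambda>x. f (g x)) S"
proof (induction k arbitrary: f)
  case 0
  have "continuous_on S g"
    using 0(2) by (auto simp: continuous_on_componentwise[of S g])
  then show ?case using 0(1) gST by (auto intro: continuous_on_compose2)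
next
  case (Suc k)
  let ?g' = "\<lambda>x v. \<Sum>b\<in>Basis. fd (\<lambda>x. g x \<bullet> b) x v *\<^sub>R b"
  have hd: "((\<lambda>x. f (g x)) has_derivative (\<lambda>v. fd f (g x) (?g' x v))) (at x)" if "x \<in> S" for x
  proof -
    have "(g has_derivative ?g' x) (at x)"
      by (rule componentwise_has_derivative) (use that Suc.prems in auto)
    moreover have "(f has_derivative fd f (g x)) (at (g x))"
      by (rule fd_has_derivative) (use that Suc.prems gST in auto)
    ultimately show ?thesis using diff_chain_at[of g] by (fastforce simp: o_def)
  qed
  have eq: "fd (\<lambda>x. f (g x)) x v = (\<Sum>b\<in>Basis. fd (\<lambda>x. g x \<bullet> b) x v * fd f (g x) b)"
    if "x \<in> S" for x v
  proof -
    have "bounded_linear (fd f (g x))"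
      by (rule has_derivative_bounded_linear[OF fd_has_derivative]) (use that Suc.prems gST in auto)
    then interpret bounded_linear "fd f (g x)" .
    show ?thesis using fd_eqI[OF hd[OF that], of v] by (simp add: sum scaleR)
  qed
  have "ndiff_on k (\<lambda>x. fd f (g x) b) S" for b
    by (rule Suc.IH) (use Suc.prems(1) ndiff_on_SucD[OF Suc.prems(2)] in auto)
  moreover have "ndiff_on k (\<lambda>x. fd (\<lambda>x. g x \<bullet> b) x v) S" if "b \<in> Basis" for b v
    using Suc.prems(2)[OF that] by auto
  ultimately have "ndiff_on k (\<lambda>x. \<Sum>b\<in>Basis. fd (\<lambda>x. g x \<bullet> b) x v * fd f (g x) b) S" for v
    by (intro ndiff_on_sum[OF S] ndiff_on_mult[OF S])
  then have "ndiff_on k (\<lambda>x. fd (\<lambda>x. f (g x)) x v) S" for v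
    by (subst ndiff_on_cong[OF S eq]) auto
  then show ?case using hd by (auto simp: differentiable_def)
qed

lemma smooth_on_subset: "smooth_on f S \<Longrightarrow> S' \<subseteq> S \<Longrightarrow> smooth_on f S'"
  by (auto simp: smooth_on_def intro: ndiff_on_subset)

lemma smooth_on_cong:
  "open S \<Longrightarrow> (\<And>x. x \<in> S \<Longrightarrow> f x = g x) \<Longrightarrow> smooth_on f S \<longleftrightarrow> smooth_on g S"
  unfolding smooth_on_def using ndiff_on_cong by blast

lemma smooth_on_const: "smooth_on (\<lambda>x. c) S"
  and smooth_on_linear: "bounded_linear f \<Longrightarrow> smooth_on f S"
  by (auto simp: smooth_on_def ndiff_on_const ndiff_on_linear)

lemma smooth_on_add:
  "open S \<Longrightarrow> smooth_on f S \<Longrightarrow> smooth_on g S \<Longrightarrow> smooth_on (\<lambda>x. f x + g x) S"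
  and smooth_on_mult:
  "open S \<Longrightarrow> smooth_on f S \<Longrightarrow> smooth_on g S \<Longrightarrow> smooth_on (\<lambda>x. f x * g x) S"
  by (auto simp: smooth_on_def ndiff_on_add ndiff_on_mult)

lemma smooth_on_cmult: "open S \<Longrightarrow> smooth_on f S \<Longrightarrow> smooth_on (\<lambda>x. c * f x) S"
  by (intro smooth_on_mult smooth_on_const)

lemma smooth_on_minus: "open S \<Longrightarrow> smooth_on f S \<Longrightarrow> smooth_on (\<lambda>x. - f x) S"
  using smooth_on_cmult[of S f "-1"] by simp

lemma smooth_on_diff:
  "open S \<Longrightarrow> smooth_on f S \<Longrightarrow> smooth_on g S \<Longrightarrow> smooth_on (\<lambda>x. f x - g x) S"
  using smooth_on_add[of S f "\<lambda>x. - g x"] smooth_on_minus by fastforce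

lemma smooth_on_compose:
  fixes g :: "'a::real_normed_vector \<Rightarrow> 'b::euclidean_space"
  assumes "open S" "g ` S \<subseteq> T" "smooth_on f T" "\<And>b. b \<in> Basis \<Longrightarrow> smooth_on (\<lambda>x. g x \<bullet> b) S"
  shows "smooth_on (\<lambda>x. f (g x)) S"
  unfolding smooth_on_def
proof
  show "ndiff_on k (\<lambda>x. f (g x)) S" for k
    by (rule ndiff_on_compose[OF assms(1,2)]) (use assms(3,4) in \<open>auto simp: smooth_on_def\<close>)
qed

lemma smooth_on_differentiable: "smooth_on f S \<Longrightarrow> x \<in> S \<Longrightarrow> f differentiable (at x)"
  unfolding smooth_on_def by (metis ndiff_on.simps(2))

lemma smooth_on_fd: "smooth_on f S \<Longrightarrow> smooth_on (\<lambda>x. fd f x v) S"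
  unfolding smooth_on_def by (metis ndiff_on.simps(2))

lemma smooth_on_continuous: "smooth_on f S \<Longrightarrow> continuous_on S f"
  unfolding smooth_on_def by (metis ndiff_on.simps(1))

subsection \<open>Partial derivatives\<close>

lemma has_real_derivative_along:
  assumes "(f has_derivative f') (at (g s))" "(g has_vector_derivative v) (at s)"
  shows "((\<lambda>s. f (g s)) has_real_derivative f' v) (at s)"
proof -
  have "((\<lambda>s. f (g s)) has_derivative (\<lambda>h. f' (h *\<^sub>R v))) (at s)"
    using diff_chain_at[of g _ s f f'] assms by (simp add: o_def has_vector_derivative_def)
  moreover have "f' (h *\<^sub>R v) = f' v * h" for h
    using has_derivative_bounded_linear[OF assms(1)]
    by (simp add: bounded_linear.linear linear_cmul)
  ultimately show ?thesis by (simp add: has_field_derivative_def)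
qed

lemma
  assumes "f differentiable (at q)"
  shows pd1_eq_fd: "pd1 f q = fd f q (1, 0)" and pd2_eq_fd: "pd2 f q = fd f q (0, 1)"
proof -
  obtain r s where q: "q = (r, s)" by (cases q)
  have 1: "((\<lambda>r'. (r', s)) has_vector_derivative (1, 0)) (at r)"
    and 2: "((\<lambda>s'. (r, s')) has_vector_derivative (0, 1)) (at s)"
    by (auto intro!: derivative_eq_intros)
  show "pd1 f q = fd f q (1, 0)" "pd2 f q = fd f q (0, 1)"
    unfolding q pd1_def pd2_def
    using has_real_derivative_along[of f "fd f q", OF _ 1] has_real_derivative_along[of f "fd f q", OF _ 2]
      fd_has_derivative[OF assms] q by (auto intro: DERIV_imp_deriv)
qed

lemma fd_prod2:
  assumes "f differentiable (at q)"
  shows "fd f q (a, b) = a * pd1 f q + b * pd2 f q"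
proof -
  interpret bounded_linear "fd f q"
    using has_derivative_bounded_linear[OF fd_has_derivative[OF assms]] .
  have "(a, b) = a *\<^sub>R (1, 0) + b *\<^sub>R (0, 1 :: real)" by simp
  then show ?thesis
    unfolding pd1_eq_fd[OF assms] pd2_eq_fd[OF assms] by (metis add scaleR real_scaleR_def)
qed

lemma
  assumes "(f has_derivative (\<lambda>(a, b). a * c + b * d)) (at q)"
  shows pd1_eqI: "pd1 f q = c" and pd2_eqI: "pd2 f q = d"
proof -
  have "f differentiable (at q)" using assms by (auto simp: differentiable_def)
  then show "pd1 f q = c" "pd2 f q = d"
    using fd_eqI[OF assms] by (simp_all add: pd1_eq_fd pd2_eq_fd)
qed

lemma smooth_on_pd1: "open S \<Longrightarrow> smooth_on f S \<Longrightarrow> smooth_on (pd1 f) S"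
  using smooth_on_fd[of f S "(1, 0)"] smooth_on_cong[of S "\<lambda>x. fd f x (1, 0)" "pd1 f"]
    smooth_on_differentiable[of f S] pd1_eq_fd by auto

lemma smooth_on_pd2: "open S \<Longrightarrow> smooth_on f S \<Longrightarrow> smooth_on (pd2 f) S"
  using smooth_on_fd[of f S "(0, 1)"] smooth_on_cong[of S "\<lambda>x. fd f x (0, 1)" "pd2 f"]
    smooth_on_differentiable[of f S] pd2_eq_fd by auto

lemma
  assumes "smooth_on f S" "(x, t) \<in> S"
  shows smooth_on_DERIV_pd1: "((\<lambda>x. f (x, t)) has_real_derivative pd1 f (x, t)) (at x)"
    and smooth_on_DERIV_pd2: "((\<lambda>t. f (x, t)) has_real_derivative pd2 f (x, t)) (at t)"
proof -
  have d: "f differentiable (at (x, t))" using assms smooth_on_differentiable by blast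
  have 1: "((\<lambda>r'. (r', t)) has_vector_derivative (1, 0)) (at x)"
    and 2: "((\<lambda>s'. (x, s')) has_vector_derivative (0, 1)) (at t)"
    by (auto intro!: derivative_eq_intros)
  show "((\<lambda>x. f (x, t)) has_real_derivative pd1 f (x, t)) (at x)"
    "((\<lambda>t. f (x, t)) has_real_derivative pd2 f (x, t)) (at t)"
    using has_real_derivative_along[of f "fd f (x, t)", OF _ 1] 
      has_real_derivative_along[of f "fd f (x, t)", OF _ 2] fd_has_derivative[OF d]
    unfolding pd1_eq_fd[OF d] pd2_eq_fd[OF d] by auto
qed

lemma deriv_eq_fd: "(f::real \<Rightarrow> real) differentiable (at x) \<Longrightarrow> deriv f x = fd f x 1"
  using DERIV_deriv_iff_real_differentiable[of f x] fd_eqI[of f "(*) (deriv f x)" x 1]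
  by (simp add: has_field_derivative_def)

lemma smooth_on_deriv:
  fixes f :: "real \<Rightarrow> real"
  shows "open S \<Longrightarrow> smooth_on f S \<Longrightarrow> smooth_on (deriv f) S"
  using smooth_on_fd[of f S 1] smooth_on_cong[of S "\<lambda>x. fd f x 1" "deriv f"]
    smooth_on_differentiable[of f S] deriv_eq_fd by auto

lemma smooth_on_DERIV:
  fixes f :: "real \<Rightarrow> real"
  shows "smooth_on f S \<Longrightarrow> x \<in> S \<Longrightarrow> (f has_real_derivative deriv f x) (at x)"
  by (simp add: DERIV_deriv_iff_real_differentiable smooth_on_differentiable)

text \<open>Together with the lemma after it, this reduces \<open>k\<close>-fold differentiability in the plane to
  statements about derivatives in one variable.\<close>

lemma has_derivative_of_partials:
  fixes f :: "real \<times> real \<Rightarrow> real"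
  assumes S: "open S"
    and 1: "\<And>x t. (x, t) \<in> S \<Longrightarrow> ((\<lambda>x. f (x, t)) has_real_derivative f1 (x, t)) (at x)"
    and 2: "\<And>x t. (x, t) \<in> S \<Longrightarrow> ((\<lambda>t. f (x, t)) has_real_derivative f2 (x, t)) (at t)"
    and c: "continuous_on S f2" and q: "q \<in> S"
  shows "(f has_derivative (\<lambda>(a, b). a * f1 q + b * f2 q)) (at q)"
proof -
  obtain x0 t0 where q': "q = (x0, t0)" by (cases q)
  obtain X Y where XY': "open X" "open Y" "q \<in> X \<times> Y" "X \<times> Y \<subseteq> S"
    by (rule open_prod_elim[OF S q])
  then have XY: "open X" "open Y" "x0 \<in> X" "t0 \<in> Y" "X \<times> Y \<subseteq> S"
    by (simp_all add: q')
  obtain e where e: "e > 0" "ball t0 e \<subseteq> Y" using XY open_contains_ball by blast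
  let ?Y = "ball t0 e"
  have sub: "X \<times> ?Y \<subseteq> S" using XY e by blast
  have cf2: "continuous (at (x0, t0) within X \<times> ?Y) f2"
    using c XY e S q q' by (metis continuous_on_eq_continuous_at continuous_at_imp_continuous_at_within)
  have "((\<lambda>(x, y). f (x, y)) has_derivative (\<lambda>(tx, ty). (f1 (x0,t0)) * tx + (blinfun_scaleR_left (f2 (x0, t0))) ty))
      (at (x0, t0) within X \<times> ?Y)"
  proof (rule has_derivative_partialsI)
    show "((\<lambda>x. f (x, t0)) has_derivative (*) (f1 (x0, t0))) (at x0 within X)"
      using 1[of x0 t0] q q' by (simp add: has_field_derivative_def has_derivative_at_withinI)
    show "((\<lambda>y. f (x, y)) has_derivative blinfun_apply (blinfun_scaleR_left (f2 (x, y)))) (at y within ?Y)"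
      if "x \<in> X" "y \<in> ?Y" for x y
    proof -
      have "((\<lambda>t. f (x, t)) has_real_derivative f2 (x, y)) (at y)" 
        by (rule 2) (use sub that in auto)
      then have "((\<lambda>t. f (x, t)) has_derivative (\<lambda>h. h * f2 (x, y))) (at y)"
        by (simp add: has_field_derivative_def mult.commute[of _ "f2 (x, y)"])
      then show ?thesis by (simp add: has_derivative_at_withinI)
    qed
    show "continuous (at (x0, t0) within X \<times> ?Y) (\<lambda>(x, y). blinfun_scaleR_left (f2 (x, y)))"
      using bounded_linear.continuous[OF bounded_linear_blinfun_scaleR_left cf2]
      by (simp add: case_prod_beta')
  qed (use e in auto)
  moreover have "(\<lambda>(x, y). f (x, y)) = f" by auto
  moreover have "at (x0, t0) within X \<times> ?Y = at (x0, t0)"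
    by (rule at_within_open) (use XY e in \<open>auto intro: open_Times\<close>)
  moreover have "(\<lambda>(tx, ty). (f1 (x0,t0)) * tx + (blinfun_scaleR_left (f2 (x0, t0))) ty)
      = (\<lambda>(a, b). a * f1 q + b * f2 q)"
    by (auto simp: q' mult.commute)
  ultimately show ?thesis by (simp add: q')
qed

lemma ndiff_on_SucI:
  fixes f :: "real \<times> real \<Rightarrow> real"
  assumes S: "open S"
    and 1: "\<And>x t. (x, t) \<in> S \<Longrightarrow> ((\<lambda>x. f (x, t)) has_real_derivative f1 (x, t)) (at x)"
    and 2: "\<And>x t. (x, t) \<in> S \<Longrightarrow> ((\<lambda>t. f (x, t)) has_real_derivative f2 (x, t)) (at t)"
    and n: "ndiff_on k f1 S" "ndiff_on k f2 S"
  shows "ndiff_on (Suc k) f S"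
proof -
  have hd: "(f has_derivative (\<lambda>(a, b). a * f1 q + b * f2 q)) (at q)" if "q \<in> S" for q
    using has_derivative_of_partials[OF S 1 2 ndiff_on_continuous[OF n(2)] that] by simp
  have "fd f q v = fst v * f1 q + snd v * f2 q" if "q \<in> S" for q v
    using fd_eqI[OF hd[OF that], of v] by (simp add: case_prod_beta)
  moreover have "ndiff_on k (\<lambda>q. fst v * f1 q + snd v * f2 q) S" for v
    by (intro ndiff_on_add[OF S] ndiff_on_mult[OF S] ndiff_on_const n)
  ultimately have "ndiff_on k (\<lambda>q. fd f q v) S" for v
    by (subst ndiff_on_cong[OF S]) auto
  moreover have "f differentiable (at q)" if "q \<in> S" for q
    using hd[OF that] by (auto simp only: differentiable_def)
  ultimately show ?thesis by simp
qed

lemma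
  assumes "f differentiable (at w)"
  shows pd1_cmult: "pd1 (\<lambda>w. c * f w) w = c * pd1 f w" and pd2_cmult: "pd2 (\<lambda>w. c * f w) w = c * pd2 f w"
proof -
  have "((\<lambda>w. c * f w) has_derivative (\<lambda>v. c * fd f w v)) (at w)"
    by (intro has_derivative_mult_right fd_has_derivative assms)
  then show "pd1 (\<lambda>w. c * f w) w = c * pd1 f w" "pd2 (\<lambda>w. c * f w) w = c * pd2 f w"
    using pd1_eq_fd[OF assms] pd2_eq_fd[OF assms] pd1_eq_fd pd2_eq_fd fd_eqI by (metis differentiable_def)+
qed

lemma
  assumes "f differentiable (at w)" "g differentiable (at w)"
  shows pd1_lincomb: "pd1 (\<lambda>w. c * f w + d * g w) w = c * pd1 f w + d * pd1 g w"
    and pd2_lincomb: "pd2 (\<lambda>w. c * f w + d * g w) w = c * pd2 f w + d * pd2 g w"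
    and pd1_squares: "pd1 (\<lambda>w. (f w)\<^sup>2 - c * (g w)\<^sup>2) w = 2 * f w * pd1 f w - c * (2 * g w * pd1 g w)"
    and pd2_squares: "pd2 (\<lambda>w. (f w)\<^sup>2 - c * (g w)\<^sup>2) w = 2 * f w * pd2 f w - c * (2 * g w * pd2 g w)"
proof -
  have 1: "((\<lambda>w. c * f w + d * g w) has_derivative (\<lambda>v. c * fd f w v + d * fd g w v)) (at w)"
    by (intro has_derivative_add has_derivative_mult_right fd_has_derivative assms)
  then have d1: "(\<lambda>w. c * f w + d * g w) differentiable (at w)" unfolding differentiable_def by blast
  show "pd1 (\<lambda>w. c * f w + d * g w) w = c * pd1 f w + d * pd1 g w"
    "pd2 (\<lambda>w. c * f w + d * g w) w = c * pd2 f w + d * pd2 g w"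
    unfolding pd1_eq_fd[OF d1] pd2_eq_fd[OF d1] fd_eqI[OF 1] pd1_eq_fd[OF assms(1)] pd2_eq_fd[OF assms(1)]
      pd1_eq_fd[OF assms(2)] pd2_eq_fd[OF assms(2)] by (rule refl)+
  have 2: "((\<lambda>w. (f w)\<^sup>2 - c * (g w)\<^sup>2) has_derivative (\<lambda>v. 2 * f w * fd f w v - c * (2 * g w * fd g w v))) (at w)"
    by (auto intro!: derivative_eq_intros fd_has_derivative assms)
  then have d2: "(\<lambda>w. (f w)\<^sup>2 - c * (g w)\<^sup>2) differentiable (at w)" unfolding differentiable_def by blast
  show "pd1 (\<lambda>w. (f w)\<^sup>2 - c * (g w)\<^sup>2) w = 2 * f w * pd1 f w - c * (2 * g w * pd1 g w)"
    "pd2 (\<lambda>w. (f w)\<^sup>2 - c * (g w)\<^sup>2) w = 2 * f w * pd2 f w - c * (2 * g w * pd2 g w)"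
    unfolding pd1_eq_fd[OF d2] pd2_eq_fd[OF d2] fd_eqI[OF 2] pd1_eq_fd[OF assms(1)] pd2_eq_fd[OF assms(1)]
      pd1_eq_fd[OF assms(2)] pd2_eq_fd[OF assms(2)] by (rule refl)+
qed

lemma
  assumes S: "open S" and w: "w \<in> S" and p: "\<And>w. w \<in> S \<Longrightarrow> p w = c * fst w + d * snd w + k"
  shows pd1_affine: "pd1 p w = c" and pd2_affine: "pd2 p w = d"
proof -
  have "((\<lambda>w. c * fst w + d * snd w + k) has_derivative (\<lambda>(a, b). a * c + b * d)) (at w)"
    by (auto intro!: derivative_eq_intros)
  then have "(p has_derivative (\<lambda>(a, b). a * c + b * d)) (at w)"
    by (rule has_derivative_transform_within_open[OF _ S w]) (simp add: p)
  then show "pd1 p w = c" "pd2 p w = d" by (rule pd1_eqI, rule pd2_eqI)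
qed

lemma
  assumes S: "open S" "w \<in> S" and eq: "\<And>w. w \<in> S \<Longrightarrow> f w = f' w" and d: "f' differentiable (at w)"
  shows pd1_cong: "pd1 f w = pd1 f' w" and pd2_cong: "pd2 f w = pd2 f' w"
proof -
  have h: "(f has_derivative fd f' w) (at w)"
    by (rule has_derivative_transform_within_open[OF fd_has_derivative[OF d] S]) (simp add: eq)
  then have d': "f differentiable (at w)" unfolding differentiable_def by blast
  show "pd1 f w = pd1 f' w" "pd2 f w = pd2 f' w"
    unfolding pd1_eq_fd[OF d'] pd2_eq_fd[OF d'] pd1_eq_fd[OF d] pd2_eq_fd[OF d] fd_eqI[OF h] by (rule refl)+
qed

lemma ndiff_on_compose_pair:
  fixes f :: "real \<times> real \<Rightarrow> real"
  assumes "open S" "\<And>x. x \<in> S \<Longrightarrow> (a x, b x) \<in> T" "ndiff_on k f T" "ndiff_on k a S" "ndiff_on k b S"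
  shows "ndiff_on k (\<lambda>x. f (a x, b x)) S"
  by (rule ndiff_on_compose[where g = "\<lambda>x. (a x, b x)", OF assms(1) _ assms(3)])
    (use assms in \<open>auto simp: Basis_prod_def\<close>)

lemma ndiff_on_compose_jet:
  fixes f :: "jet_pt \<Rightarrow> real"
  assumes "open S" "\<And>x. x \<in> S \<Longrightarrow> (a x, b x, c x, d x) \<in> T" "ndiff_on k f T"
    "ndiff_on k a S" "ndiff_on k b S" "ndiff_on k c S" "ndiff_on k d S"
  shows "ndiff_on k (\<lambda>x. f (a x, b x, c x, d x)) S"
  by (rule ndiff_on_compose[where g = "\<lambda>x. (a x, b x, c x, d x)", OF assms(1) _ assms(3)])
    (use assms in \<open>auto simp: Basis_prod_def\<close>)

lemma smooth_on_compose_pair: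
  fixes f :: "real \<times> real \<Rightarrow> real"
  assumes "open S" "\<And>x. x \<in> S \<Longrightarrow> (a x, b x) \<in> T" "smooth_on f T" "smooth_on a S" "smooth_on b S"
  shows "smooth_on (\<lambda>x. f (a x, b x)) S"
  using assms ndiff_on_compose_pair[of S a b T _ f] by (auto simp: smooth_on_def)

lemma smooth_on_compose_jet:
  fixes f :: "jet_pt \<Rightarrow> real"
  assumes "open S" "\<And>x. x \<in> S \<Longrightarrow> (a x, b x, c x, d x) \<in> T" "smooth_on f T"
    "smooth_on a S" "smooth_on b S" "smooth_on c S" "smooth_on d S"
  shows "smooth_on (\<lambda>x. f (a x, b x, c x, d x)) S"
  using assms ndiff_on_compose_jet[of S a b c d T _ f] by (auto simp: smooth_on_def)

abbreviation e1 :: jet_pt where "e1 \<equiv> (1, 0, 0, 0)"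
abbreviation e2 :: jet_pt where "e2 \<equiv> (0, 1, 0, 0)"
abbreviation e3 :: jet_pt where "e3 \<equiv> (0, 0, 1, 0)"
abbreviation e4 :: jet_pt where "e4 \<equiv> (0, 0, 0, 1)"

lemma fd_jet:
  assumes "f differentiable (at X)"
  shows "fd f X (a, b, c, d) = a * fd f X e1 + b * fd f X e2 + c * fd f X e3 + d * fd f X e4"
proof -
  interpret bounded_linear "fd f X"
    using has_derivative_bounded_linear[OF fd_has_derivative[OF assms]] .
  have "(a, b, c, d) = a *\<^sub>R e1 + b *\<^sub>R e2 + c *\<^sub>R e3 + d *\<^sub>R e4" by simp
  then have "fd f X (a, b, c, d) = fd f X (a *\<^sub>R e1 + b *\<^sub>R e2 + c *\<^sub>R e3 + d *\<^sub>R e4)" by (rule arg_cong)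
  then show ?thesis by (simp only: add scaleR real_scaleR_def)
qed

lemma ndiff_on_Suc_differentiable: "ndiff_on (Suc k) f S \<Longrightarrow> x \<in> S \<Longrightarrow> f differentiable (at x)"
  and ndiff_on_Suc_fd: "ndiff_on (Suc k) f S \<Longrightarrow> ndiff_on k (\<lambda>x. fd f x v) S"
  by auto

lemma mean_value_segment:
  fixes f :: "'a::real_normed_vector \<Rightarrow> real"
  assumes "\<And>y. y \<in> closed_segment a b \<Longrightarrow> f differentiable (at y)"
  obtains c where "c \<in> closed_segment a b" "f b - f a = fd f c (b - a)"
proof -
  define g where "g \<theta> = a + \<theta> *\<^sub>R (b - a)" for \<theta>
  have g: "g \<theta> \<in> closed_segment a b" if "0 \<le> \<theta>" "\<theta> \<le> 1" for \<theta>
    using that unfolding g_def closed_segment_def by (auto intro!: exI[of _ \<theta>] simp: algebra_simps)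
  have "\<exists>\<theta>\<in>{0<..<1}. f (g 1) - f (g 0) = (1 - 0) * fd f (g \<theta>) (b - a)"
  proof (rule mvt_simple)
    fix \<theta> :: real assume \<theta>: "0 \<le> \<theta>" "\<theta> \<le> 1"
    have "(g has_vector_derivative (b - a)) (at \<theta>)"
      unfolding g_def by (auto intro!: derivative_eq_intros)
    then have "((\<lambda>\<theta>. f (g \<theta>)) has_real_derivative fd f (g \<theta>) (b - a)) (at \<theta>)"
      using has_real_derivative_along fd_has_derivative assms g[OF \<theta>] by blast
    then show "((\<lambda>\<theta>. f (g \<theta>)) has_derivative (\<lambda>h. h * fd f (g \<theta>) (b - a))) (at \<theta> within {0..1})"
      by (simp add: has_field_derivative_def has_derivative_at_withinI mult_commute_abs)
  qed simp
  then obtain \<theta> where \<theta>: "\<theta> \<in> {0<..<1}" "f (g 1) - f (g 0) = fd f (g \<theta>) (b - a)" by auto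
  show ?thesis by (rule that[of "g \<theta>"]) (use \<theta> g[of \<theta>] in \<open>auto simp: g_def\<close>)
qed

lemma fd_eq_sum_Basis:
  fixes f :: "'a::euclidean_space \<Rightarrow> real"
  assumes "f differentiable (at x)"
  shows "fd f x v = (\<Sum>b\<in>Basis. (v \<bullet> b) * fd f x b)"
proof -
  interpret bounded_linear "fd f x"
    using has_derivative_bounded_linear[OF fd_has_derivative[OF assms]] .
  have "fd f x v = fd f x (\<Sum>b\<in>Basis. (v \<bullet> b) *\<^sub>R b)" by (simp add: euclidean_representation)
  then show ?thesis by (simp only: sum scaleR real_scaleR_def)
qed

lemma fd_bound:
  fixes f :: "'a::euclidean_space \<Rightarrow> real"
  assumes "compact K" "\<And>x. x \<in> K \<Longrightarrow> f differentiable (at x)"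
    and c: "\<And>b. b \<in> Basis \<Longrightarrow> continuous_on K (\<lambda>x. fd f x b)"
  obtains M where "0 \<le> M" "\<And>x v. x \<in> K \<Longrightarrow> \<bar>fd f x v\<bar> \<le> M * norm v"
proof -
  have "\<exists>M. \<forall>x\<in>K. \<bar>fd f x b\<bar> \<le> M" if "b \<in> Basis" for b
    using compact_imp_bounded[OF compact_continuous_image[OF c[OF that] assms(1)]]
    by (auto simp: bounded_iff)
  then obtain M where M: "\<And>b x. b \<in> Basis \<Longrightarrow> x \<in> K \<Longrightarrow> \<bar>fd f x b\<bar> \<le> M b" by metis
  have "\<bar>fd f x v\<bar> \<le> (\<Sum>b\<in>Basis. \<bar>M b\<bar>) * norm v" if "x \<in> K" for x v
  proof -
    have "\<bar>fd f x v\<bar> \<le> (\<Sum>b\<in>Basis. \<bar>(v \<bullet> b) * fd f x b\<bar>)"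
      unfolding fd_eq_sum_Basis[OF assms(2)[OF that], of v] by (rule sum_abs)
    also have "\<dots> \<le> (\<Sum>b\<in>Basis. norm v * \<bar>M b\<bar>)"
    proof (rule sum_mono)
      fix b :: 'a assume b: "b \<in> Basis"
      have "\<bar>fd f x b\<bar> \<le> \<bar>M b\<bar>" using M[OF b that] by linarith
      then show "\<bar>(v \<bullet> b) * fd f x b\<bar> \<le> norm v * \<bar>M b\<bar>"
        unfolding abs_mult using Basis_le_norm[OF b, of v] by (intro mult_mono) auto
    qed
    finally show ?thesis by (simp add: sum_distrib_left mult.commute)
  qed
  moreover have "0 \<le> (\<Sum>b\<in>Basis. \<bar>M b\<bar>)" by (intro sum_nonneg) auto
  ultimately show ?thesis using that by blast
qed

text \<open>The mean value theorem on segments of \<open>K\<close>, combined with the uniform continuity of the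
  derivative on the compact set \<open>K\<close>.\<close>

lemma uniform_linearization:
  fixes f :: "'a::euclidean_space \<Rightarrow> real"
  assumes K: "compact K" "convex K" and df: "\<And>x. x \<in> K \<Longrightarrow> f differentiable (at x)"
    and c: "\<And>b. b \<in> Basis \<Longrightarrow> continuous_on K (\<lambda>x. fd f x b)" and e: "0 < e"
  obtains d where "0 < d" "\<And>x y. x \<in> K \<Longrightarrow> y \<in> K \<Longrightarrow> norm (y - x) < d \<Longrightarrow>
    \<bar>f y - f x - fd f x (y - x)\<bar> \<le> e * norm (y - x)"
proof -
  define e' where "e' = e / DIM('a)"
  have e': "0 < e'" using e by (simp add: e'_def)
  have "\<exists>d>0. \<forall>x\<in>K. \<forall>y\<in>K. dist y x < d \<longrightarrow> dist (fd f y b) (fd f x b) < e'" if "b \<in> Basis" for b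
    using compact_uniformly_continuous[OF c[OF that] K(1)] e' by (auto simp: uniformly_continuous_on_def)
  then obtain \<delta> where \<delta>: "\<And>b. b \<in> Basis \<Longrightarrow> \<delta> b > 0" "\<And>b x y. b \<in> Basis \<Longrightarrow> x \<in> K \<Longrightarrow> y \<in> K \<Longrightarrow>
      dist y x < \<delta> b \<Longrightarrow> dist (fd f y b) (fd f x b) < e'" by metis
  define d where "d = Min (\<delta> ` Basis)"
  have d: "0 < d" "\<And>b. b \<in> Basis \<Longrightarrow> d \<le> \<delta> b" using \<delta>(1) by (auto simp: d_def)
  show ?thesis
  proof (rule that[OF d(1)])
    fix x y assume xy: "x \<in> K" "y \<in> K" "norm (y - x) < d"
    have seg: "closed_segment x y \<subseteq> K" using xy K(2) by (simp add: closed_segment_subset)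
    obtain z where z: "z \<in> closed_segment x y" "f y - f x = fd f z (y - x)"
      by (rule mean_value_segment[of x y f]) (use seg df in auto)
    have zK: "z \<in> K" using z seg by auto
    have "dist z x \<le> norm (y - x)"
      using segment_bound(1)[OF z(1)] by (simp add: dist_norm)
    then have zx: "\<bar>fd f z b - fd f x b\<bar> \<le> e'" if "b \<in> Basis" for b
      using \<delta>(2)[OF that xy(1) zK] d(2)[OF that] xy(3) by (simp add: dist_norm)
    have "f y - f x - fd f x (y - x) = (\<Sum>b\<in>Basis. ((y - x) \<bullet> b) * (fd f z b - fd f x b))"
      unfolding z(2) fd_eq_sum_Basis[OF df[OF zK], of "y - x"] fd_eq_sum_Basis[OF df[OF xy(1)], of "y - x"]
      by (simp add: sum_subtractf right_diff_distrib)
    also have "\<bar>\<dots>\<bar> \<le> (\<Sum>b\<in>(Basis::'a set). norm (y - x) * e')"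
    proof (rule order_trans[OF sum_abs sum_mono])
      fix b :: 'a assume b: "b \<in> Basis"
      then show "\<bar>((y - x) \<bullet> b) * (fd f z b - fd f x b)\<bar> \<le> norm (y - x) * e'"
        unfolding abs_mult using Basis_le_norm[OF b, of "y - x"] zx[OF b] by (intro mult_mono) auto
    qed
    also have "\<dots> = e * norm (y - x)" by (simp add: e'_def)
    finally show "\<bar>f y - f x - fd f x (y - x)\<bar> \<le> e * norm (y - x)" .
  qed
qed

section \<open>A Goursat problem\<close>

text \<open>Banach's fixed point theorem in the supremum norm. The iterates of \<open>T\<close>, started at zero, have
  geometrically decreasing distances; only the values on \<open>S\<close> enter these distances, so the
  functions may be total.\<close>

lemma halving_map_has_fixpoint:
  fixes T :: "('q::topological_space \<Rightarrow> 'e::banach) \<Rightarrow> 'q \<Rightarrow> 'e"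
  assumes S: "compact S"
    and cont: "\<And>f. continuous_on S f \<Longrightarrow> continuous_on S (T f)"
    and contr: "\<And>f g c. continuous_on S f \<Longrightarrow> continuous_on S g \<Longrightarrow>
      (\<And>q. q \<in> S \<Longrightarrow> norm (f q - g q) \<le> c) \<Longrightarrow> (\<And>q. q \<in> S \<Longrightarrow> norm (T f q - T g q) \<le> c / 2)"
  shows "\<exists>f. continuous_on S f \<and> (\<forall>q\<in>S. T f q = f q)"
proof -
  define F where "F n = (T ^^ n) (\<lambda>_. 0)" for n
  have F_Suc: "F (Suc n) = T (F n)" for n by (simp add: F_def)
  have cF: "continuous_on S (F n)" for n
    by (induction n) (simp add: F_def, simp add: F_Suc cont)
  obtain B where B: "\<And>q. q \<in> S \<Longrightarrow> norm (F 1 q - F 0 q) \<le> B"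
  proof -
    have "compact ((\<lambda>q. F 1 q - F 0 q) ` S)"
      by (intro compact_continuous_image S continuous_intros cF)
    then obtain B where "\<forall>x\<in>(\<lambda>q. F 1 q - F 0 q) ` S. norm x \<le> B"
      by (meson bounded_iff compact_imp_bounded)
    then show ?thesis using that by auto
  qed
  have step: "norm (F (Suc n) q - F n q) \<le> B / 2 ^ n" if "q \<in> S" for n q
    using that
  proof (induction n arbitrary: q)
    case 0
    then show ?case using B by simp
  next
    case (Suc n)
    have "norm (T (F (Suc n)) q - T (F n) q) \<le> B / 2 ^ n / 2"
      by (rule contr[OF cF cF]) (use Suc in auto)
    then show ?case by (simp add: F_Suc mult.commute)
  qed
  have tail: "norm (F (n + k) q - F n q) \<le> B * (2 / 2 ^ n - 2 / 2 ^ (n + k))" if "q \<in> S" for n k q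
  proof (induction k)
    case (Suc k)
    have "norm (F (n + Suc k) q - F n q) \<le> norm (F (Suc (n + k)) q - F (n + k) q) + norm (F (n + k) q - F n q)"
      using norm_triangle_ineq[of "F (Suc (n + k)) q - F (n + k) q" "F (n + k) q - F n q"] by simp
    also have "\<dots> \<le> B / 2 ^ (n + k) + B * (2 / 2 ^ n - 2 / 2 ^ (n + k))"
      using step[OF that, of "n + k"] Suc by linarith
    also have "\<dots> = B * (2 / 2 ^ n - 2 / 2 ^ (n + Suc k))"
      by (simp add: field_simps)
    finally show ?case .
  qed simp
  have tail': "norm (F m q - F n q) \<le> \<bar>B\<bar> * 2 / 2 ^ n" if "q \<in> S" "n \<le> m" for m n q
  proof -
    have "B * (2 / 2 ^ n - 2 / 2 ^ m) \<le> \<bar>B\<bar> * (2 / 2 ^ n - 2 / 2 ^ m)"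
      using that by (intro mult_right_mono) (auto simp: field_simps power_increasing)
    also have "\<dots> \<le> \<bar>B\<bar> * (2 / 2 ^ n)" by (intro mult_left_mono) auto
    finally show ?thesis using tail[OF that(1), of n "m - n"] that by simp
  qed
  have "uniformly_Cauchy_on S F"
  proof (rule uniformly_Cauchy_onI')
    fix e :: real assume "e > 0"
    have "(\<lambda>n. \<bar>B\<bar> * 2 / 2 ^ n) \<longlonglongrightarrow> 0"
      using LIMSEQ_divide_realpow_zero[of 2 "\<bar>B\<bar> * 2"] by simp
    then obtain N where N: "\<bar>B\<bar> * 2 / 2 ^ n < e" if "n \<ge> N" for n
      using \<open>e > 0\<close> unfolding LIMSEQ_iff by fastforce
    have "dist (F m q) (F n q) < e" if "q \<in> S" "m \<ge> N" "n > m" for q m n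
      using tail'[of q m n] N[OF that(2)] that by (simp add: dist_norm norm_minus_commute[of "F m q" "F n q"])
    then show "\<exists>M. \<forall>q\<in>S. \<forall>m\<ge>M. \<forall>n>m. dist (F m q) (F n q) < e"
      by blast
  qed
  then obtain l where l: "uniform_limit S F l sequentially"
    by (auto simp: uniformly_convergent_eq_Cauchy[symmetric] uniformly_convergent_on_def)
  have cl: "continuous_on S l"
    by (rule uniform_limit_theorem[OF _ l]) (auto simp: cF)
  have "T l q = l q" if q: "q \<in> S" for q
  proof -
    have "norm (T l q - l q) \<le> e" if e: "e > 0" for e
    proof -
      have "\<forall>\<^sub>F n in sequentially. \<forall>q\<in>S. dist (F n q) (l q) < e / 2"
        using l e unfolding uniform_limit_iff by (meson half_gt_zero)
      then obtain n where n: "\<And>m q. m \<ge> n \<Longrightarrow> q \<in> S \<Longrightarrow> norm (F m q - l q) < e / 2"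
        by (auto simp: eventually_sequentially dist_norm)
      have "norm (T (F n) q - T l q) \<le> e / 2 / 2"
        by (rule contr[OF cF cl _ q]) (use n in \<open>auto intro: less_imp_le\<close>)
      moreover have "norm (T (F n) q - l q) < e / 2"
        using n[of "Suc n" q] q by (simp add: F_Suc)
      moreover have "norm (T l q - l q) \<le> norm (T (F n) q - T l q) + norm (T (F n) q - l q)"
        using norm_triangle_ineq[of "T l q - T (F n) q" "T (F n) q - l q"]
        by (simp add: norm_minus_commute)
      ultimately show ?thesis using e by linarith
    qed
    then show ?thesis by (metis eq_iff_diff_eq_0 norm_le_zero_iff dense_ge)
  qed
  then show ?thesis using cl by blast
qed

text \<open>The primitive that vanishes at \<open>0\<close>, on both sides of \<open>0\<close>. Integrating over the
  fixed interval \<open>[0, 1]\<close> makes it jointly continuous, and differentiable, in parameters.\<close>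

definition prim :: "(real \<Rightarrow> real) \<Rightarrow> real \<Rightarrow> real" where
  "prim f t = t * integral {0..1} (\<lambda>\<theta>. f (t * \<theta>))"

lemma prim_0 [simp]: "prim f 0 = 0"
  by (simp add: prim_def)

lemma mult_unit_interval:
  fixes t :: real
  assumes "0 \<le> \<theta>" "\<theta> \<le> 1" "\<bar>t\<bar> \<le> r" shows "\<bar>t * \<theta>\<bar> \<le> r"
  using assms mult_left_le[of \<theta> "\<bar>t\<bar>"] by (simp add: abs_mult)

text \<open>The fundamental theorem of calculus for \<open>\<theta> \<mapsto> G (t * \<theta>)\<close> on \<open>[0, 1]\<close>.\<close>

lemma primitive_eq_prim:
  assumes f: "continuous_on {-r..r} f" and t: "\<bar>t\<bar> \<le> r"
    and G: "\<And>s. s \<in> {-r..r} \<Longrightarrow> (G has_real_derivative f s) (at s within {-r..r})"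
  shows "prim f t = G t - G 0"
proof -
  have m: "t * \<theta> \<in> {-r..r}" if "\<theta> \<in> {0..1}" for \<theta>
    using mult_unit_interval[of \<theta> t r] that t by (auto simp: abs_le_iff)
  have "((\<lambda>\<theta>. G (t * \<theta>)) has_vector_derivative f (t * \<theta>) * t) (at \<theta> within {0..1})" if "\<theta> \<in> {0..1}" for \<theta>
  proof -
    have "(G has_real_derivative f (t * \<theta>)) (at (t * \<theta>) within (\<lambda>\<theta>. t * \<theta>) ` {0..1})"
      by (rule DERIV_subset[OF G]) (use m that in auto)
    moreover have "((\<lambda>\<theta>. t * \<theta>) has_real_derivative t) (at \<theta> within {0..1})"
      by (auto intro!: derivative_eq_intros)
    ultimately show ?thesis
      using DERIV_image_chain[of G _ "\<lambda>\<theta>. t * \<theta>" \<theta> "{0..1}" t]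
      by (simp add: o_def has_real_derivative_iff_has_vector_derivative)
  qed
  then have "((\<lambda>\<theta>. f (t * \<theta>) * t) has_integral G (t * 1) - G (t * 0)) {0..1}"
    by (intro fundamental_theorem_of_calculus) auto
  then have "integral {0..1} (\<lambda>\<theta>. f (t * \<theta>) * t) = G (t * 1) - G (t * 0)"
    by (rule integral_unique)
  then show ?thesis by (simp add: prim_def mult.commute[of t "integral _ _"])
qed

lemma prim_has_real_derivative:
  assumes f: "continuous_on {-r..r} f" and t: "\<bar>t\<bar> \<le> r"
  shows "(prim f has_real_derivative f t) (at t within {-r..r})"
proof -
  define G where "G u = integral {-r..u} f" for u
  have G: "(G has_real_derivative f s) (at s within {-r..r})" if "s \<in> {-r..r}" for s
    unfolding G_def has_real_derivative_iff_has_vector_derivative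
    by (rule integral_has_vector_derivative[OF f that])
  have "((\<lambda>s. G s - G 0) has_real_derivative f t) (at t within {-r..r})"
    using DERIV_diff[OF G DERIV_const, of t] t by (auto simp: abs_le_iff)
  then show ?thesis
    by (rule has_field_derivative_transform_within[where d = 1])
      (use t primitive_eq_prim[OF f _ G] in \<open>auto simp: abs_le_iff\<close>)
qed

lemma prim_diff_le:
  assumes f: "continuous_on {-r..r} f" and g: "continuous_on {-r..r} g" and t: "\<bar>t\<bar> \<le> r"
    and le: "\<And>s. \<bar>s\<bar> \<le> r \<Longrightarrow> \<bar>f s - g s\<bar> \<le> c"
  shows "\<bar>prim f t - prim g t\<bar> \<le> r * c"
proof -
  have m: "\<bar>t * \<theta>\<bar> \<le> r" if "\<theta> \<in> {0..1}" for \<theta>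
    using mult_unit_interval[of \<theta> t r] that t by auto
  have c: "continuous_on {0..1} (\<lambda>\<theta>. f (t * \<theta>))" "continuous_on {0..1} (\<lambda>\<theta>. g (t * \<theta>))"
    by (intro continuous_on_compose2[OF f] continuous_on_compose2[OF g] continuous_intros;
        use m in \<open>force simp: abs_le_iff\<close>)+
  have i: "(\<lambda>\<theta>. f (t * \<theta>)) integrable_on {0..1}" "(\<lambda>\<theta>. g (t * \<theta>)) integrable_on {0..1}"
    by (intro integrable_continuous_real c)+
  have "prim f t - prim g t = t * integral {0..1} (\<lambda>\<theta>. f (t * \<theta>) - g (t * \<theta>))"
    by (simp add: prim_def integral_diff i right_diff_distrib)
  moreover have "\<bar>integral {0..1} (\<lambda>\<theta>. f (t * \<theta>) - g (t * \<theta>))\<bar> \<le> c"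
    using integral_bound[OF _ continuous_on_diff[OF c], of c] le m by simp
  moreover have "0 \<le> c" using le[OF t] by linarith
  ultimately show ?thesis
    using mult_mono[OF t, of "\<bar>integral {0..1} (\<lambda>\<theta>. f (t * \<theta>) - g (t * \<theta>))\<bar>" c] t
    by (simp add: abs_mult)
qed

lemma continuous_on_prim:
  assumes w: "continuous_on S w" and m: "\<And>q \<theta>. q \<in> S \<Longrightarrow> \<theta> \<in> {0..1} \<Longrightarrow> h q (\<tau> q * \<theta>) \<in> S"
    and h: "continuous_on (S \<times> {0..1}) (\<lambda>(q, \<theta>). h q (\<tau> q * \<theta>))"
    and \<tau>: "continuous_on S \<tau>"
  shows "continuous_on S (\<lambda>q. prim (\<lambda>s. w (h q s)) (\<tau> q))"
proof -
  have "(\<lambda>(q, \<theta>). h q (\<tau> q * \<theta>)) ` (S \<times> {0..1}) \<subseteq> S"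
    by (auto intro: m)
  then have "continuous_on (S \<times> {0..1}) (\<lambda>p. w (case p of (q, \<theta>) \<Rightarrow> h q (\<tau> q * \<theta>)))"
    by (rule continuous_on_compose2[OF w h])
  then have "continuous_on (S \<times> cbox 0 1) (\<lambda>(q, \<theta>). w (h q (\<tau> q * \<theta>)))"
    by (simp add: case_prod_beta')
  then have "continuous_on S (\<lambda>q. integral {0..1} (\<lambda>\<theta>. w (h q (\<tau> q * \<theta>))))"
    using integral_continuous_on_param[where U = S and a = 0 and b = 1
        and f = "\<lambda>q \<theta>. w (h q (\<tau> q * \<theta>))"] by (simp only: box_real)
  then show ?thesis unfolding prim_def by (intro continuous_on_mult \<tau>)
qed

lemma continuous_on_prim_x:
  assumes "continuous_on S w" "\<And>x t \<theta>. (x, t) \<in> S \<Longrightarrow> \<theta> \<in> {0..1} \<Longrightarrow> (x * \<theta>, t) \<in> S"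
  shows "continuous_on S (\<lambda>q. prim (\<lambda>s. w (s, snd q)) (fst q))"
  by (rule continuous_on_prim[OF assms(1), where h = "\<lambda>q s. (s, snd q)"])
    (use assms(2) in \<open>auto simp: case_prod_beta intro!: continuous_intros\<close>)

lemma continuous_on_prim_t:
  assumes "continuous_on S w" "\<And>x t \<theta>. (x, t) \<in> S \<Longrightarrow> \<theta> \<in> {0..1} \<Longrightarrow> (x, t * \<theta>) \<in> S"
  shows "continuous_on S (\<lambda>q. prim (\<lambda>s. w (fst q, s)) (snd q))"
  by (rule continuous_on_prim[OF assms(1), where h = "\<lambda>q s. (fst q, s)"])
    (use assms(2) in \<open>auto simp: case_prod_beta intro!: continuous_intros\<close>)

abbreviation sq :: "real \<Rightarrow> (real \<times> real) set" where
  "sq r \<equiv> {-r..r} \<times> {-r..r}"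

abbreviation osq :: "real \<Rightarrow> (real \<times> real) set" where
  "osq r \<equiv> {-r<..<r} \<times> {-r<..<r}"

lemma sq_scale: "(x, t) \<in> sq r \<Longrightarrow> \<theta> \<in> {0..1} \<Longrightarrow> (x * \<theta>, t) \<in> sq r"
  "(x, t) \<in> sq r \<Longrightarrow> \<theta> \<in> {0..1} \<Longrightarrow> (x, t * \<theta>) \<in> sq r"
  using mult_unit_interval[of \<theta> x r] mult_unit_interval[of \<theta> t r] by (auto simp: abs_le_iff)

lemma norm_jet_le: "norm (a, b, c, d) \<le> \<bar>a\<bar> + \<bar>b\<bar> + \<bar>c\<bar> + \<bar>d :: real\<bar>" for a b c :: real
  using norm_Pair_le[of a "(b, c, d)"] norm_Pair_le[of b "(c, d)"] norm_Pair_le[of c d] by simp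

lemma jet_component_le_norm:
  fixes X :: jet_pt
  shows "\<bar>fst X\<bar> \<le> norm X" "\<bar>fst (snd X)\<bar> \<le> norm X"
    "\<bar>fst (snd (snd X))\<bar> \<le> norm X" "\<bar>snd (snd (snd X))\<bar> \<le> norm X"
proof -
  obtain a b c d where X: "X = (a, b, c, d)" by (cases X)
  note norm_snd_le[where x = a and y = "(b, c, d)"] norm_snd_le[where x = b and y = "(c, d)"]
    norm_fst_le[where x = a and y = "(b, c, d)"] norm_fst_le[where x = b and y = "(c, d)"]
    norm_fst_le[where x = c and y = d] norm_snd_le[where x = c and y = d]
  then show "\<bar>fst X\<bar> \<le> norm X" "\<bar>fst (snd X)\<bar> \<le> norm X"
    "\<bar>fst (snd (snd X))\<bar> \<le> norm X" "\<bar>snd (snd (snd X))\<bar> \<le> norm X"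
    unfolding X by auto
qed

text \<open>Integrating \<open>u\<^sub>x = w, v\<^sub>x = s\<close> from the \<open>t\<close>-axis and the equations for \<open>w\<^sub>t, s\<^sub>t\<close> from the \<open>x\<close>-axis
  gives a fixed point equation. Each integral contributes a factor \<open>r\<close>, and the four components
  together a factor \<open>2 * r * (1 + L)\<close>, which is at most \<open>1/2\<close>.\<close>

lemma goursat_Lipschitz:
  fixes Fh Gh :: "real \<times> real \<Rightarrow> jet_pt \<Rightarrow> real"
  assumes r: "0 < r" "4 * r * (1 + L) \<le> 1" and L: "0 \<le> L"
    and cF: "continuous_on (sq r \<times> UNIV) (\<lambda>(q, X). Fh q X)"
    and cG: "continuous_on (sq r \<times> UNIV) (\<lambda>(q, X). Gh q X)"
    and lF: "\<And>q X Y. q \<in> sq r \<Longrightarrow> \<bar>Fh q X - Fh q Y\<bar> \<le> L * norm (X - Y)"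
    and lG: "\<And>q X Y. q \<in> sq r \<Longrightarrow> \<bar>Gh q X - Gh q Y\<bar> \<le> L * norm (X - Y)"
  obtains u w v s where
    "continuous_on (sq r) u" "continuous_on (sq r) w"
    "continuous_on (sq r) v" "continuous_on (sq r) s"
    "\<And>x t. (x, t) \<in> sq r \<Longrightarrow>
      ((\<lambda>x. u (x, t)) has_real_derivative w (x, t)) (at x within {-r..r})"
    "\<And>x t. (x, t) \<in> sq r \<Longrightarrow>
      ((\<lambda>x. v (x, t)) has_real_derivative s (x, t)) (at x within {-r..r})"
    "\<And>x t. (x, t) \<in> sq r \<Longrightarrow> ((\<lambda>t. w (x, t)) has_real_derivative
      Fh (x, t) (u (x, t), w (x, t), v (x, t), s (x, t))) (at t within {-r..r})"
    "\<And>x t. (x, t) \<in> sq r \<Longrightarrow> ((\<lambda>t. s (x, t)) has_real_derivative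
      Gh (x, t) (u (x, t), w (x, t), v (x, t), s (x, t))) (at t within {-r..r})"
    "\<And>t. \<bar>t\<bar> \<le> r \<Longrightarrow> u (0, t) = z0 + p1 * t" "\<And>t. \<bar>t\<bar> \<le> r \<Longrightarrow> v (0, t) = y0 + p2 * t"
    "\<And>x. \<bar>x\<bar> \<le> r \<Longrightarrow> w (x, 0) = z1 + q1 * x" "\<And>x. \<bar>x\<bar> \<le> r \<Longrightarrow> s (x, 0) = y1 + q2 * x"
proof -
  define w' where "w' J q = fst (snd (J q))" for J :: "real \<times> real \<Rightarrow> jet_pt" and q
  define s' where "s' J q = snd (snd (snd (J q)))" for J :: "real \<times> real \<Rightarrow> jet_pt" and q
  define f' where "f' J q = Fh q (J q)" for J q
  define g' where "g' J q = Gh q (J q)" for J q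
  define K where "K J q =
      (z0 + p1 * snd q + prim (\<lambda>\<sigma>. w' J (\<sigma>, snd q)) (fst q),
       z1 + q1 * fst q + prim (\<lambda>\<sigma>. f' J (fst q, \<sigma>)) (snd q),
       y0 + p2 * snd q + prim (\<lambda>\<sigma>. s' J (\<sigma>, snd q)) (fst q),
       y1 + q2 * fst q + prim (\<lambda>\<sigma>. g' J (fst q, \<sigma>)) (snd q))"
    for J :: "real \<times> real \<Rightarrow> jet_pt" and q
  have cw: "continuous_on (sq r) (w' J)" and cs: "continuous_on (sq r) (s' J)"
    if "continuous_on (sq r) J" for J
    unfolding w'_def s'_def by (intro continuous_intros that)+
  have cf: "continuous_on (sq r) (f' J)" and cg: "continuous_on (sq r) (g' J)"
    if J: "continuous_on (sq r) J" for J
  proof -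
    have "continuous_on (sq r) (\<lambda>q. case (q, J q) of (q, X) \<Rightarrow> Fh q X)"
      by (rule continuous_on_compose2[OF cF]) (auto intro!: continuous_intros J)
    then show "continuous_on (sq r) (f' J)" by (simp add: f'_def[abs_def])
    have "continuous_on (sq r) (\<lambda>q. case (q, J q) of (q, X) \<Rightarrow> Gh q X)"
      by (rule continuous_on_compose2[OF cG]) (auto intro!: continuous_intros J)
    then show "continuous_on (sq r) (g' J)" by (simp add: g'_def[abs_def])
  qed
  have row: "continuous_on {-r..r} (\<lambda>\<sigma>. a (\<sigma>, t))" and col: "continuous_on {-r..r} (\<lambda>\<sigma>. a (t, \<sigma>))"
    if "continuous_on (sq r) a" "\<bar>t\<bar> \<le> r" for a :: "real \<times> real \<Rightarrow> real" and t
    by (rule continuous_on_compose2[OF that(1)]; use that(2) in \<open>auto intro!: continuous_intros simp: abs_le_iff\<close>)+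
  have "\<exists>J. continuous_on (sq r) J \<and> (\<forall>q\<in>sq r. K J q = J q)"
  proof (rule halving_map_has_fixpoint)
    show "compact (sq r)" by (intro compact_Times compact_Icc)
    show "continuous_on (sq r) (K J)" if "continuous_on (sq r) J" for J
      unfolding K_def
      by (intro continuous_on_Pair continuous_on_add continuous_on_mult continuous_on_const continuous_on_fst
          continuous_on_snd continuous_on_id continuous_on_prim_x continuous_on_prim_t cw cs cf cg that sq_scale)
    show "norm (K J q - K J' q) \<le> c / 2"
      if J: "continuous_on (sq r) J" "continuous_on (sq r) J'" and q: "q \<in> sq r"
        and c: "\<And>q. q \<in> sq r \<Longrightarrow> norm (J q - J' q) \<le> c" for J J' c q
    proof -
      obtain x t where xt: "q = (x, t)" "\<bar>x\<bar> \<le> r" "\<bar>t\<bar> \<le> r" using q by (cases q) auto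
      have w: "\<bar>w' J q - w' J' q\<bar> \<le> c" "\<bar>s' J q - s' J' q\<bar> \<le> c"
        "\<bar>f' J q - f' J' q\<bar> \<le> L * c" "\<bar>g' J q - g' J' q\<bar> \<le> L * c" if "q \<in> sq r" for q
        using c[OF that] jet_component_le_norm[of "J q - J' q"] lF[OF that, of "J q" "J' q"]
          lG[OF that, of "J q" "J' q"] mult_left_mono[OF c[OF that] L]
        unfolding w'_def s'_def f'_def g'_def by auto
      have "\<bar>prim (\<lambda>\<sigma>. w' J (\<sigma>, t)) x - prim (\<lambda>\<sigma>. w' J' (\<sigma>, t)) x\<bar> \<le> r * c"
        "\<bar>prim (\<lambda>\<sigma>. s' J (\<sigma>, t)) x - prim (\<lambda>\<sigma>. s' J' (\<sigma>, t)) x\<bar> \<le> r * c"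
        "\<bar>prim (\<lambda>\<sigma>. f' J (x, \<sigma>)) t - prim (\<lambda>\<sigma>. f' J' (x, \<sigma>)) t\<bar> \<le> r * (L * c)"
        "\<bar>prim (\<lambda>\<sigma>. g' J (x, \<sigma>)) t - prim (\<lambda>\<sigma>. g' J' (x, \<sigma>)) t\<bar> \<le> r * (L * c)"
        by (intro prim_diff_le row col cw cs cf cg J xt; use w xt in \<open>auto simp: abs_le_iff\<close>)+
      moreover have "norm (K J q - K J' q) \<le>
          \<bar>prim (\<lambda>\<sigma>. w' J (\<sigma>, t)) x - prim (\<lambda>\<sigma>. w' J' (\<sigma>, t)) x\<bar> +
          \<bar>prim (\<lambda>\<sigma>. f' J (x, \<sigma>)) t - prim (\<lambda>\<sigma>. f' J' (x, \<sigma>)) t\<bar> +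
          \<bar>prim (\<lambda>\<sigma>. s' J (\<sigma>, t)) x - prim (\<lambda>\<sigma>. s' J' (\<sigma>, t)) x\<bar> +
          \<bar>prim (\<lambda>\<sigma>. g' J (x, \<sigma>)) t - prim (\<lambda>\<sigma>. g' J' (x, \<sigma>)) t\<bar>"
        unfolding K_def xt using norm_jet_le by (simp add: xt)
      moreover have "0 \<le> c" using c[OF q] norm_ge_zero order_trans by blast
      then have "4 * r * (1 + L) * c \<le> 1 * c" using r by (intro mult_right_mono) auto
      ultimately show ?thesis by (simp add: algebra_simps)
    qed
  qed
  then obtain J where J: "continuous_on (sq r) J" "\<And>q. q \<in> sq r \<Longrightarrow> K J q = J q"
    by blast
  define u where "u q = fst (J q)" for q
  define v where "v q = fst (snd (snd (J q)))" for q
  have Jq: "J q = (u q, w' J q, v q, s' J q)" for q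
    by (simp add: u_def v_def w'_def s'_def)
  have fix_eq: "u q = z0 + p1 * snd q + prim (\<lambda>\<sigma>. w' J (\<sigma>, snd q)) (fst q)"
    "w' J q = z1 + q1 * fst q + prim (\<lambda>\<sigma>. f' J (fst q, \<sigma>)) (snd q)"
    "v q = y0 + p2 * snd q + prim (\<lambda>\<sigma>. s' J (\<sigma>, snd q)) (fst q)"
    "s' J q = y1 + q2 * fst q + prim (\<lambda>\<sigma>. g' J (fst q, \<sigma>)) (snd q)" if "q \<in> sq r" for q
    using J(2)[OF that] Jq[of q] unfolding K_def by auto
  have d: "(a has_real_derivative b x) (at x within {-r..r})"
    if "\<And>\<sigma>. \<sigma> \<in> {-r..r} \<Longrightarrow> a \<sigma> = k + prim b \<sigma>" "continuous_on {-r..r} b" "\<bar>x\<bar> \<le> r" for a b k x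
  proof (rule has_field_derivative_transform_within[where d = 1])
    show "((\<lambda>\<sigma>. k + prim b \<sigma>) has_real_derivative b x) (at x within {-r..r})"
      using DERIV_add[OF DERIV_const prim_has_real_derivative[OF that(2,3)]] by simp
  qed (use that in \<open>auto simp: abs_le_iff\<close>)
  show ?thesis
  proof (rule that[of u "w' J" v "s' J"])
    show "continuous_on (sq r) u" "continuous_on (sq r) v"
      unfolding u_def v_def by (intro continuous_intros J)+
    show "continuous_on (sq r) (w' J)" "continuous_on (sq r) (s' J)" using cw cs J by auto
    fix x t assume xt: "(x, t) \<in> sq r"
    then have x: "\<bar>x\<bar> \<le> r" and t: "\<bar>t\<bar> \<le> r" by auto
    show "((\<lambda>x. u (x, t)) has_real_derivative w' J (x, t)) (at x within {-r..r})"
      by (rule d[of _ "z0 + p1 * t"]) (use fix_eq(1) x t row[OF cw[OF J(1)]] in \<open>auto simp: abs_le_iff\<close>)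
    show "((\<lambda>x. v (x, t)) has_real_derivative s' J (x, t)) (at x within {-r..r})"
      by (rule d[of _ "y0 + p2 * t"]) (use fix_eq(3) x t row[OF cs[OF J(1)]] in \<open>auto simp: abs_le_iff\<close>)
    have "((\<lambda>t. w' J (x, t)) has_real_derivative f' J (x, t)) (at t within {-r..r})"
      by (rule d[of _ "z1 + q1 * x"]) (use fix_eq(2) x t col[OF cf[OF J(1)]] in \<open>auto simp: abs_le_iff\<close>)
    then show "((\<lambda>t. w' J (x, t)) has_real_derivative
      Fh (x, t) (u (x, t), w' J (x, t), v (x, t), s' J (x, t))) (at t within {-r..r})"
      unfolding Jq[symmetric] f'_def .
    have "((\<lambda>t. s' J (x, t)) has_real_derivative g' J (x, t)) (at t within {-r..r})"
      by (rule d[of _ "y1 + q2 * x"]) (use fix_eq(4) x t col[OF cg[OF J(1)]] in \<open>auto simp: abs_le_iff\<close>)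
    then show "((\<lambda>t. s' J (x, t)) has_real_derivative
      Gh (x, t) (u (x, t), w' J (x, t), v (x, t), s' J (x, t))) (at t within {-r..r})"
      unfolding Jq[symmetric] g'_def .
  qed (use fix_eq r in \<open>auto simp: abs_le_iff\<close>)
qed

text \<open>Differentiation under the integral sign, for a function that is known through its
  derivative in the other variable.\<close>

lemma has_transverse_derivative:
  assumes ux: "\<And>x t. (x, t) \<in> osq R \<Longrightarrow> ((\<lambda>x. u (x, t)) has_real_derivative w (x, t)) (at x)"
    and wt: "\<And>x t. (x, t) \<in> osq R \<Longrightarrow> ((\<lambda>t. w (x, t)) has_real_derivative n (x, t)) (at t)"
    and cw: "continuous_on (osq R) w" and cn: "continuous_on (osq R) n"
    and u0: "\<And>t. \<bar>t\<bar> < R \<Longrightarrow> ((\<lambda>t. u (0, t)) has_real_derivative \<alpha> t) (at t)"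
    and xt: "(x, t) \<in> osq R"
  shows "((\<lambda>t. u (x, t)) has_real_derivative \<alpha> t + prim (\<lambda>s. n (s, t)) x) (at t)"
proof -
  let ?U = "{-R<..<R}"
  have in_osq: "(x * \<theta>, \<tau>) \<in> osq R" if "\<theta> \<in> {0..1}" "\<tau> \<in> ?U" for \<theta> \<tau>
    using mult_unit_interval[of \<theta> x "\<bar>x\<bar>"] that xt by (auto simp: abs_le_iff abs_if split: if_splits)
  have c: "continuous_on (?U \<times> cbox 0 1) (\<lambda>(\<tau>, \<theta>). a (x * \<theta>, \<tau>))" if "continuous_on (osq R) a" for a :: "real \<times> real \<Rightarrow> real"
  proof -
    have "continuous_on (?U \<times> {0..1}) (\<lambda>p. a (case p of (\<tau>, \<theta>) \<Rightarrow> (x * \<theta>, \<tau>)))"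
      by (rule continuous_on_compose2[OF that])
        (use in_osq in \<open>auto simp: case_prod_beta' intro!: continuous_intros\<close>)
    then show ?thesis by (simp add: case_prod_beta')
  qed
  have "((\<lambda>\<tau>. integral (cbox 0 1) (\<lambda>\<theta>. w (x * \<theta>, \<tau>))) has_field_derivative
      integral (cbox 0 1) (\<lambda>\<theta>. n (x * \<theta>, t))) (at t within ?U)"
  proof (rule leibniz_rule_field_derivative)
    show "((\<lambda>\<tau>. w (x * \<theta>, \<tau>)) has_real_derivative n (x * \<theta>, \<tau>)) (at \<tau> within ?U)"
      if "\<tau> \<in> ?U" "\<theta> \<in> cbox 0 1" for \<tau> \<theta>
      using wt[OF in_osq, of \<theta> \<tau>] that by (auto intro: has_field_derivative_at_within)
    show "(\<lambda>\<theta>. w (x * \<theta>, \<tau>)) integrable_on cbox 0 1" if "\<tau> \<in> ?U" for \<tau>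
    proof -
      have "continuous_on {0..1} (\<lambda>\<theta>. w (x * \<theta>, \<tau>))"
        by (rule continuous_on_compose2[OF cw]) (use in_osq that in \<open>auto intro!: continuous_intros\<close>)
      then show ?thesis using integrable_continuous_real by simp
    qed
  qed (use c[OF cn] xt in auto)
  then have 1: "((\<lambda>\<tau>. integral {0..1} (\<lambda>\<theta>. w (x * \<theta>, \<tau>))) has_real_derivative
      integral {0..1} (\<lambda>\<theta>. n (x * \<theta>, t))) (at t)"
    using xt at_within_open[of t ?U] by simp
  have 2: "((\<lambda>\<tau>. u (0, \<tau>) + prim (\<lambda>s. w (s, \<tau>)) x) has_real_derivative
      \<alpha> t + prim (\<lambda>s. n (s, t)) x) (at t)"
    unfolding prim_def by (rule DERIV_add[OF u0 DERIV_cmult[OF 1]]) (use xt in auto)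
  have 3: "u (0, \<tau>) + prim (\<lambda>s. w (s, \<tau>)) x = u (x, \<tau>)" if "\<tau> \<in> ?U" for \<tau>
  proof -
    have sub: "(s, \<tau>) \<in> osq R" if "s \<in> {-\<bar>x\<bar>..\<bar>x\<bar>}" for s
      using that \<open>\<tau> \<in> ?U\<close> xt by (auto simp: abs_if split: if_splits)
    have "prim (\<lambda>s. w (s, \<tau>)) x = u (x, \<tau>) - u (0, \<tau>)"
    proof (rule primitive_eq_prim)
      show "continuous_on {-\<bar>x\<bar>..\<bar>x\<bar>} (\<lambda>s. w (s, \<tau>))"
        by (rule continuous_on_compose2[OF cw]) (use sub in \<open>auto intro!: continuous_intros\<close>)
      show "((\<lambda>s. u (s, \<tau>)) has_real_derivative w (s, \<tau>)) (at s within {-\<bar>x\<bar>..\<bar>x\<bar>})"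
        if "s \<in> {-\<bar>x\<bar>..\<bar>x\<bar>}" for s
        using ux[OF sub[OF that]] by (rule has_field_derivative_at_within)
    qed simp
    then show ?thesis by simp
  qed
  show ?thesis
    by (rule has_field_derivative_transform_within_open[OF 2, of ?U]) (use xt 3 in auto)
qed

lemma prim_has_derivative_in_osq:
  assumes n: "continuous_on (osq R) n" and xt: "(x, t) \<in> osq R"
  shows "((\<lambda>x. prim (\<lambda>s. n (s, t)) x) has_real_derivative n (x, t)) (at x)"
proof -
  obtain r where r: "\<bar>x\<bar> < r" "r < R" using xt dense[of "\<bar>x\<bar>" R] by (auto simp: abs_less_iff)
  have "continuous_on {-r..r} (\<lambda>s. n (s, t))"
    by (rule continuous_on_compose2[OF n]) (use r xt in \<open>auto intro!: continuous_intros\<close>)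
  then have "((\<lambda>x. prim (\<lambda>s. n (s, t)) x) has_real_derivative n (x, t)) (at x within {-r..r})"
    by (rule prim_has_real_derivative) (use r in auto)
  moreover have "at x within {-r..r} = at x"
    by (rule at_within_interior) (use r in auto)
  ultimately show ?thesis by simp
qed

lemma uniform_x_linearization:
  assumes c': "continuous_on (sq r) c'"
    and d: "\<And>x t. (x, t) \<in> sq r \<Longrightarrow> ((\<lambda>x. c (x, t)) has_real_derivative c' (x, t)) (at x within {-r..r})"
    and e: "0 < e"
  obtains d where "0 < d" "\<And>x x' t. (x, t) \<in> sq r \<Longrightarrow> (x', t) \<in> sq r \<Longrightarrow> \<bar>x' - x\<bar> < d \<Longrightarrow>
    \<bar>c (x', t) - c (x, t) - (x' - x) * c' (x, t)\<bar> \<le> e * \<bar>x' - x\<bar>"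
proof -
  have "uniformly_continuous_on (sq r) c'"
    by (rule compact_uniformly_continuous[OF c']) (intro compact_Times compact_Icc)
  then obtain \<delta> where \<delta>: "\<delta> > 0" "\<And>p q. p \<in> sq r \<Longrightarrow> q \<in> sq r \<Longrightarrow> dist q p < \<delta> \<Longrightarrow> dist (c' q) (c' p) < e"
    using e unfolding uniformly_continuous_on_def by metis
  show ?thesis
  proof (rule that[OF \<delta>(1)])
    fix x x' t assume xt: "(x, t) \<in> sq r" "(x', t) \<in> sq r" "\<bar>x' - x\<bar> < \<delta>"
    have seg: "closed_segment x x' \<subseteq> {-r..r}"
      using xt by (intro closed_segment_subset) auto
    have "norm ((c (x', t) - x' * c' (x, t)) - (c (x, t) - x * c' (x, t))) \<le> e * norm (x' - x)"
    proof (rule field_differentiable_bound[where S = "closed_segment x x'" and f' = "\<lambda>\<sigma>. c' (\<sigma>, t) - c' (x, t)"])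
      fix \<sigma> assume \<sigma>: "\<sigma> \<in> closed_segment x x'"
      then have \<sigma>t: "(\<sigma>, t) \<in> sq r" using seg xt by auto
      have "((\<lambda>x. c (x, t)) has_real_derivative c' (\<sigma>, t)) (at \<sigma> within closed_segment x x')"
        by (rule DERIV_subset[OF d[OF \<sigma>t] seg])
      moreover have "((\<lambda>\<sigma>. \<sigma> * c' (x, t)) has_real_derivative c' (x, t)) (at \<sigma> within closed_segment x x')"
        by (auto intro!: derivative_eq_intros)
      ultimately show "((\<lambda>\<sigma>. c (\<sigma>, t) - \<sigma> * c' (x, t)) has_real_derivative c' (\<sigma>, t) - c' (x, t))
          (at \<sigma> within closed_segment x x')" by (rule DERIV_diff)
      have "dist (\<sigma>, t) (x, t) < \<delta>"
        using segment_bound(1)[OF \<sigma>] xt(3) by (simp add: dist_Pair_Pair dist_norm)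
      then show "norm (c' (\<sigma>, t) - c' (x, t)) \<le> e"
        using \<delta>(2)[OF xt(1) \<sigma>t] by (simp add: dist_norm)
    qed auto
    then show "\<bar>c (x', t) - c (x, t) - (x' - x) * c' (x, t)\<bar> \<le> e * \<bar>x' - x\<bar>"
      by (simp add: algebra_simps)
  qed
qed

lemma abs_mult_le: "\<bar>a\<bar> \<le> a' \<Longrightarrow> \<bar>b\<bar> \<le> b' \<Longrightarrow> \<bar>a * b\<bar> \<le> a' * b'" for a b a' b' :: real
  unfolding abs_mult by (intro mult_mono) auto

lemma continuous_on_jet:
  "continuous_on S a \<Longrightarrow> continuous_on S b \<Longrightarrow> continuous_on S c \<Longrightarrow> continuous_on S d
    \<Longrightarrow> continuous_on S (\<lambda>q. (a q, b q, c q, d q))"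
  by (intro continuous_on_Pair)

text \<open>Differentiability of the solution of an ordinary differential equation with respect to a
  parameter \<open>x\<close>. The derivatives \<open>V1', V2'\<close> are constructed as the solution of the formally
  differentiated, linear equation. The error \<open>\<Delta>\<close> of the linear approximation over a step \<open>h\<close>
  satisfies the same linear equation up to a term of size \<open>\<epsilon> * (\<bar>h\<bar> + k)\<close>, where \<open>k\<close> is its
  maximum; integrating over the small square yields \<open>k \<le> k / 2 + O(\<epsilon> * \<bar>h\<bar>)\<close>.\<close>

lemma flow_differentiable_in_x:
  fixes \<Phi> \<Gamma> :: "jet_pt \<Rightarrow> real" and c1 c2 V1 V2 c1' c2' :: "real \<times> real \<Rightarrow> real"
  defines "J \<equiv> \<lambda>q. (c1 q, V1 q, c2 q, V2 q)"
  assumes r: "0 < r" "4 * r * (1 + 2 * L) \<le> 1" "0 \<le> L"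
    and D: "convex D" "ndiff_on (Suc 0) \<Phi> D" "ndiff_on (Suc 0) \<Gamma> D"
    and J: "\<And>q. q \<in> sq r \<Longrightarrow> J q \<in> D"
    and cont: "continuous_on (sq r) c1" "continuous_on (sq r) c2" "continuous_on (sq r) V1"
      "continuous_on (sq r) V2" "continuous_on (sq r) c1'" "continuous_on (sq r) c2'"
    and cx: "\<And>x t. (x, t) \<in> sq r \<Longrightarrow> ((\<lambda>x. c1 (x, t)) has_real_derivative c1' (x, t)) (at x within {-r..r})"
      "\<And>x t. (x, t) \<in> sq r \<Longrightarrow> ((\<lambda>x. c2 (x, t)) has_real_derivative c2' (x, t)) (at x within {-r..r})"
    and Vt: "\<And>x t. (x, t) \<in> sq r \<Longrightarrow> ((\<lambda>t. V1 (x, t)) has_real_derivative \<Phi> (J (x, t))) (at t within {-r..r})"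
      "\<And>x t. (x, t) \<in> sq r \<Longrightarrow> ((\<lambda>t. V2 (x, t)) has_real_derivative \<Gamma> (J (x, t))) (at t within {-r..r})"
    and V0: "\<And>x. \<bar>x\<bar> \<le> r \<Longrightarrow> V1 (x, 0) = a1 + b1 * x" "\<And>x. \<bar>x\<bar> \<le> r \<Longrightarrow> V2 (x, 0) = a2 + b2 * x"
    and L: "\<And>q v. q \<in> sq r \<Longrightarrow> v \<in> {e2, e4} \<Longrightarrow> \<bar>fd \<Phi> (J q) v\<bar> \<le> L \<and> \<bar>fd \<Gamma> (J q) v\<bar> \<le> L"
  obtains V1' V2' where "continuous_on (sq r) V1'" "continuous_on (sq r) V2'"
    "\<And>x t. (x, t) \<in> sq r \<Longrightarrow> ((\<lambda>x. V1 (x, t)) has_real_derivative V1' (x, t)) (at x within {-r..r})"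
    "\<And>x t. (x, t) \<in> sq r \<Longrightarrow> ((\<lambda>x. V2 (x, t)) has_real_derivative V2' (x, t)) (at x within {-r..r})"
    "\<And>x t. (x, t) \<in> sq r \<Longrightarrow> ((\<lambda>t. V1' (x, t)) has_real_derivative
      fd \<Phi> (J (x, t)) (c1' (x, t), V1' (x, t), c2' (x, t), V2' (x, t))) (at t within {-r..r})"
    "\<And>x t. (x, t) \<in> sq r \<Longrightarrow> ((\<lambda>t. V2' (x, t)) has_real_derivative
      fd \<Gamma> (J (x, t)) (c1' (x, t), V1' (x, t), c2' (x, t), V2' (x, t))) (at t within {-r..r})"
    "\<And>x. \<bar>x\<bar> \<le> r \<Longrightarrow> V1' (x, 0) = b1" "\<And>x. \<bar>x\<bar> \<le> r \<Longrightarrow> V2' (x, 0) = b2"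
proof -
  have csq: "compact (sq r)" by (intro compact_Times compact_Icc)
  have cJ: "continuous_on (sq r) J" unfolding J_def by (intro continuous_on_jet cont)
  have dif: "\<Phi> differentiable (at X)" "\<Gamma> differentiable (at X)" if "X \<in> D" for X
    using that D by auto
  have cfd: "continuous_on D (\<lambda>X. fd \<Phi> X v)" "continuous_on D (\<lambda>X. fd \<Gamma> X v)" for v
    using ndiff_on_Suc_fd[OF D(2), of v] ndiff_on_Suc_fd[OF D(3), of v] by simp_all
  have cfdJ: "continuous_on (sq r) (\<lambda>q. fd \<Phi> (J q) v)" "continuous_on (sq r) (\<lambda>q. fd \<Gamma> (J q) v)" for v
    by (rule continuous_on_compose2[OF cfd(1) cJ] continuous_on_compose2[OF cfd(2) cJ]; use J in blast)+
  have lin: "continuous_on (sq r \<times> UNIV)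
      (\<lambda>(q, X). fd f (J q) (c1' q, fst (snd X), c2' q, snd (snd (snd (X :: jet_pt)))))"
    and lip: "\<And>q (X :: jet_pt) Y. q \<in> sq r \<Longrightarrow> \<bar>fd f (J q) (c1' q, fst (snd X), c2' q, snd (snd (snd X)))
      - fd f (J q) (c1' q, fst (snd Y), c2' q, snd (snd (snd Y)))\<bar> \<le> 2 * L * norm (X - Y)"
    if f: "\<And>X. X \<in> D \<Longrightarrow> f differentiable (at X)" "\<And>v. continuous_on (sq r) (\<lambda>q. fd f (J q) v)"
      "\<And>q v. q \<in> sq r \<Longrightarrow> v \<in> {e2, e4} \<Longrightarrow> \<bar>fd f (J q) v\<bar> \<le> L" for f
  proof -
    note e = fd_jet[OF f(1)[OF J]]
    have cp: "continuous_on (sq r \<times> UNIV) (\<lambda>p. a (fst p))" if "continuous_on (sq r) a"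
      for a :: "real \<times> real \<Rightarrow> real"
      by (rule continuous_on_compose2[OF that]) (auto intro!: continuous_intros)
    have "continuous_on (sq r \<times> UNIV) (\<lambda>p. c1' (fst p) * fd f (J (fst p)) e1
        + fst (snd (snd p)) * fd f (J (fst p)) e2 + c2' (fst p) * fd f (J (fst p)) e3
        + snd (snd (snd (snd (p :: _ \<times> jet_pt)))) * fd f (J (fst p)) e4)"
      by (intro continuous_on_add continuous_on_mult cp[OF f(2)] cp[OF cont(5)] cp[OF cont(6)]
          continuous_on_fst continuous_on_snd continuous_on_id)
    then show "continuous_on (sq r \<times> UNIV)
      (\<lambda>(q, X). fd f (J q) (c1' q, fst (snd X), c2' q, snd (snd (snd (X :: jet_pt)))))"
      by (rule continuous_on_eq) (auto simp: e[where a = "c1' q" for q])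
    show "\<bar>fd f (J q) (c1' q, fst (snd X), c2' q, snd (snd (snd X)))
          - fd f (J q) (c1' q, fst (snd Y), c2' q, snd (snd (snd Y)))\<bar> \<le> 2 * L * norm (X - Y)"
      if q: "q \<in> sq r" for q and X Y :: jet_pt
    proof -
      have "fd f (J q) (c1' q, fst (snd X), c2' q, snd (snd (snd X)))
          - fd f (J q) (c1' q, fst (snd Y), c2' q, snd (snd (snd Y)))
        = fst (snd (X - Y)) * fd f (J q) e2 + snd (snd (snd (X - Y))) * fd f (J q) e4"
        unfolding e[OF q, of "c1' q"] by (simp add: algebra_simps)
      also have "\<bar>\<dots>\<bar> \<le> norm (X - Y) * L + norm (X - Y) * L"
        using f(3)[OF q, of e2] f(3)[OF q, of e4]
        by (intro order_trans[OF abs_triangle_ineq] add_mono abs_mult_le jet_component_le_norm) simp_all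
      finally show ?thesis by simp
    qed
  qed
  obtain U V1' S V2' where V': "continuous_on (sq r) V1'" "continuous_on (sq r) V2'"
    "\<And>x t. (x, t) \<in> sq r \<Longrightarrow> ((\<lambda>t. V1' (x, t)) has_real_derivative
      fd \<Phi> (J (x, t)) (c1' (x, t), V1' (x, t), c2' (x, t), V2' (x, t))) (at t within {-r..r})"
    "\<And>x t. (x, t) \<in> sq r \<Longrightarrow> ((\<lambda>t. V2' (x, t)) has_real_derivative
      fd \<Gamma> (J (x, t)) (c1' (x, t), V1' (x, t), c2' (x, t), V2' (x, t))) (at t within {-r..r})"
    "\<And>x. \<bar>x\<bar> \<le> r \<Longrightarrow> V1' (x, 0) = b1" "\<And>x. \<bar>x\<bar> \<le> r \<Longrightarrow> V2' (x, 0) = b2"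
  proof (rule goursat_Lipschitz[where L = "2 * L" and r = r and ?z0.0 = 0 and ?y0.0 = 0 and ?p1.0 = 0 and ?p2.0 = 0
        and ?z1.0 = b1 and ?y1.0 = b2 and ?q1.0 = 0 and ?q2.0 = 0
        and Fh = "\<lambda>q X. fd \<Phi> (J q) (c1' q, fst (snd X), c2' q, snd (snd (snd X)))"
        and Gh = "\<lambda>q X. fd \<Gamma> (J q) (c1' q, fst (snd X), c2' q, snd (snd (snd X)))"])
    fix u w v s :: "real \<times> real \<Rightarrow> real"
    assume *: "continuous_on (sq r) w" "continuous_on (sq r) s"
      "\<And>x t. (x, t) \<in> sq r \<Longrightarrow> ((\<lambda>t. w (x, t)) has_real_derivative fd \<Phi> (J (x, t)) (c1' (x, t),
          fst (snd (u (x, t), w (x, t), v (x, t), s (x, t))), c2' (x, t),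
          snd (snd (snd (u (x, t), w (x, t), v (x, t), s (x, t)))))) (at t within {-r..r})"
      "\<And>x t. (x, t) \<in> sq r \<Longrightarrow> ((\<lambda>t. s (x, t)) has_real_derivative fd \<Gamma> (J (x, t)) (c1' (x, t),
          fst (snd (u (x, t), w (x, t), v (x, t), s (x, t))), c2' (x, t),
          snd (snd (snd (u (x, t), w (x, t), v (x, t), s (x, t)))))) (at t within {-r..r})"
      "\<And>x. \<bar>x\<bar> \<le> r \<Longrightarrow> w (x, 0) = b1 + 0 * x" "\<And>x. \<bar>x\<bar> \<le> r \<Longrightarrow> s (x, 0) = b2 + 0 * x"
    show ?thesis
      by (rule that[of w s]) (use * in auto)
  qed (use r lin[of \<Phi>] lin[of \<Gamma>] lip[of \<Phi>] lip[of \<Gamma>] dif cfdJ L in auto)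
  define J' where "J' q = (c1' q, V1' q, c2' q, V2' q)" for q
  have bounded: "\<exists>M\<ge>0. \<forall>q\<in>sq r. \<bar>f q\<bar> \<le> M" if "continuous_on (sq r) f" for f :: "real \<times> real \<Rightarrow> real"
    using compact_imp_bounded[OF compact_continuous_image[OF that csq]]
    by (auto simp: bounded_iff intro: order_trans[OF abs_ge_zero] dest: spec)
      (metis abs_ge_zero abs_ge_self order_trans)
  have "continuous_on (sq r) J'"
    unfolding J'_def[abs_def] by (intro continuous_on_jet cont V')
  then obtain C where C: "C \<ge> 0" "\<And>q. q \<in> sq r \<Longrightarrow> norm (J' q) \<le> C"
    using bounded[OF continuous_on_norm, of J'] by (metis abs_norm_cancel)
  obtain B where B: "B \<ge> 0" "\<And>q v. q \<in> sq r \<Longrightarrow> v \<in> {e1, e3} \<Longrightarrow> \<bar>fd \<Phi> (J q) v\<bar> \<le> B \<and> \<bar>fd \<Gamma> (J q) v\<bar> \<le> B"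
  proof -
    obtain B1 where B1: "B1 \<ge> 0" "\<forall>q\<in>sq r. \<bar>fd \<Phi> (J q) e1\<bar> \<le> B1" using bounded cfdJ by blast
    obtain B2 where B2: "B2 \<ge> 0" "\<forall>q\<in>sq r. \<bar>fd \<Phi> (J q) e3\<bar> \<le> B2" using bounded cfdJ by blast
    obtain B3 where B3: "B3 \<ge> 0" "\<forall>q\<in>sq r. \<bar>fd \<Gamma> (J q) e1\<bar> \<le> B3" using bounded cfdJ by blast
    obtain B4 where B4: "B4 \<ge> 0" "\<forall>q\<in>sq r. \<bar>fd \<Gamma> (J q) e3\<bar> \<le> B4" using bounded cfdJ by blast
    show ?thesis
    proof (rule that[of "B1 + B2 + B3 + B4"])
      show "0 \<le> B1 + B2 + B3 + B4" using B1(1) B2(1) B3(1) B4(1) by linarith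
      fix q v assume q: "q \<in> sq r" and v: "v \<in> {e1, e3}"
      have b: "\<bar>fd \<Phi> (J q) e1\<bar> \<le> B1" "\<bar>fd \<Phi> (J q) e3\<bar> \<le> B2"
        "\<bar>fd \<Gamma> (J q) e1\<bar> \<le> B3" "\<bar>fd \<Gamma> (J q) e3\<bar> \<le> B4"
        using B1(2) B2(2) B3(2) B4(2) q by blast+
      from v consider "v = e1" | "v = e3" by blast
      then show "\<bar>fd \<Phi> (J q) v\<bar> \<le> B1 + B2 + B3 + B4 \<and> \<bar>fd \<Gamma> (J q) v\<bar> \<le> B1 + B2 + B3 + B4"
        using b B1(1) B2(1) B3(1) B4(1) by cases (simp_all only:, linarith+)
    qed
  qed
  \<comment> \<open>a compact convex part of \<open>D\<close>, on which the linearization is uniform\<close>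
  define H where "H = convex hull (J ` sq r)"
  have H: "compact H" "convex H" "H \<subseteq> D" "\<And>q. q \<in> sq r \<Longrightarrow> J q \<in> H"
  proof -
    show "compact H" "convex H"
      unfolding H_def by (intro compact_convex_hull compact_continuous_image[OF cJ csq] convex_convex_hull)+
    show "H \<subseteq> D"
      unfolding H_def using J by (intro hull_minimal D(1)) blast
    show "J q \<in> H" if "q \<in> sq r" for q
      unfolding H_def by (rule hull_inc) (use that in blast)
  qed
  have key: "\<exists>d>0. \<forall>x x' t. (x, t) \<in> sq r \<longrightarrow> (x', t) \<in> sq r \<longrightarrow> \<bar>x' - x\<bar> < d \<longrightarrow>
      \<bar>V1 (x', t) - V1 (x, t) - (x' - x) * V1' (x, t)\<bar> \<le> e * \<bar>x' - x\<bar> \<and>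
      \<bar>V2 (x', t) - V2 (x, t) - (x' - x) * V2' (x, t)\<bar> \<le> e * \<bar>x' - x\<bar>" if e: "0 < e" for e
  proof -
    \<comment> \<open>the final estimate is \<open>k \<le> \<epsilon> * (C + 1 + 2 * B) * \<bar>h\<bar>\<close>\<close>
    define \<epsilon> where "\<epsilon> = min (1/2) (e / (C + 1 + 2 * B))"
    have \<epsilon>: "0 < \<epsilon>" "\<epsilon> \<le> 1/2" "\<epsilon> * (C + 1 + 2 * B) \<le> e"
    proof -
      have N: "0 < C + 1 + 2 * B" using B(1) C(1) by linarith
      show "0 < \<epsilon>" using e N by (simp add: \<epsilon>_def)
      show "\<epsilon> \<le> 1/2" unfolding \<epsilon>_def by (rule min.cobounded1)
      have "\<epsilon> \<le> e / (C + 1 + 2 * B)" by (simp add: \<epsilon>_def)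
      then show "\<epsilon> * (C + 1 + 2 * B) \<le> e" using N by (simp only: pos_le_divide_eq)
    qed
    obtain d1 where d1: "0 < d1" "\<And>X Y. X \<in> H \<Longrightarrow> Y \<in> H \<Longrightarrow> norm (Y - X) < d1 \<Longrightarrow>
        \<bar>\<Phi> Y - \<Phi> X - fd \<Phi> X (Y - X)\<bar> \<le> \<epsilon> * norm (Y - X)"
      by (rule uniform_linearization[OF H(1,2) dif(1) continuous_on_subset[OF cfd(1)] \<epsilon>(1)]) (use H(3) in auto)
    obtain d2 where d2: "0 < d2" "\<And>X Y. X \<in> H \<Longrightarrow> Y \<in> H \<Longrightarrow> norm (Y - X) < d2 \<Longrightarrow>
        \<bar>\<Gamma> Y - \<Gamma> X - fd \<Gamma> X (Y - X)\<bar> \<le> \<epsilon> * norm (Y - X)"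
      by (rule uniform_linearization[OF H(1,2) dif(2) continuous_on_subset[OF cfd(2)] \<epsilon>(1)]) (use H(3) in auto)
    obtain d3 where d3: "0 < d3" "\<And>x x' t. (x, t) \<in> sq r \<Longrightarrow> (x', t) \<in> sq r \<Longrightarrow> \<bar>x' - x\<bar> < d3 \<Longrightarrow>
        \<bar>c1 (x', t) - c1 (x, t) - (x' - x) * c1' (x, t)\<bar> \<le> \<epsilon> * \<bar>x' - x\<bar>"
      by (rule uniform_x_linearization[OF cont(5) cx(1) \<epsilon>(1)]) auto
    obtain d4 where d4: "0 < d4" "\<And>x x' t. (x, t) \<in> sq r \<Longrightarrow> (x', t) \<in> sq r \<Longrightarrow> \<bar>x' - x\<bar> < d4 \<Longrightarrow>
        \<bar>c2 (x', t) - c2 (x, t) - (x' - x) * c2' (x, t)\<bar> \<le> \<epsilon> * \<bar>x' - x\<bar>"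
      by (rule uniform_x_linearization[OF cont(6) cx(2) \<epsilon>(1)]) auto
    have "uniformly_continuous_on (sq r) J" by (rule compact_uniformly_continuous[OF cJ csq])
    then obtain d5 where d5: "0 < d5" "\<And>p q. p \<in> sq r \<Longrightarrow> q \<in> sq r \<Longrightarrow> dist q p < d5 \<Longrightarrow> dist (J q) (J p) < min d1 d2"
      using d1(1) d2(1) unfolding uniformly_continuous_on_def by (metis min_less_iff_conj)
    define d where "d = min d3 (min d4 d5)"
    show ?thesis
    proof (intro exI[of _ d] conjI allI impI)
      show "0 < d" using d3(1) d4(1) d5(1) by (simp add: d_def)
      fix x x' t assume x: "(x, t) \<in> sq r" and x': "(x', t) \<in> sq r" and xx': "\<bar>x' - x\<bar> < d"
      define h where "h = x' - x"
      have mem: "(x, \<tau>) \<in> sq r" "(x', \<tau>) \<in> sq r" if "\<tau> \<in> {-r..r}" for \<tau> using x x' that by auto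
      define \<Delta>1 where "\<Delta>1 \<tau> = V1 (x', \<tau>) - V1 (x, \<tau>) - h * V1' (x, \<tau>)" for \<tau>
      define \<Delta>2 where "\<Delta>2 \<tau> = V2 (x', \<tau>) - V2 (x, \<tau>) - h * V2' (x, \<tau>)" for \<tau>
      have col: "continuous_on {-r..r} (\<lambda>\<tau>. a (z, \<tau>))" if "continuous_on (sq r) a" "\<bar>z\<bar> \<le> r"
        for a :: "real \<times> real \<Rightarrow> real" and z
        by (rule continuous_on_compose2[OF that(1)]; use that(2) in \<open>auto intro!: continuous_intros simp: abs_le_iff\<close>)
      have "continuous_on {-r..r} (\<lambda>\<tau>. \<bar>\<Delta>1 \<tau>\<bar> + \<bar>\<Delta>2 \<tau>\<bar>)"
        unfolding \<Delta>1_def \<Delta>2_def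
        by (intro continuous_intros col cont V') (use x x' in \<open>auto simp: abs_le_iff\<close>)
      then obtain \<tau>0 where \<tau>0: "\<tau>0 \<in> {-r..r}" "\<And>\<tau>. \<tau> \<in> {-r..r} \<Longrightarrow> \<bar>\<Delta>1 \<tau>\<bar> + \<bar>\<Delta>2 \<tau>\<bar> \<le> \<bar>\<Delta>1 \<tau>0\<bar> + \<bar>\<Delta>2 \<tau>0\<bar>"
        using continuous_attains_sup[of "{-r..r}" "\<lambda>\<tau>. \<bar>\<Delta>1 \<tau>\<bar> + \<bar>\<Delta>2 \<tau>\<bar>"] r(1) by auto
      define k where "k = \<bar>\<Delta>1 \<tau>0\<bar> + \<bar>\<Delta>2 \<tau>0\<bar>"
      define M where "M = L * k + \<epsilon> * (\<bar>h\<bar> * (C + 1) + k) + 2 * B * (\<epsilon> * \<bar>h\<bar>)"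
      have est: "\<bar>f (J (x', \<tau>)) - f (J (x, \<tau>)) - h * fd f (J (x, \<tau>)) (J' (x, \<tau>))\<bar> \<le> M"
        if \<tau>: "\<tau> \<in> {-r..r}" and df: "f differentiable (at (J (x, \<tau>)))"
          and f: "\<bar>f (J (x', \<tau>)) - f (J (x, \<tau>)) - fd f (J (x, \<tau>)) (J (x', \<tau>) - J (x, \<tau>))\<bar>
            \<le> \<epsilon> * norm (J (x', \<tau>) - J (x, \<tau>))"
          and fB: "\<bar>fd f (J (x, \<tau>)) e1\<bar> \<le> B" "\<bar>fd f (J (x, \<tau>)) e3\<bar> \<le> B"
          and fL: "\<bar>fd f (J (x, \<tau>)) e2\<bar> \<le> L" "\<bar>fd f (J (x, \<tau>)) e4\<bar> \<le> L" for \<tau> f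
      proof -
        define \<rho>1 where "\<rho>1 = c1 (x', \<tau>) - c1 (x, \<tau>) - h * c1' (x, \<tau>)"
        define \<rho>2 where "\<rho>2 = c2 (x', \<tau>) - c2 (x, \<tau>) - h * c2' (x, \<tau>)"
        have \<rho>: "\<bar>\<rho>1\<bar> \<le> \<epsilon> * \<bar>h\<bar>" "\<bar>\<rho>2\<bar> \<le> \<epsilon> * \<bar>h\<bar>"
          using d3(2)[OF mem[OF \<tau>]] d4(2)[OF mem[OF \<tau>]] xx' by (auto simp: \<rho>1_def \<rho>2_def h_def d_def)
        have k: "\<bar>\<Delta>1 \<tau>\<bar> + \<bar>\<Delta>2 \<tau>\<bar> \<le> k" using \<tau>0(2)[OF \<tau>] by (simp add: k_def)
        have dJ: "J (x', \<tau>) - J (x, \<tau>) = h *\<^sub>R J' (x, \<tau>) + (\<rho>1, \<Delta>1 \<tau>, \<rho>2, \<Delta>2 \<tau>)"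
          by (simp add: J_def J'_def \<rho>1_def \<rho>2_def \<Delta>1_def \<Delta>2_def)
        interpret bounded_linear "fd f (J (x, \<tau>))"
          using has_derivative_bounded_linear[OF fd_has_derivative[OF df]] .
        have P: "fd f (J (x, \<tau>)) (J (x', \<tau>) - J (x, \<tau>))
          = h * fd f (J (x, \<tau>)) (J' (x, \<tau>)) + fd f (J (x, \<tau>)) (\<rho>1, \<Delta>1 \<tau>, \<rho>2, \<Delta>2 \<tau>)"
          unfolding dJ by (simp only: add scaleR real_scaleR_def)
        have "\<bar>fd f (J (x, \<tau>)) (\<rho>1, \<Delta>1 \<tau>, \<rho>2, \<Delta>2 \<tau>)\<bar>
            \<le> \<epsilon> * \<bar>h\<bar> * B + \<bar>\<Delta>1 \<tau>\<bar> * L + \<epsilon> * \<bar>h\<bar> * B + \<bar>\<Delta>2 \<tau>\<bar> * L"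
          unfolding fd_jet[OF df, of \<rho>1]
          by (intro order_trans[OF abs_triangle_ineq] add_mono abs_mult_le \<rho> fB fL order_refl)
        also have "\<dots> = 2 * B * (\<epsilon> * \<bar>h\<bar>) + L * (\<bar>\<Delta>1 \<tau>\<bar> + \<bar>\<Delta>2 \<tau>\<bar>)" by (simp add: algebra_simps)
        also have "\<dots> \<le> 2 * B * (\<epsilon> * \<bar>h\<bar>) + L * k" using mult_left_mono[OF k r(3)] by simp
        finally have 1: "\<bar>fd f (J (x, \<tau>)) (\<rho>1, \<Delta>1 \<tau>, \<rho>2, \<Delta>2 \<tau>)\<bar> \<le> 2 * B * (\<epsilon> * \<bar>h\<bar>) + L * k" .
        have "norm (J (x', \<tau>) - J (x, \<tau>)) \<le> \<bar>h\<bar> * norm (J' (x, \<tau>)) + (\<bar>\<rho>1\<bar> + \<bar>\<Delta>1 \<tau>\<bar> + \<bar>\<rho>2\<bar> + \<bar>\<Delta>2 \<tau>\<bar>)"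
          unfolding dJ using norm_triangle_ineq[of "h *\<^sub>R J' (x, \<tau>)" "(\<rho>1, \<Delta>1 \<tau>, \<rho>2, \<Delta>2 \<tau>)"]
            norm_jet_le[of \<rho>1 "\<Delta>1 \<tau>" \<rho>2 "\<Delta>2 \<tau>"] by simp
        moreover have "\<bar>h\<bar> * norm (J' (x, \<tau>)) \<le> \<bar>h\<bar> * C" by (intro mult_left_mono C(2) mem[OF \<tau>]) auto
        moreover have "\<epsilon> * \<bar>h\<bar> \<le> 1/2 * \<bar>h\<bar>" by (intro mult_right_mono \<epsilon>) auto
        ultimately have "norm (J (x', \<tau>) - J (x, \<tau>)) \<le> \<bar>h\<bar> * (C + 1) + k"
          using \<rho> k by (simp add: algebra_simps)
        then have "\<epsilon> * norm (J (x', \<tau>) - J (x, \<tau>)) \<le> \<epsilon> * (\<bar>h\<bar> * (C + 1) + k)"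
          using \<epsilon>(1) by (intro mult_left_mono) auto
        then show ?thesis using f 1 unfolding P M_def by linarith
      qed
      have near: "norm (J (x', \<tau>) - J (x, \<tau>)) < d1" "norm (J (x', \<tau>) - J (x, \<tau>)) < d2" if "\<tau> \<in> {-r..r}" for \<tau>
        using d5(2)[OF mem[OF that]] xx' by (auto simp: d_def dist_Pair_Pair dist_norm)
      have D1: "(\<Delta>1 has_real_derivative \<Phi> (J (x', \<tau>)) - \<Phi> (J (x, \<tau>)) - h * fd \<Phi> (J (x, \<tau>)) (J' (x, \<tau>)))
          (at \<tau> within {-r..r})"
        and D2: "(\<Delta>2 has_real_derivative \<Gamma> (J (x', \<tau>)) - \<Gamma> (J (x, \<tau>)) - h * fd \<Gamma> (J (x, \<tau>)) (J' (x, \<tau>)))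
          (at \<tau> within {-r..r})" if \<tau>: "\<tau> \<in> {-r..r}" for \<tau>
        unfolding \<Delta>1_def[abs_def] \<Delta>2_def[abs_def] J'_def
        by (intro DERIV_diff DERIV_cmult Vt V' mem[OF \<tau>])+
      have M1: "\<bar>\<Phi> (J (x', \<tau>)) - \<Phi> (J (x, \<tau>)) - h * fd \<Phi> (J (x, \<tau>)) (J' (x, \<tau>))\<bar> \<le> M"
        and M2: "\<bar>\<Gamma> (J (x', \<tau>)) - \<Gamma> (J (x, \<tau>)) - h * fd \<Gamma> (J (x, \<tau>)) (J' (x, \<tau>))\<bar> \<le> M" if \<tau>: "\<tau> \<in> {-r..r}" for \<tau>
        using dif[OF J[OF mem(1)[OF \<tau>]]] B(2)[OF mem(1)[OF \<tau>]] L[OF mem(1)[OF \<tau>]]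
          d1(2)[OF H(4)[OF mem(1)[OF \<tau>]] H(4)[OF mem(2)[OF \<tau>]] near(1)[OF \<tau>]]
          d2(2)[OF H(4)[OF mem(1)[OF \<tau>]] H(4)[OF mem(2)[OF \<tau>]] near(2)[OF \<tau>]]
        by (intro est[OF \<tau>]; simp)+
      have small: "\<bar>\<Delta> \<tau>\<bar> \<le> M * r" if \<tau>: "\<tau> \<in> {-r..r}" and 0: "\<Delta> 0 = 0"
        and d: "\<And>\<tau>. \<tau> \<in> {-r..r} \<Longrightarrow> (\<Delta> has_real_derivative \<Delta>' \<tau>) (at \<tau> within {-r..r})"
        and b: "\<And>\<tau>. \<tau> \<in> {-r..r} \<Longrightarrow> \<bar>\<Delta>' \<tau>\<bar> \<le> M" for \<Delta> \<Delta>' \<tau>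
      proof -
        have "norm (\<Delta> \<tau> - \<Delta> 0) \<le> M * norm (\<tau> - 0)"
          by (rule field_differentiable_bound[of "{-r..r}" \<Delta> \<Delta>']) (use \<tau> d b r(1) in auto)
        moreover have "M * \<bar>\<tau>\<bar> \<le> M * r"
          using \<tau> b[OF \<tau>] by (intro mult_left_mono) auto
        ultimately show ?thesis using 0 by simp
      qed
      have "\<Delta>1 0 = 0" "\<Delta>2 0 = 0"
        using V0 V'(5,6) x x' by (auto simp: \<Delta>1_def \<Delta>2_def h_def algebra_simps abs_le_iff)
      then have "k \<le> M * r + M * r"
        unfolding k_def using small[OF \<tau>0(1) _ D1 M1] small[OF \<tau>0(1) _ D2 M2] by fastforce
      also have "\<dots> = (2 * r * L + 2 * r * \<epsilon>) * k + 2 * r * (\<epsilon> * (C + 1 + 2 * B) * \<bar>h\<bar>)"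
        by (simp add: M_def algebra_simps)
      finally have k_le: "k \<le> (2 * r * L + 2 * r * \<epsilon>) * k + 2 * r * (\<epsilon> * (C + 1 + 2 * B) * \<bar>h\<bar>)" .
      have rL: "4 * r + 8 * (r * L) \<le> 1" using r(2) by (simp add: algebra_simps)
      have "0 \<le> r * L" using r by simp
      with rL have r4: "4 * r \<le> 1" "8 * (r * L) \<le> 1" using r(1) by linarith+
      have "2 * r * \<epsilon> \<le> 2 * r * (1/2)" using \<epsilon> r(1) by (intro mult_left_mono) auto
      then have "2 * r * L + 2 * r * \<epsilon> \<le> 1/2" using r4 by linarith
      then have "(2 * r * L + 2 * r * \<epsilon>) * k \<le> 1/2 * k" by (intro mult_right_mono) (auto simp: k_def)
      moreover have "2 * r * (\<epsilon> * (C + 1 + 2 * B) * \<bar>h\<bar>) \<le> 1/2 * (e * \<bar>h\<bar>)"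
        using r4(1) \<epsilon> r(1) e B(1) C(1) by (intro mult_mono) auto
      ultimately have k: "k \<le> e * \<bar>h\<bar>" using k_le by linarith
      have t: "t \<in> {-r..r}" using x by auto
      show "\<bar>V1 (x', t) - V1 (x, t) - (x' - x) * V1' (x, t)\<bar> \<le> e * \<bar>x' - x\<bar>"
        "\<bar>V2 (x', t) - V2 (x, t) - (x' - x) * V2' (x, t)\<bar> \<le> e * \<bar>x' - x\<bar>"
        using \<tau>0(2)[OF t] k unfolding k_def \<Delta>1_def[of t] \<Delta>2_def[of t] h_def by linarith+
    qed
  qed
  have dx: "((\<lambda>x. V (x, t)) has_real_derivative V' (x, t)) (at x within {-r..r})"
    if xt: "(x, t) \<in> sq r" and k: "\<And>e. 0 < e \<Longrightarrow> \<exists>d>0. \<forall>x x' t. (x, t) \<in> sq r \<longrightarrow> (x', t) \<in> sq r \<longrightarrow> \<bar>x' - x\<bar> < d \<longrightarrow>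
      \<bar>V (x', t) - V (x, t) - (x' - x) * V' (x, t)\<bar> \<le> e * \<bar>x' - x\<bar>" for V V' :: "real \<times> real \<Rightarrow> real" and x t
    unfolding has_field_derivative_def has_derivative_within_alt
  proof (intro conjI allI impI)
    show "bounded_linear ((*) (V' (x, t)))" by (rule bounded_linear_mult_right)
    fix e :: real assume "0 < e"
    then obtain d where d: "d > 0" "\<forall>x x' t. (x, t) \<in> sq r \<longrightarrow> (x', t) \<in> sq r \<longrightarrow> \<bar>x' - x\<bar> < d \<longrightarrow>
      \<bar>V (x', t) - V (x, t) - (x' - x) * V' (x, t)\<bar> \<le> e * \<bar>x' - x\<bar>" using k by blast
    have "norm (V (y, t) - V (x, t) - V' (x, t) * (y - x)) \<le> e * norm (y - x)"
      if "y \<in> {-r..r}" "norm (y - x) < d" for y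
      using d(2)[rule_format, OF xt, of y] that xt by (simp add: mult.commute)
    then show "\<exists>d>0. \<forall>y\<in>{-r..r}. norm (y - x) < d \<longrightarrow>
        norm (V (y, t) - V (x, t) - V' (x, t) * (y - x)) \<le> e * norm (y - x)"
      using d(1) by blast
  qed
  have "((\<lambda>x. V1 (x, t)) has_real_derivative V1' (x, t)) (at x within {-r..r})"
    "((\<lambda>x. V2 (x, t)) has_real_derivative V2' (x, t)) (at x within {-r..r})" if "(x, t) \<in> sq r" for x t
    by (rule dx[OF that]; use key in meson)+
  then show ?thesis by (rule that[OF V'(1,2) _ _ V'(3-6)])
qed

text \<open>A pair \<open>V1, V2\<close> satisfying an ordinary differential equation in \<open>t\<close> in which \<open>x\<close> is a
  parameter. The format is closed under differentiation in \<open>x\<close>: the derivatives of the affine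
  initial values are constant, and the bound \<open>L\<close>, which concerns the derivatives of the
  right-hand sides with respect to the unknowns, is the same for the differentiated equation, so
  that one square serves for derivatives of all orders. For \<open>k = 0\<close> these derivatives need not
  exist, whence the guard of the last condition.\<close>

definition flow ::
  "nat \<Rightarrow> real \<Rightarrow> real \<Rightarrow> (jet_pt \<Rightarrow> real) \<Rightarrow> (jet_pt \<Rightarrow> real) \<Rightarrow> (real \<times> real \<Rightarrow> real) \<Rightarrow> (real \<times> real \<Rightarrow> real)
    \<Rightarrow> (real \<times> real \<Rightarrow> real) \<Rightarrow> (real \<times> real \<Rightarrow> real) \<Rightarrow> bool" where
  "flow k R L \<Phi> \<Gamma> c1 c2 V1 V2 \<longleftrightarrow> (\<exists>D a1 b1 a2 b2.
     open D \<and> convex D \<and> ndiff_on k \<Phi> D \<and> ndiff_on k \<Gamma> D \<and>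
     ndiff_on k c1 (osq R) \<and> ndiff_on k c2 (osq R) \<and>
     continuous_on (osq R) V1 \<and> continuous_on (osq R) V2 \<and>
     (\<forall>q\<in>osq R. (c1 q, V1 q, c2 q, V2 q) \<in> D) \<and>
     (\<forall>x t. (x, t) \<in> osq R \<longrightarrow>
       ((\<lambda>t. V1 (x, t)) has_real_derivative \<Phi> (c1 (x, t), V1 (x, t), c2 (x, t), V2 (x, t))) (at t) \<and>
       ((\<lambda>t. V2 (x, t)) has_real_derivative \<Gamma> (c1 (x, t), V1 (x, t), c2 (x, t), V2 (x, t))) (at t)) \<and>
     (\<forall>x. \<bar>x\<bar> < R \<longrightarrow> V1 (x, 0) = a1 + b1 * x \<and> V2 (x, 0) = a2 + b2 * x) \<and>
     (0 < k \<longrightarrow> (\<forall>q\<in>osq R. \<forall>v\<in>{e2, e4}.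
       \<bar>fd \<Phi> (c1 q, V1 q, c2 q, V2 q) v\<bar> \<le> L \<and> \<bar>fd \<Gamma> (c1 q, V1 q, c2 q, V2 q) v\<bar> \<le> L)))"

lemma flow_SucD: "flow (Suc k) R L \<Phi> \<Gamma> c1 c2 V1 V2 \<Longrightarrow> flow k R L \<Phi> \<Gamma> c1 c2 V1 V2"
  unfolding flow_def
  by (elim exE conjE, intro exI conjI; (assumption | (erule ndiff_on_SucD; fail) | simp only: zero_less_Suc simp_thms; (rule impI, assumption)))

lemma differentiable_DERIV_pd1:
  assumes "c differentiable (at (x, t))"
  shows "((\<lambda>x. c (x, t)) has_real_derivative pd1 c (x, t)) (at x)"
proof -
  have "((\<lambda>x. (x, t)) has_vector_derivative (1, 0)) (at x)" by (auto intro!: derivative_eq_intros)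
  from has_real_derivative_along[OF fd_has_derivative[OF assms] this] show ?thesis
    by (simp add: pd1_eq_fd[OF assms])
qed

lemma open_osq: "open (osq R)"
  by (intro open_Times open_greaterThanLessThan)

text \<open>The domain of equations linear in the unknowns: \<open>(x, t)\<close> in the square, the unknowns arbitrary.\<close>

lemma
  shows open_osq_cylinder: "open {X :: jet_pt. (fst X, fst (snd (snd X))) \<in> osq R}"
    and convex_osq_cylinder: "convex {X :: jet_pt. (fst X, fst (snd (snd X))) \<in> osq R}"
proof -
  let ?\<pi> = "\<lambda>X :: jet_pt. (fst X, fst (snd (snd X)))"
  have "bounded_linear ?\<pi>"
    by (intro bounded_linear_Pair bounded_linear_fst bounded_linear_compose[OF bounded_linear_fst]
        bounded_linear_compose[OF bounded_linear_snd] bounded_linear_snd)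
  then have "convex (?\<pi> -` osq R)"
    by (intro convex_linear_vimage bounded_linear.linear convex_Times convex_real_interval)
  moreover have "open (?\<pi> -` osq R)"
    by (rule open_vimage[OF open_osq]) (intro continuous_intros)
  ultimately show "open {X :: jet_pt. ?\<pi> X \<in> osq R}" "convex {X :: jet_pt. ?\<pi> X \<in> osq R}"
    by (simp_all add: vimage_def)
qed

lemma sq_subset_osq: "r < R \<Longrightarrow> sq r \<subseteq> osq R"
  by auto

lemma osq_in_sq:
  assumes "(x, t) \<in> osq R"
  obtains r where "0 < r" "r < R" "\<bar>x\<bar> < r" "\<bar>t\<bar> < r"
proof -
  have "max \<bar>x\<bar> \<bar>t\<bar> < R" using assms by (auto simp: abs_less_iff)
  then obtain r where "max \<bar>x\<bar> \<bar>t\<bar> < r" "r < R" using dense by blast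
  then show ?thesis using that[of r] by auto
qed

text \<open>The \<open>t\<close>-derivatives of \<open>V1, V2\<close> are given by the equation, and the \<open>x\<close>-derivatives form a flow
  whose data have one order of differentiability less. So the order rises by one with each step
  of the induction, which is over all flows.\<close>

lemma flow_ndiff:
  assumes R: "0 < R" "4 * R * (1 + 2 * L) \<le> 1" "0 \<le> L"
  shows "flow k R L \<Phi> \<Gamma> c1 c2 V1 V2 \<Longrightarrow> ndiff_on k V1 (osq R) \<and> ndiff_on k V2 (osq R)"
proof (induction k arbitrary: \<Phi> \<Gamma> c1 c2 V1 V2)
  case 0
  then show ?case by (auto simp: flow_def)
next
  case (Suc k)
  define J where "J q = (c1 q, V1 q, c2 q, V2 q)" for q
  obtain D a1 b1 a2 b2 where D: "open D" "convex D" and \<Phi>: "ndiff_on (Suc k) \<Phi> D" and \<Gamma>: "ndiff_on (Suc k) \<Gamma> D"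
    and c: "ndiff_on (Suc k) c1 (osq R)" "ndiff_on (Suc k) c2 (osq R)"
    and cV: "continuous_on (osq R) V1" "continuous_on (osq R) V2"
    and J: "\<And>q. q \<in> osq R \<Longrightarrow> J q \<in> D"
    and Vt: "\<And>x t. (x, t) \<in> osq R \<Longrightarrow> ((\<lambda>t. V1 (x, t)) has_real_derivative \<Phi> (J (x, t))) (at t)"
      "\<And>x t. (x, t) \<in> osq R \<Longrightarrow> ((\<lambda>t. V2 (x, t)) has_real_derivative \<Gamma> (J (x, t))) (at t)"
    and V0: "\<And>x. \<bar>x\<bar> < R \<Longrightarrow> V1 (x, 0) = a1 + b1 * x" "\<And>x. \<bar>x\<bar> < R \<Longrightarrow> V2 (x, 0) = a2 + b2 * x"
    and L: "\<And>q v. q \<in> osq R \<Longrightarrow> v \<in> {e2, e4} \<Longrightarrow> \<bar>fd \<Phi> (J q) v\<bar> \<le> L \<and> \<bar>fd \<Gamma> (J q) v\<bar> \<le> L"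
    using Suc.prems unfolding flow_def J_def by (elim exE conjE) (blast intro: zero_less_Suc)
  have Vk: "ndiff_on k V1 (osq R)" "ndiff_on k V2 (osq R)"
    using Suc.IH[OF flow_SucD[OF Suc.prems]] by auto
  have ck: "ndiff_on k c1 (osq R)" "ndiff_on k c2 (osq R)" using c ndiff_on_SucD by blast+
  have dc: "c1 differentiable (at q)" "c2 differentiable (at q)" if "q \<in> osq R" for q
    using c that by auto
  have pc: "ndiff_on k (pd1 c1) (osq R)" "ndiff_on k (pd1 c2) (osq R)"
    using ndiff_on_Suc_fd[OF c(1), of "(1, 0)"] ndiff_on_Suc_fd[OF c(2), of "(1, 0)"]
      ndiff_on_cong[OF open_osq, of R "pd1 c1" "\<lambda>q. fd c1 q (1, 0)" k]
      ndiff_on_cong[OF open_osq, of R "pd1 c2" "\<lambda>q. fd c2 q (1, 0)" k] pd1_eq_fd dc by auto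
  have cx: "((\<lambda>x. c1 (x, t)) has_real_derivative pd1 c1 (x, t)) (at x)"
    "((\<lambda>x. c2 (x, t)) has_real_derivative pd1 c2 (x, t)) (at x)" if "(x, t) \<in> osq R" for x t
    using differentiable_DERIV_pd1 dc[OF that] by blast+
  define N1 where "N1 q = fd \<Phi> (J q) (pd1 c1 q, pd1 V1 q, pd1 c2 q, pd1 V2 q)" for q
  define N2 where "N2 q = fd \<Gamma> (J q) (pd1 c1 q, pd1 V1 q, pd1 c2 q, pd1 V2 q)" for q
  \<comment> \<open>\<open>flow_differentiable_in_x\<close> concerns closed squares with data up to the boundary.\<close>
  have local: "continuous_on (osq r) (pd1 V1) \<and> continuous_on (osq r) (pd1 V2) \<and>
    (\<forall>x t. (x, t) \<in> osq r \<longrightarrow>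
      ((\<lambda>x. V1 (x, t)) has_real_derivative pd1 V1 (x, t)) (at x) \<and>
      ((\<lambda>x. V2 (x, t)) has_real_derivative pd1 V2 (x, t)) (at x) \<and>
      ((\<lambda>t. pd1 V1 (x, t)) has_real_derivative N1 (x, t)) (at t) \<and>
      ((\<lambda>t. pd1 V2 (x, t)) has_real_derivative N2 (x, t)) (at t)) \<and>
    (\<forall>x. \<bar>x\<bar> < r \<longrightarrow> pd1 V1 (x, 0) = b1 \<and> pd1 V2 (x, 0) = b2)" if r: "0 < r" "r < R" for r
  proof -
    have sub: "sq r \<subseteq> osq R" using r(2) by (rule sq_subset_osq)
    have rL: "4 * r * (1 + 2 * L) \<le> 1"
    proof -
      have "r * (1 + 2 * L) \<le> R * (1 + 2 * L)" using r R(3) by (intro mult_right_mono) auto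
      then show ?thesis using R(2) by linarith
    qed
    have n1: "ndiff_on (Suc 0) \<Phi> D" "ndiff_on (Suc 0) \<Gamma> D"
      using \<Phi> \<Gamma> ndiff_on_le[of "Suc k" _ D "Suc 0"] by blast+
    have cont: "continuous_on (sq r) c1" "continuous_on (sq r) c2" "continuous_on (sq r) V1"
      "continuous_on (sq r) V2" "continuous_on (sq r) (pd1 c1)" "continuous_on (sq r) (pd1 c2)"
      using cV ck pc ndiff_on_continuous continuous_on_subset[OF _ sub] by blast+
    obtain V1' V2' where V': "continuous_on (sq r) V1'" "continuous_on (sq r) V2'"
      "\<And>x t. (x, t) \<in> sq r \<Longrightarrow> ((\<lambda>x. V1 (x, t)) has_real_derivative V1' (x, t)) (at x within {-r..r})"
      "\<And>x t. (x, t) \<in> sq r \<Longrightarrow> ((\<lambda>x. V2 (x, t)) has_real_derivative V2' (x, t)) (at x within {-r..r})"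
      "\<And>x t. (x, t) \<in> sq r \<Longrightarrow> ((\<lambda>t. V1' (x, t)) has_real_derivative
        fd \<Phi> (J (x, t)) (pd1 c1 (x, t), V1' (x, t), pd1 c2 (x, t), V2' (x, t))) (at t within {-r..r})"
      "\<And>x t. (x, t) \<in> sq r \<Longrightarrow> ((\<lambda>t. V2' (x, t)) has_real_derivative
        fd \<Gamma> (J (x, t)) (pd1 c1 (x, t), V1' (x, t), pd1 c2 (x, t), V2' (x, t))) (at t within {-r..r})"
      "\<And>x. \<bar>x\<bar> \<le> r \<Longrightarrow> V1' (x, 0) = b1" "\<And>x. \<bar>x\<bar> \<le> r \<Longrightarrow> V2' (x, 0) = b2"
    proof (rule flow_differentiable_in_x[OF r(1) rL R(3) D(2) n1 _ cont])
      show "(c1 q, V1 q, c2 q, V2 q) \<in> D" if "q \<in> sq r" for q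
        using J[of q] that sub by (auto simp: J_def)
      show "((\<lambda>x. c1 (x, t)) has_real_derivative pd1 c1 (x, t)) (at x within {-r..r})"
        "((\<lambda>x. c2 (x, t)) has_real_derivative pd1 c2 (x, t)) (at x within {-r..r})" if "(x, t) \<in> sq r" for x t
        using cx[of x t] that sub by (blast intro: has_field_derivative_at_within)+
      show "((\<lambda>t. V1 (x, t)) has_real_derivative \<Phi> (c1 (x, t), V1 (x, t), c2 (x, t), V2 (x, t))) (at t within {-r..r})"
        "((\<lambda>t. V2 (x, t)) has_real_derivative \<Gamma> (c1 (x, t), V1 (x, t), c2 (x, t), V2 (x, t))) (at t within {-r..r})"
        if "(x, t) \<in> sq r" for x t
        using Vt[of x t] that sub unfolding J_def by (blast intro: has_field_derivative_at_within)+
      show "V1 (x, 0) = a1 + b1 * x" "V2 (x, 0) = a2 + b2 * x" if "\<bar>x\<bar> \<le> r" for x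
        using V0[of x] that r by auto
      show "\<bar>fd \<Phi> (c1 q, V1 q, c2 q, V2 q) v\<bar> \<le> L \<and> \<bar>fd \<Gamma> (c1 q, V1 q, c2 q, V2 q) v\<bar> \<le> L"
        if "q \<in> sq r" "v \<in> {e2, e4}" for q v
        using L[of q v] that sub unfolding J_def by blast
    qed (unfold J_def, blast)
    have at_r: "at x within {-r..r} = at x" if "x \<in> {-r<..<r}" for x
      by (rule at_within_interior) (use that in auto)
    have dV: "((\<lambda>x. V1 (x, t)) has_real_derivative V1' (x, t)) (at x)"
      "((\<lambda>x. V2 (x, t)) has_real_derivative V2' (x, t)) (at x)" if "(x, t) \<in> osq r" for x t
      using V'(3,4)[of x t] that at_r[of x] by auto
    have eq: "pd1 V1 q = V1' q" "pd1 V2 q = V2' q" if "q \<in> osq r" for q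
      using that dV by (cases q; simp add: pd1_def DERIV_imp_deriv)+
    have sub': "osq r \<subseteq> sq r" by auto
    show ?thesis
    proof (intro conjI allI impI)
      show "continuous_on (osq r) (pd1 V1)" "continuous_on (osq r) (pd1 V2)"
        using continuous_on_cong[OF refl, of "osq r" "pd1 V1" V1'] continuous_on_cong[OF refl, of "osq r" "pd1 V2" V2']
          eq continuous_on_subset[OF V'(1) sub'] continuous_on_subset[OF V'(2) sub'] by blast+
      fix x t assume xt: "(x, t) \<in> osq r"
      show "((\<lambda>x. V1 (x, t)) has_real_derivative pd1 V1 (x, t)) (at x)"
        "((\<lambda>x. V2 (x, t)) has_real_derivative pd1 V2 (x, t)) (at x)"
        using dV[OF xt] eq[OF xt] by auto
      have t: "t \<in> {-r<..<r}" and xs: "(x, s) \<in> osq r" if "s \<in> {-r<..<r}" for s using xt that by auto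
      have 1: "((\<lambda>t. V1' (x, t)) has_real_derivative N1 (x, t)) (at t)"
        "((\<lambda>t. V2' (x, t)) has_real_derivative N2 (x, t)) (at t)"
        using V'(5,6)[of x t] xt at_r[of t] unfolding N1_def N2_def eq[OF xt] by auto
      show "((\<lambda>t. pd1 V1 (x, t)) has_real_derivative N1 (x, t)) (at t)"
        by (rule has_field_derivative_transform_within_open[OF 1(1), of "{-r<..<r}"]) (use xt eq in auto)
      show "((\<lambda>t. pd1 V2 (x, t)) has_real_derivative N2 (x, t)) (at t)"
        by (rule has_field_derivative_transform_within_open[OF 1(2), of "{-r<..<r}"]) (use xt eq in auto)
    next
      fix x assume "\<bar>x\<bar> < r"
      then show "pd1 V1 (x, 0) = b1" "pd1 V2 (x, 0) = b2"
        using eq[of "(x, 0)"] V'(7,8)[of x] r(1) by (auto simp: abs_less_iff)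
    qed
  qed
  have dV: "((\<lambda>x. V1 (x, t)) has_real_derivative pd1 V1 (x, t)) (at x)"
    "((\<lambda>x. V2 (x, t)) has_real_derivative pd1 V2 (x, t)) (at x)"
    "((\<lambda>t. pd1 V1 (x, t)) has_real_derivative N1 (x, t)) (at t)"
    "((\<lambda>t. pd1 V2 (x, t)) has_real_derivative N2 (x, t)) (at t)"
    "isCont (pd1 V1) (x, t)" "isCont (pd1 V2) (x, t)" if xtR: "(x, t) \<in> osq R" for x t
  proof -
    obtain r where r: "0 < r" "r < R" "\<bar>x\<bar> < r" "\<bar>t\<bar> < r" by (rule osq_in_sq[OF xtR])
    have xt: "(x, t) \<in> osq r" using r(3,4) by (auto simp: abs_less_iff)
    show "((\<lambda>x. V1 (x, t)) has_real_derivative pd1 V1 (x, t)) (at x)"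
    "((\<lambda>x. V2 (x, t)) has_real_derivative pd1 V2 (x, t)) (at x)"
    "((\<lambda>t. pd1 V1 (x, t)) has_real_derivative N1 (x, t)) (at t)"
    "((\<lambda>t. pd1 V2 (x, t)) has_real_derivative N2 (x, t)) (at t)"
    "isCont (pd1 V1) (x, t)" "isCont (pd1 V2) (x, t)"
      using local[OF r(1,2)] xt continuous_on_eq_continuous_at[OF open_osq] by blast+
  qed
  have cpV: "continuous_on (osq R) (pd1 V1)" "continuous_on (osq R) (pd1 V2)"
    unfolding continuous_on_eq_continuous_at[OF open_osq] using dV by auto
  have pV0: "pd1 V1 (x, 0) = b1" "pd1 V2 (x, 0) = b2" if "\<bar>x\<bar> < R" for x
  proof -
    obtain r where "\<bar>x\<bar> < r" "r < R" using \<open>\<bar>x\<bar> < R\<close> dense by blast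
    then show "pd1 V1 (x, 0) = b1" "pd1 V2 (x, 0) = b2" using local[of r] abs_ge_zero[of x] by auto
  qed
  \<comment> \<open>The equation solved by the derivatives \<open>pd1 V1, pd1 V2\<close>; its parameters are \<open>x, t\<close> themselves.\<close>
  define \<Psi> where "\<Psi> f X = (case X of (x, a, t, b) \<Rightarrow> pd1 c1 (x, t) * fd f (J (x, t)) e1 + a * fd f (J (x, t)) e2
      + pd1 c2 (x, t) * fd f (J (x, t)) e3 + b * fd f (J (x, t)) e4)" for f and X :: jet_pt
  define D' where "D' = {X :: jet_pt. (fst X, fst (snd (snd X))) \<in> osq R}"
  have D': "open D'" "convex D'"
    unfolding D'_def by (rule open_osq_cylinder, rule convex_osq_cylinder)
  have coords: "ndiff_on k (\<lambda>X :: jet_pt. fst X) D'" "ndiff_on k (\<lambda>X :: jet_pt. fst (snd X)) D'"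
    "ndiff_on k (\<lambda>X :: jet_pt. fst (snd (snd X))) D'" "ndiff_on k (\<lambda>X :: jet_pt. snd (snd (snd X))) D'"
    by (intro ndiff_on_linear bounded_linear_fst bounded_linear_compose[OF bounded_linear_fst]
          bounded_linear_compose[OF bounded_linear_snd] bounded_linear_snd)+
  have pull: "ndiff_on k (\<lambda>X :: jet_pt. f (fst X, fst (snd (snd X)))) D'" if "ndiff_on k f (osq R)" for f
    by (rule ndiff_on_compose_pair[OF D'(1) _ that coords(1,3)]) (auto simp: D'_def)
  have fdJ: "ndiff_on k (\<lambda>q. fd f (J q) v) (osq R)" if "ndiff_on (Suc k) f D" for f v
    unfolding J_def
    by (rule ndiff_on_compose_jet[OF open_osq _ ndiff_on_Suc_fd[OF that] ck(1) Vk(1) ck(2) Vk(2)])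
      (use J in \<open>auto simp: J_def\<close>)
  have \<Psi>: "ndiff_on k (\<Psi> f) D'" if "ndiff_on (Suc k) f D" for f
  proof -
    have "\<Psi> f = (\<lambda>X. pd1 c1 (fst X, fst (snd (snd X))) * fd f (J (fst X, fst (snd (snd X)))) e1
        + fst (snd X) * fd f (J (fst X, fst (snd (snd X)))) e2
        + pd1 c2 (fst X, fst (snd (snd X))) * fd f (J (fst X, fst (snd (snd X)))) e3
        + snd (snd (snd X)) * fd f (J (fst X, fst (snd (snd X)))) e4)"
      by (auto simp: \<Psi>_def fun_eq_iff)
    then show ?thesis
      by (simp only:) (intro ndiff_on_add[OF D'(1)] ndiff_on_mult[OF D'(1)] coords
          pull[OF pc(1)] pull[OF pc(2)] pull[OF fdJ[OF that]])
  qed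
  have N\<Psi>: "fd f (J q) (pd1 c1 q, pd1 V1 q, pd1 c2 q, pd1 V2 q) = \<Psi> f (fst q, pd1 V1 q, snd q, pd1 V2 q)"
    if "ndiff_on (Suc k) f D" "q \<in> osq R" for f q
    using fd_jet[OF ndiff_on_Suc_differentiable[OF that(1) J[OF that(2)]], of "pd1 c1 q"]
    by (simp add: \<Psi>_def)
  have fd\<Psi>: "fd (\<Psi> f) (x, a, t, b) e2 = fd f (J (x, t)) e2" "fd (\<Psi> f) (x, a, t, b) e4 = fd f (J (x, t)) e4"
    if f: "ndiff_on (Suc k) f D" and k: "0 < k" and xt: "(x, t) \<in> osq R" for f x t a b
  proof -
    obtain j where "k = Suc j" using k by (cases k) auto
    then have "\<Psi> f differentiable (at (x, a, t, b))"
      using ndiff_on_Suc_differentiable[of j "\<Psi> f" D'] \<Psi>[OF f] xt by (auto simp: D'_def)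
    have "((\<lambda>s. \<Psi> f (x, s, t, b)) has_real_derivative fd (\<Psi> f) (x, a, t, b) e2) (at a)"
      by (rule has_real_derivative_along[where g = "\<lambda>s. (x, s, t, b)", OF fd_has_derivative])
        (use \<open>\<Psi> f differentiable (at (x, a, t, b))\<close> in \<open>auto intro!: derivative_eq_intros simp: zero_prod_def\<close>)
    moreover have "((\<lambda>s. \<Psi> f (x, s, t, b)) has_real_derivative fd f (J (x, t)) e2) (at a)"
      by (auto simp: \<Psi>_def intro!: derivative_eq_intros)
    ultimately show "fd (\<Psi> f) (x, a, t, b) e2 = fd f (J (x, t)) e2" by (rule DERIV_unique)
    have "((\<lambda>s. \<Psi> f (x, a, t, s)) has_real_derivative fd (\<Psi> f) (x, a, t, b) e4) (at b)"
      by (rule has_real_derivative_along[where g = "\<lambda>s. (x, a, t, s)", OF fd_has_derivative])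
        (use \<open>\<Psi> f differentiable (at (x, a, t, b))\<close> in \<open>auto intro!: derivative_eq_intros simp: zero_prod_def\<close>)
    moreover have "((\<lambda>s. \<Psi> f (x, a, t, s)) has_real_derivative fd f (J (x, t)) e4) (at b)"
      by (auto simp: \<Psi>_def intro!: derivative_eq_intros)
    ultimately show "fd (\<Psi> f) (x, a, t, b) e4 = fd f (J (x, t)) e4" by (rule DERIV_unique)
  qed
  have "flow k R L (\<Psi> \<Phi>) (\<Psi> \<Gamma>) fst snd (pd1 V1) (pd1 V2)"
    unfolding flow_def
  proof (rule exI[of _ D'], rule exI[of _ b1], rule exI[of _ 0], rule exI[of _ b2], rule exI[of _ 0],
      intro conjI ballI allI impI)
    show "(fst q, pd1 V1 q, snd q, pd1 V2 q) \<in> D'" if "q \<in> osq R" for q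
      using that by (cases q) (simp add: D'_def)
    show "((\<lambda>t. pd1 V1 (x, t)) has_real_derivative \<Psi> \<Phi> (fst (x, t), pd1 V1 (x, t), snd (x, t), pd1 V2 (x, t))) (at t)"
      "((\<lambda>t. pd1 V2 (x, t)) has_real_derivative \<Psi> \<Gamma> (fst (x, t), pd1 V1 (x, t), snd (x, t), pd1 V2 (x, t))) (at t)"
      if "(x, t) \<in> osq R" for x t
      using dV(3,4)[OF that] unfolding N1_def N2_def N\<Psi>[OF \<Phi> that] N\<Psi>[OF \<Gamma> that] .
    show "pd1 V1 (x, 0) = b1 + 0 * x" "pd1 V2 (x, 0) = b2 + 0 * x" if "\<bar>x\<bar> < R" for x using pV0[OF that] by auto
    fix q v assume *: "0 < k" "q \<in> osq R" "v \<in> {e2, e4}"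
    obtain x t where q: "q = (x, t)" by (cases q)
    from *(3) consider "v = e2" | "v = e4" by blast
    then show "\<bar>fd (\<Psi> \<Phi>) (fst q, pd1 V1 q, snd q, pd1 V2 q) v\<bar> \<le> L"
      "\<bar>fd (\<Psi> \<Gamma>) (fst q, pd1 V1 q, snd q, pd1 V2 q) v\<bar> \<le> L"
      using L[OF *(2,3)] *(2) fd\<Psi>[OF \<Phi> *(1)] fd\<Psi>[OF \<Gamma> *(1)] unfolding q by (cases; simp)+
  qed (use D' \<Psi>[OF \<Phi>] \<Psi>[OF \<Gamma>] cpV in \<open>auto intro!: ndiff_on_linear bounded_linear_fst bounded_linear_snd\<close>)
  then have pk: "ndiff_on k (pd1 V1) (osq R)" "ndiff_on k (pd1 V2) (osq R)" using Suc.IH by blast+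
  have \<Phi>J: "ndiff_on k (\<lambda>q. f (J q)) (osq R)" if "ndiff_on (Suc k) f D" for f
    unfolding J_def
    by (rule ndiff_on_compose_jet[OF open_osq _ ndiff_on_SucD[OF that] ck(1) Vk(1) ck(2) Vk(2)])
      (use J in \<open>auto simp: J_def\<close>)
  show ?case
    using ndiff_on_SucI[OF open_osq dV(1) Vt(1) pk(1) \<Phi>J[OF \<Phi>]]
      ndiff_on_SucI[OF open_osq dV(2) Vt(2) pk(2) \<Phi>J[OF \<Gamma>]] by blast
qed

text \<open>Up to the exchange of \<open>x\<close> and \<open>t\<close>, a primitive is a flow whose right-hand side does not
  involve the unknowns, with \<open>L = 0\<close>.\<close>

lemma ndiff_on_prim_x:
  assumes R: "0 < R" "4 * R \<le> 1" and n: "ndiff_on k n (osq R)"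
  shows "ndiff_on k (\<lambda>q. prim (\<lambda>s. n (s, snd q)) (fst q)) (osq R)"
proof -
  define m where "m q = n (snd q, fst q)" for q
  define V where "V q = prim (\<lambda>s. n (s, fst q)) (snd q)" for q
  have cn: "continuous_on (osq R) n" using n by (rule ndiff_on_continuous)
  have swap: "ndiff_on k (\<lambda>q. f (snd q, fst q)) (osq R)" if "ndiff_on k f (osq R)" for f
    by (rule ndiff_on_compose_pair[OF open_osq _ that])
      (auto intro!: ndiff_on_linear bounded_linear_fst bounded_linear_snd)
  have mult: "(x * \<theta>, t) \<in> osq R" if "(x, t) \<in> osq R" "\<theta> \<in> {0..1}" for x t \<theta>
    using mult_unit_interval[of \<theta> x "\<bar>x\<bar>"] that by (auto simp: abs_le_iff abs_if split: if_splits)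
  define D' where "D' = {X :: jet_pt. (fst X, fst (snd (snd X))) \<in> osq R}"
  have D': "open D'" "convex D'"
    unfolding D'_def by (rule open_osq_cylinder, rule convex_osq_cylinder)
  define \<Phi> where "\<Phi> X = m (fst X, fst (snd (snd X)))" for X :: jet_pt
  have \<Phi>: "ndiff_on k \<Phi> D'"
    unfolding \<Phi>_def m_def
    by (rule ndiff_on_compose_pair[OF D'(1) _ n])
      (auto simp: D'_def intro!: ndiff_on_linear bounded_linear_fst bounded_linear_compose[OF bounded_linear_fst]
          bounded_linear_compose[OF bounded_linear_snd] bounded_linear_snd)
  have cV: "continuous_on (osq R) V"
  proof -
    have c: "continuous_on (osq R) (\<lambda>q. prim (\<lambda>s. n (s, snd q)) (fst q))"
      by (rule continuous_on_prim_x[OF cn mult])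
    have "continuous_on (osq R) (\<lambda>q. (\<lambda>q. prim (\<lambda>s. n (s, snd q)) (fst q)) (snd q, fst q))"
      by (rule continuous_on_compose2[OF c]) (auto intro!: continuous_intros)
    then show ?thesis by (simp add: V_def[abs_def])
  qed
  have Vt: "((\<lambda>t. V (x, t)) has_real_derivative \<Phi> (fst (x, t), V (x, t), snd (x, t), V (x, t))) (at t)"
    if "(x, t) \<in> osq R" for x t
    using prim_has_derivative_in_osq[OF cn, of t x] that by (simp add: V_def \<Phi>_def m_def)
  have fd0: "fd \<Phi> (fst q, V q, snd q, V q) v = 0" if k: "0 < k" and q: "q \<in> osq R" and v: "v \<in> {e2, e4}" for q v
  proof -
    obtain j where "k = Suc j" using k by (cases k) auto
    then have d: "\<Phi> differentiable (at (fst q, V q, snd q, V q))"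
      using ndiff_on_Suc_differentiable[of j \<Phi> D'] \<Phi> q by (auto simp: D'_def)
    have "((\<lambda>s. (fst q, V q, snd q, V q) + s *\<^sub>R v) has_vector_derivative v) (at 0)"
      by (auto intro!: derivative_eq_intros)
    then have "((\<lambda>s. \<Phi> ((fst q, V q, snd q, V q) + s *\<^sub>R v)) has_real_derivative fd \<Phi> (fst q, V q, snd q, V q) v) (at 0)"
      by (intro has_real_derivative_along) (use fd_has_derivative[OF d] in auto)
    moreover have "(\<lambda>s. \<Phi> ((fst q, V q, snd q, V q) + s *\<^sub>R v)) = (\<lambda>s. \<Phi> (fst q, V q, snd q, V q))"
      using v by (auto simp: \<Phi>_def fun_eq_iff)
    ultimately show ?thesis using DERIV_unique[OF _ DERIV_const] by simp
  qed
  have "flow k R 0 \<Phi> \<Phi> fst snd V V"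
    unfolding flow_def
  proof (rule exI[of _ D'], (rule exI[of _ 0])+, intro conjI ballI allI impI)
    fix q v assume "0 < k" "q \<in> osq R" "v \<in> {e2, e4}"
    then show "\<bar>fd \<Phi> (fst q, V q, snd q, V q) v\<bar> \<le> 0" "\<bar>fd \<Phi> (fst q, V q, snd q, V q) v\<bar> \<le> 0"
      by (simp_all only: fd0 abs_zero order_refl)
  next
    show "(fst q, V q, snd q, V q) \<in> D'" if "q \<in> osq R" for q
      using that by (cases q) (simp add: D'_def)
    show "V (x, 0) = 0 + 0 * x" "V (x, 0) = 0 + 0 * x" for x by (simp_all add: V_def)
    show "((\<lambda>t. V (x, t)) has_real_derivative \<Phi> (fst (x, t), V (x, t), snd (x, t), V (x, t))) (at t)"
      "((\<lambda>t. V (x, t)) has_real_derivative \<Phi> (fst (x, t), V (x, t), snd (x, t), V (x, t))) (at t)"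
      if "(x, t) \<in> osq R" for x t by (rule Vt[OF that])+
  qed (intro D' \<Phi> cV ndiff_on_linear bounded_linear_fst bounded_linear_snd)+
  then have "ndiff_on k V (osq R)" using flow_ndiff[of R 0 k \<Phi> \<Phi> fst snd V V] R by simp
  from swap[OF this] show ?thesis by (simp add: V_def)
qed

text \<open>With \<open>w = u\<^sub>x\<close> and \<open>s = v\<^sub>x\<close>, the data are affine functions with the prescribed slopes, for
  \<open>u, v\<close> on the \<open>t\<close>-axis and for \<open>w, s\<close> on the \<open>x\<close>-axis. Composition with the
  projection to a ball makes the right-hand sides globally Lipschitz; near the origin the solution
  stays in the ball, where the projection is the identity. Smoothness is gained alternately: if
  \<open>u, v, w, s\<close> are \<open>k\<close> times differentiable, then so are \<open>u\<^sub>x = w\<close> and \<open>u\<^sub>t\<close>, which is a constant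
  plus the integral of \<open>F\<close> along \<open>x\<close>, so \<open>u\<close> and \<open>v\<close> have order \<open>k + 1\<close>; and then \<open>w, s\<close> have this order as a flow with
  parameters \<open>u, v\<close>.\<close>

theorem goursat_smooth:
  assumes D: "open D" and F: "smooth_on F D" and G: "smooth_on G D" and X0: "(z0, z1, y0, y1) \<in> D"
  obtains R u v where "0 < R" "smooth_on u (osq R)" "smooth_on v (osq R)" "jet u v ` osq R \<subseteq> D"
    "solves_system F G (osq R) u v" "jet u v (0, 0) = (z0, z1, y0, y1)"
    "pd2 u (0, 0) = p1" "pd2 v (0, 0) = p2" "pd1 (pd1 u) (0, 0) = q1" "pd1 (pd1 v) (0, 0) = q2"
proof -
  let ?X = "(z0, z1, y0, y1)"
  obtain \<rho> where \<rho>: "0 < \<rho>" "cball ?X \<rho> \<subseteq> D" using D X0 open_contains_cball by blast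
  define K where "K = cball ?X \<rho>"
  have K: "compact K" "convex K" "closed K" "K \<noteq> {}" "K \<subseteq> D" using \<rho> by (auto simp: K_def)
  have bnd: "\<exists>M\<ge>0. \<forall>x\<in>K. \<forall>v. \<bar>fd f x v\<bar> \<le> M * norm v" if f: "smooth_on f D" for f
    by (rule fd_bound[OF K(1), of f])
      (use smooth_on_differentiable[OF f] smooth_on_continuous[OF smooth_on_fd[OF f]] continuous_on_subset[OF _ K(5)] K(5) in blast)+
  obtain LF where LF: "0 \<le> LF" "\<And>x v. x \<in> K \<Longrightarrow> \<bar>fd F x v\<bar> \<le> LF * norm v" using bnd[OF F] by blast
  obtain LG where LG: "0 \<le> LG" "\<And>x v. x \<in> K \<Longrightarrow> \<bar>fd G x v\<bar> \<le> LG * norm v" using bnd[OF G] by blast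
  define L where "L = LF + LG"
  have L: "0 \<le> L" "\<And>x v. x \<in> K \<Longrightarrow> \<bar>fd F x v\<bar> \<le> L * norm v" "\<And>x v. x \<in> K \<Longrightarrow> \<bar>fd G x v\<bar> \<le> L * norm v"
  proof -
    have "LF * norm v \<le> L * norm v" "LG * norm v \<le> L * norm v" for v :: jet_pt
      using LF(1) LG(1) by (auto simp: L_def intro!: mult_right_mono)
    then show "\<And>x v. x \<in> K \<Longrightarrow> \<bar>fd F x v\<bar> \<le> L * norm v" "\<And>x v. x \<in> K \<Longrightarrow> \<bar>fd G x v\<bar> \<le> L * norm v"
      by (meson LF(2) LG(2) order_trans)+
    show "0 \<le> L" using LF(1) LG(1) by (simp add: L_def)
  qed
  have lip: "\<bar>f (closest_point K X) - f (closest_point K Y)\<bar> \<le> L * norm (X - Y)"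
    if f: "smooth_on f D" and fL: "\<And>x v. x \<in> K \<Longrightarrow> \<bar>fd f x v\<bar> \<le> L * norm v" for f X Y
  proof -
    have in_K: "closest_point K Z \<in> K" for Z by (rule closest_point_in_set[OF K(3,4)])
    have seg: "closed_segment (closest_point K Y) (closest_point K X) \<subseteq> K"
      by (rule closed_segment_subset[OF in_K in_K K(2)])
    obtain c where c: "c \<in> closed_segment (closest_point K Y) (closest_point K X)"
      "f (closest_point K X) - f (closest_point K Y) = fd f c (closest_point K X - closest_point K Y)"
      by (rule mean_value_segment[of "closest_point K Y" "closest_point K X" f])
        (use seg smooth_on_differentiable[OF f] K(5) in blast)
    have "\<bar>f (closest_point K X) - f (closest_point K Y)\<bar> \<le> L * norm (closest_point K X - closest_point K Y)"
      unfolding c(2) using fL[of c] c(1) seg by blast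
    also have "\<dots> \<le> L * norm (X - Y)"
      using closest_point_lipschitz[OF K(2,3,4), of X Y] L(1) by (intro mult_left_mono) (auto simp: dist_norm)
    finally show ?thesis .
  qed
  have cont: "continuous_on (S \<times> UNIV) (\<lambda>(q, X). f (closest_point K X))" if f: "smooth_on f D" for f and S :: "(real \<times> real) set"
  proof -
    have 1: "continuous_on UNIV (closest_point K)" by (rule continuous_on_closest_point[OF K(2,3,4)])
    have 2: "continuous_on UNIV (\<lambda>X. f (closest_point K X))"
      by (rule continuous_on_compose2[OF smooth_on_continuous[OF f] 1])
        (use closest_point_in_set[OF K(3,4)] K(5) in blast)
    have "continuous_on (S \<times> UNIV) (\<lambda>p. f (closest_point K (snd p)))"
      by (rule continuous_on_compose2[OF 2]) (auto intro!: continuous_intros)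
    then show ?thesis by (simp add: case_prod_beta')
  qed
  \<comment> \<open>small enough for the fixed point equation and, with \<open>2 * L\<close>, for the linearized flows\<close>
  define r where "r = 1 / (4 * (1 + 2 * L))"
  have r: "0 < r" "4 * r * (1 + 2 * L) \<le> 1" using L(1) by (auto simp: r_def)
  have small: "4 * s * (1 + 2 * L) \<le> 1" "4 * s * (1 + L) \<le> 1" "4 * s \<le> 1" if "0 < s" "s \<le> r" for s
  proof -
    have "s * (1 + 2 * L) \<le> r * (1 + 2 * L)" using that L(1) by (intro mult_right_mono) auto
    then show 1: "4 * s * (1 + 2 * L) \<le> 1" using r(2) by linarith
    have "0 \<le> s * L" using that L(1) by simp
    then show "4 * s * (1 + L) \<le> 1" "4 * s \<le> 1" using 1 by (simp_all add: algebra_simps)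
  qed
  obtain u w v s where cont_uw: "continuous_on (sq r) u" "continuous_on (sq r) w"
    "continuous_on (sq r) v" "continuous_on (sq r) s"
    and uw: "\<And>x t. (x, t) \<in> sq r \<Longrightarrow>
      ((\<lambda>x. u (x, t)) has_real_derivative w (x, t)) (at x within {-r..r})"
    "\<And>x t. (x, t) \<in> sq r \<Longrightarrow>
      ((\<lambda>x. v (x, t)) has_real_derivative s (x, t)) (at x within {-r..r})"
    "\<And>x t. (x, t) \<in> sq r \<Longrightarrow> ((\<lambda>t. w (x, t)) has_real_derivative
      F (closest_point K (u (x, t), w (x, t), v (x, t), s (x, t)))) (at t within {-r..r})"
    "\<And>x t. (x, t) \<in> sq r \<Longrightarrow> ((\<lambda>t. s (x, t)) has_real_derivative
      G (closest_point K (u (x, t), w (x, t), v (x, t), s (x, t)))) (at t within {-r..r})"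
    and ini: "\<And>t. \<bar>t\<bar> \<le> r \<Longrightarrow> u (0, t) = z0 + p1 * t" "\<And>t. \<bar>t\<bar> \<le> r \<Longrightarrow> v (0, t) = y0 + p2 * t"
    "\<And>x. \<bar>x\<bar> \<le> r \<Longrightarrow> w (x, 0) = z1 + q1 * x" "\<And>x. \<bar>x\<bar> \<le> r \<Longrightarrow> s (x, 0) = y1 + q2 * x"
    by (rule goursat_Lipschitz[of r L "\<lambda>q X. F (closest_point K X)" "\<lambda>q X. G (closest_point K X)" z0 p1 y0 p2 z1 q1 y1 q2])
      (use r(1) small(2)[of r] L(1) cont[OF F] cont[OF G] lip[OF F L(2)] lip[OF G L(3)] in auto)
  define J where "J q = (u q, w q, v q, s q)" for q
  have cJ: "continuous_on (sq r) J" unfolding J_def[abs_def] by (intro continuous_on_jet cont_uw)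
  have J0: "J (0, 0) = ?X" using ini[of 0] r(1) by (simp add: J_def)
  obtain d where d: "0 < d" "\<And>q. q \<in> sq r \<Longrightarrow> dist q (0, 0) < d \<Longrightarrow> dist (J q) ?X < \<rho>"
    using cJ[unfolded continuous_on_iff, rule_format, of "(0, 0)" \<rho>] \<rho>(1) r(1) unfolding J0 by auto
  define R where "R = min r (d / 2)"
  have R: "0 < R" "R \<le> r" "2 * R \<le> d" using r(1) d(1) by (auto simp: R_def)
  have osq_sq: "osq R \<subseteq> sq r" using R by auto
  have J_ball: "J q \<in> ball ?X \<rho>" if "q \<in> osq R" for q
  proof -
    obtain x t where q: "q = (x, t)" by (cases q)
    have "dist q (0, 0) \<le> \<bar>x\<bar> + \<bar>t\<bar>" unfolding q using norm_Pair_le[of x t] by (simp add: dist_norm)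
    also have "\<dots> < d" using that R q by (auto simp: abs_if)
    finally show ?thesis using d(2)[of q] that osq_sq by (auto simp: dist_commute)
  qed
  have clK: "closest_point K (J q) = J q" if "q \<in> osq R" for q
    by (rule closest_point_self) (use J_ball[OF that] in \<open>auto simp: K_def\<close>)
  have at_r: "at x within {-r..r} = at x" if "x \<in> {-R<..<R}" for x
    by (rule at_within_interior) (use that R in auto)
  have ux: "((\<lambda>x. u (x, t)) has_real_derivative w (x, t)) (at x)"
    "((\<lambda>x. v (x, t)) has_real_derivative s (x, t)) (at x)"
    "((\<lambda>t. w (x, t)) has_real_derivative F (J (x, t))) (at t)"
    "((\<lambda>t. s (x, t)) has_real_derivative G (J (x, t))) (at t)" if "(x, t) \<in> osq R" for x t
    using uw[OF subsetD[OF osq_sq that]] that at_r[of x] at_r[of t] clK[OF that] unfolding J_def[symmetric] by auto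
  have cR: "continuous_on (osq R) u" "continuous_on (osq R) w" "continuous_on (osq R) v" "continuous_on (osq R) s"
    using cont_uw continuous_on_subset[OF _ osq_sq] by blast+
  have balls: "open (ball ?X \<rho>)" "convex (ball ?X \<rho>)" "ball ?X \<rho> \<subseteq> D" "ball ?X \<rho> \<subseteq> K"
    using \<rho>(2) by (auto simp: K_def)
  have cFJ: "continuous_on (osq R) (\<lambda>q. f (J q))" if "smooth_on f D" for f
    by (rule continuous_on_compose2[OF smooth_on_continuous[OF that] continuous_on_subset[OF cJ osq_sq]])
      (use J_ball balls in blast)
  have ut: "((\<lambda>t. u (x, t)) has_real_derivative p1 + prim (\<lambda>\<sigma>. F (J (\<sigma>, t))) x) (at t)"
    "((\<lambda>t. v (x, t)) has_real_derivative p2 + prim (\<lambda>\<sigma>. G (J (\<sigma>, t))) x) (at t)" if "(x, t) \<in> osq R" for x t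
  proof -
    have lin: "((\<lambda>t. f (0, t)) has_real_derivative p) (at t)"
      if "\<And>t. \<bar>t\<bar> \<le> r \<Longrightarrow> f (0, t) = z + p * t" "\<bar>t\<bar> < R" for f :: "real \<times> real \<Rightarrow> real" and z p t
    proof (rule has_field_derivative_transform_within_open[of "\<lambda>t. z + p * t" _ _ "{-R<..<R}"])
      show "((\<lambda>t. z + p * t) has_real_derivative p) (at t)" by (auto intro!: derivative_eq_intros)
    qed (use that R in auto)
    show "((\<lambda>t. u (x, t)) has_real_derivative p1 + prim (\<lambda>\<sigma>. F (J (\<sigma>, t))) x) (at t)"
      by (rule has_transverse_derivative[OF ux(1) ux(3) cR(2) cFJ[OF F] lin[OF ini(1)] that])
    show "((\<lambda>t. v (x, t)) has_real_derivative p2 + prim (\<lambda>\<sigma>. G (J (\<sigma>, t))) x) (at t)"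
      by (rule has_transverse_derivative[OF ux(2) ux(4) cR(4) cFJ[OF G] lin[OF ini(2)] that])
  qed
  have smooth: "ndiff_on k u (osq R) \<and> ndiff_on k v (osq R) \<and> ndiff_on k w (osq R) \<and> ndiff_on k s (osq R)" for k
  proof (induction k)
    case 0
    then show ?case using cR by simp
  next
    case (Suc k)
    have nF: "ndiff_on j F (ball ?X \<rho>)" "ndiff_on j G (ball ?X \<rho>)" for j
      using F G balls(3) ndiff_on_subset unfolding smooth_on_def by blast+
    have FJ: "ndiff_on k (\<lambda>q. f (J q)) (osq R)" if "ndiff_on k f (ball ?X \<rho>)" for f
      unfolding J_def by (rule ndiff_on_compose_jet[OF open_osq _ that]) (use Suc J_ball in \<open>auto simp: J_def\<close>)
    have pr: "ndiff_on k (\<lambda>q. p + prim (\<lambda>\<sigma>. f (J (\<sigma>, snd q))) (fst q)) (osq R)" if "ndiff_on k f (ball ?X \<rho>)" for f p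
      by (rule ndiff_on_add[OF open_osq ndiff_on_const ndiff_on_prim_x[OF R(1) _ FJ[OF that]]])
        (rule small(3)[OF R(1,2)])
    have uv: "ndiff_on (Suc k) u (osq R)" "ndiff_on (Suc k) v (osq R)"
      by (rule ndiff_on_SucI[OF open_osq ux(1) _ _ pr[OF nF(1)], of p1] ndiff_on_SucI[OF open_osq ux(2) _ _ pr[OF nF(2)], of p2];
          use ut Suc in simp)+
    have "flow (Suc k) R L F G u v w s"
      unfolding flow_def J_def[symmetric]
    proof (rule exI[of _ "ball ?X \<rho>"], rule exI[of _ z1], rule exI[of _ q1], rule exI[of _ y1], rule exI[of _ q2],
        intro conjI ballI allI impI)
      fix q and e :: jet_pt assume q: "q \<in> osq R" and e: "e \<in> {e2, e4}"
      have "norm e \<le> 1" using e by (auto simp: norm_Pair)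
      then have "L * norm e \<le> L" using L(1) by (simp add: mult_left_le)
      then show "\<bar>fd F (J q) e\<bar> \<le> L" "\<bar>fd G (J q) e\<bar> \<le> L"
        using L(2,3)[of "J q" e] J_ball[OF q] balls(4) by force+
    qed (use balls nF uv cR J_ball ux ini R in auto)
    then have "ndiff_on (Suc k) w (osq R) \<and> ndiff_on (Suc k) s (osq R)"
      by (rule flow_ndiff[OF R(1) small(1)[OF R(1,2)] L(1)])
    then show ?case using uv by blast
  qed
  have sm: "smooth_on u (osq R)" "smooth_on v (osq R)" "smooth_on w (osq R)" "smooth_on s (osq R)"
    using smooth by (auto simp: smooth_on_def)
  have pd_uw: "pd1 u q = w q" "pd1 v q = s q" if "q \<in> osq R" for q
    using that ux by (cases q; simp add: pd1_def DERIV_imp_deriv)+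
  have pd2_eq: "pd2 g (x, t) = f" if "\<And>q. q \<in> osq R \<Longrightarrow> g q = h q" "(x, t) \<in> osq R"
    "((\<lambda>t. h (x, t)) has_real_derivative f) (at t)" for g h f x t
  proof -
    have "((\<lambda>t. g (x, t)) has_real_derivative f) (at t)"
      by (rule has_field_derivative_transform_within_open[OF that(3), of "{-R<..<R}"]) (use that in auto)
    then show ?thesis by (simp add: pd2_def DERIV_imp_deriv)
  qed
  have pd1_eq: "pd1 g (0, 0) = p" if "\<And>q. q \<in> osq R \<Longrightarrow> g q = h q" "\<And>x. \<bar>x\<bar> \<le> r \<Longrightarrow> h (x, 0) = z + p * x" for g h z p
  proof -
    have "((\<lambda>x. g (x, 0)) has_real_derivative p) (at 0)"
    proof (rule has_field_derivative_transform_within_open[of "\<lambda>x. z + p * x" _ _ "{-R<..<R}"])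
      show "((\<lambda>t. z + p * t) has_real_derivative p) (at 0)" by (auto intro!: derivative_eq_intros)
    qed (use that R in auto)
    then show ?thesis by (simp add: pd1_def DERIV_imp_deriv)
  qed
  have jetJ: "jet u v q = J q" if "q \<in> osq R" for q using pd_uw[OF that] by (simp add: jet_def J_def)
  have 00: "(0, 0) \<in> osq R" using R(1) by simp
  show ?thesis
  proof (rule that[OF R(1) sm(1,2)])
    show "jet u v ` osq R \<subseteq> D" using jetJ J_ball balls(3) by auto
    show "solves_system F G (osq R) u v"
      unfolding solves_system_def
    proof
      fix q assume q: "q \<in> osq R"
      obtain x t where qxt: "q = (x, t)" by (cases q)
      show "pd2 (pd1 u) q = F (jet u v q) \<and> pd2 (pd1 v) q = G (jet u v q)"
        unfolding jetJ[OF q] unfolding qxt using q ux(3,4)[of x t]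
        by (intro conjI pd2_eq[of "pd1 u" w] pd2_eq[of "pd1 v" s]) (auto simp: pd_uw qxt)
    qed
    show "jet u v (0, 0) = ?X" using jetJ[OF 00] J0 by simp
    show "pd2 u (0, 0) = p1" "pd2 v (0, 0) = p2"
      using pd2_eq[OF refl 00 ut(1)[OF 00]] pd2_eq[OF refl 00 ut(2)[OF 00]] by auto
    show "pd1 (pd1 u) (0, 0) = q1" "pd1 (pd1 v) (0, 0) = q2"
      using pd1_eq[OF pd_uw(1) ini(3)] pd1_eq[OF pd_uw(2) ini(4)] by auto
  qed
qed

section \<open>Symmetry of mixed partial derivatives\<close>

text \<open>The \<open>t\<close>-derivative of \<open>p\<close> is a function of \<open>t\<close> plus the integral over \<open>x\<close> of the \<open>t\<close>-derivative of
  \<open>p\<^sub>x\<close>, by differentiation under the integral sign; now differentiate in \<open>x\<close>.\<close>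

lemma pd_commute:
  assumes S: "open S" and p: "smooth_on p S" and q: "q \<in> S"
  shows "pd1 (pd2 p) q = pd2 (pd1 p) q"
proof -
  obtain x0 t0 where q0: "q = (x0, t0)" by (cases q)
  obtain e where e: "e > 0" "ball (x0, t0) e \<subseteq> S" using S q q0 open_contains_ball by blast
  define R where "R = e / 2"
  have R: "0 < R" using e by (simp add: R_def)
  have in_S: "(x + x0, t + t0) \<in> S" if "(x, t) \<in> osq R" for x t
  proof -
    have "dist (x0, t0) (x + x0, t + t0) \<le> \<bar>x\<bar> + \<bar>t\<bar>"
      using norm_Pair_le[of x t] by (simp add: dist_norm norm_minus_commute norm_Pair)
    also have "\<dots> < e" using that by (auto simp: R_def abs_if)
    finally show ?thesis using e by auto
  qed
  define u where "u a = p (fst a + x0, snd a + t0)" for a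
  define w where "w a = pd1 p (fst a + x0, snd a + t0)" for a
  define n where "n a = pd2 (pd1 p) (fst a + x0, snd a + t0)" for a
  have p1: "smooth_on (pd1 p) S" and p2: "smooth_on (pd2 p) S" and p12: "smooth_on (pd2 (pd1 p)) S"
    using S p by (auto intro: smooth_on_pd1 smooth_on_pd2)
  have c: "continuous_on (osq R) (\<lambda>a. f (fst a + x0, snd a + t0))" if "smooth_on f S" for f :: "real \<times> real \<Rightarrow> real"
    by (rule continuous_on_compose2[OF smooth_on_continuous[OF that]])
      (use in_S in \<open>auto intro!: continuous_intros\<close>)
  have ux: "((\<lambda>x. u (x, t)) has_real_derivative w (x, t)) (at x)"
    and wt: "((\<lambda>t. w (x, t)) has_real_derivative n (x, t)) (at t)" if "(x, t) \<in> osq R" for x t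
    using smooth_on_DERIV_pd1[OF p in_S[OF that]] smooth_on_DERIV_pd2[OF p1 in_S[OF that]]
    by (simp_all add: u_def w_def n_def DERIV_shift)
  have u0: "((\<lambda>t. u (0, t)) has_real_derivative pd2 p (x0, t + t0)) (at t)" if "\<bar>t\<bar> < R" for t
    using smooth_on_DERIV_pd2[OF p in_S[of 0 t]] that R by (simp add: u_def DERIV_shift abs_less_iff)
  have cwn: "continuous_on (osq R) w" "continuous_on (osq R) n"
    unfolding w_def n_def by (rule c[OF p1], rule c[OF p12])
  have eq: "pd2 p (x + x0, t0) = pd2 p (x0, t0) + prim (\<lambda>s. n (s, 0)) x" if "x \<in> {-R<..<R}" for x
  proof -
    have x: "(x, 0) \<in> osq R" using that R by auto
    have "((\<lambda>t. u (x, t)) has_real_derivative pd2 p (x0, 0 + t0) + prim (\<lambda>s. n (s, 0)) x) (at 0)"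
      by (rule has_transverse_derivative[OF ux wt cwn u0 x])
    moreover have "((\<lambda>t. u (x, t)) has_real_derivative pd2 p (x + x0, t0)) (at 0)"
      using smooth_on_DERIV_pd2[OF p in_S[OF x]]
        DERIV_shift[of "\<lambda>t. p (x + x0, t)" "pd2 p (x + x0, t0)" 0 t0] by (simp add: u_def)
    ultimately show ?thesis using DERIV_unique by fastforce
  qed
  have 00: "(0, 0) \<in> osq R" using R by simp
  have "((\<lambda>x. pd2 p (x0, t0) + prim (\<lambda>s. n (s, 0)) x) has_real_derivative 0 + n (0, 0)) (at 0)"
    by (rule DERIV_add[OF DERIV_const prim_has_derivative_in_osq[OF cwn(2) 00]])
  then have "((\<lambda>x. pd2 p (x + x0, t0)) has_real_derivative 0 + n (0, 0)) (at 0)"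
    by (rule has_field_derivative_transform_within_open[of _ _ _ "{-R<..<R}"]) (use eq R in auto)
  moreover have "((\<lambda>x. pd2 p (x + x0, t0)) has_real_derivative pd1 (pd2 p) (x0, t0)) (at 0)"
    using smooth_on_DERIV_pd1[OF p2 in_S[OF 00]]
      DERIV_shift[of "\<lambda>x. pd2 p (x, t0)" "pd1 (pd2 p) (x0, t0)" 0 x0] by simp
  ultimately have "0 + n (0, 0) = pd1 (pd2 p) (x0, t0)" by (rule DERIV_unique)
  then show ?thesis by (simp add: q0 n_def)
qed

section \<open>The structure equations as pointwise conditions\<close>

text \<open>\<open>A\<close> and \<open>B\<close> are the \<open>x\<close>- and \<open>t\<close>-derivatives of the jet of a pair of functions.\<close>

definition structure_at :: "real \<Rightarrow> assoc_funs \<Rightarrow> jet_pt \<Rightarrow> jet_pt \<Rightarrow> jet_pt \<Rightarrow> bool" where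
  "structure_at \<delta> f X A B \<longleftrightarrow>
     fd (f 1 2) X A - fd (f 1 1) X B = f 3 1 X * f 2 2 X - f 3 2 X * f 2 1 X \<and>
     fd (f 2 2) X A - fd (f 2 1) X B = f 1 1 X * f 3 2 X - f 1 2 X * f 3 1 X \<and>
     fd (f 3 2) X A - fd (f 3 1) X B = \<delta> * (f 1 1 X * f 2 2 X - f 1 2 X * f 2 1 X)"

lemma
  assumes Q: "open Q" and u: "smooth_on u Q" and v: "smooth_on v Q" and q: "q \<in> Q"
    and f: "f differentiable (at (jet u v q))"
  shows pd1_jet: "pd1 (\<lambda>q. f (jet u v q)) q
      = fd f (jet u v q) (pd1 u q, pd1 (pd1 u) q, pd1 v q, pd1 (pd1 v) q)"
    and pd2_jet: "pd2 (\<lambda>q. f (jet u v q)) q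
      = fd f (jet u v q) (pd2 u q, pd2 (pd1 u) q, pd2 v q, pd2 (pd1 v) q)"
proof -
  have d: "u differentiable (at q)" "pd1 u differentiable (at q)" "v differentiable (at q)" "pd1 v differentiable (at q)"
    using u v q smooth_on_pd1[OF Q] smooth_on_differentiable by blast+
  have "((\<lambda>q. jet u v q) has_derivative (\<lambda>h. (fd u q h, fd (pd1 u) q h, fd v q h, fd (pd1 v) q h))) (at q)"
    unfolding jet_def by (intro has_derivative_Pair fd_has_derivative d)
  from diff_chain_at[OF this fd_has_derivative[OF f]]
  have D: "((\<lambda>q. f (jet u v q)) has_derivative
      (\<lambda>h. fd f (jet u v q) (fd u q h, fd (pd1 u) q h, fd v q h, fd (pd1 v) q h))) (at q)"
    by (simp add: o_def)
  then have df: "(\<lambda>q. f (jet u v q)) differentiable (at q)" unfolding differentiable_def by blast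
  show "pd1 (\<lambda>q. f (jet u v q)) q = fd f (jet u v q) (pd1 u q, pd1 (pd1 u) q, pd1 v q, pd1 (pd1 v) q)"
    "pd2 (\<lambda>q. f (jet u v q)) q = fd f (jet u v q) (pd2 u q, pd2 (pd1 u) q, pd2 v q, pd2 (pd1 v) q)"
    unfolding pd1_eq_fd[OF df] pd2_eq_fd[OF df] fd_eqI[OF D]
      pd1_eq_fd[OF d(1)] pd1_eq_fd[OF d(2)] pd1_eq_fd[OF d(3)] pd1_eq_fd[OF d(4)]
      pd2_eq_fd[OF d(1)] pd2_eq_fd[OF d(2)] pd2_eq_fd[OF d(3)] pd2_eq_fd[OF d(4)] by (rule refl)+
qed

lemma structure_equations_iff:
  assumes Q: "open Q" "smooth_on u Q" "smooth_on v Q" "jet u v ` Q \<subseteq> D"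
    and f: "\<forall>i\<in>{1,2,3}. \<forall>j\<in>{1,2}. smooth_on (f i j) D"
  shows "structure_equations \<delta> f Q u v \<longleftrightarrow> (\<forall>q\<in>Q. structure_at \<delta> f (jet u v q)
    (pd1 u q, pd1 (pd1 u) q, pd1 v q, pd1 (pd1 v) q) (pd2 u q, pd2 (pd1 u) q, pd2 v q, pd2 (pd1 v) q))"
proof -
  have d: "f i j differentiable (at (jet u v q))" if "i \<in> {1,2,3}" "j \<in> {1,2}" "q \<in> Q" for i j q
    using f that Q(4) smooth_on_differentiable[of "f i j" D] by blast
  note e = pd1_jet[OF Q(1-3)] pd2_jet[OF Q(1-3)]
  show ?thesis
    unfolding structure_equations_def structure_at_def Let_def omega_def ext_d_def wedge_def case_prod_conv
    by (intro ball_cong refl) (simp add: e d)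
qed

text \<open>By the existence of solutions with arbitrary \<open>u\<^sub>x\<^sub>x, v\<^sub>x\<^sub>x, u\<^sub>t, v\<^sub>t\<close> at a point,
  these four quantities are free variables in the structure equations.\<close>

lemma describes_surfaces_pointwise:
  assumes D: "open D" and F: "smooth_on F D" and G: "smooth_on G D"
    and ds: "describes_surfaces \<delta> D F G f" and X: "(z, z1, y, y1) \<in> D"
  shows "structure_at \<delta> f (z, z1, y, y1) (z1, a, y1, b) (c, F (z, z1, y, y1), d, G (z, z1, y, y1))"
proof -
  obtain R u v where R: "0 < R" "smooth_on u (osq R)" "smooth_on v (osq R)" "jet u v ` osq R \<subseteq> D"
    "solves_system F G (osq R) u v" "jet u v (0, 0) = (z, z1, y, y1)"
    "pd2 u (0, 0) = c" "pd2 v (0, 0) = d" "pd1 (pd1 u) (0, 0) = a" "pd1 (pd1 v) (0, 0) = b"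
    by (rule goursat_smooth[OF D F G X])
  have 00: "(0, 0) \<in> osq R" using R(1) by simp
  have f: "\<forall>i\<in>{1,2,3}. \<forall>j\<in>{1,2}. smooth_on (f i j) D"
    using ds unfolding describes_surfaces_def by blast
  have "structure_equations \<delta> f (osq R) u v"
    using ds R(2-5) open_osq unfolding describes_surfaces_def by blast
  then have "structure_at \<delta> f (jet u v (0, 0))
    (pd1 u (0, 0), pd1 (pd1 u) (0, 0), pd1 v (0, 0), pd1 (pd1 v) (0, 0))
    (pd2 u (0, 0), pd2 (pd1 u) (0, 0), pd2 v (0, 0), pd2 (pd1 v) (0, 0))"
    using structure_equations_iff[OF open_osq R(2-4) f] 00 by blast
  moreover have "pd1 u (0, 0) = z1" "pd1 v (0, 0) = y1" using R(6) by (auto simp: jet_def)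
  moreover have "pd2 (pd1 u) (0, 0) = F (z, z1, y, y1)" "pd2 (pd1 v) (0, 0) = G (z, z1, y, y1)"
    using R(5) 00 R(6) by (auto simp: solves_system_def)
  ultimately show ?thesis using R(6-10) by simp
qed

text \<open>A solution of the second system satisfies the structure equations, hence the first system; and
  its jet at one point can be prescribed.\<close>

lemma describes_surfaces_unique:
  assumes D: "open D" and F: "smooth_on F D" and G: "smooth_on G D"
    and F': "smooth_on F' D" and G': "smooth_on G' D"
    and ds: "describes_surfaces \<delta> D F G f"
    and st: "\<And>z z1 y y1 a b c d. (z, z1, y, y1) \<in> D \<Longrightarrow>
      structure_at \<delta> f (z, z1, y, y1) (z1, a, y1, b) (c, F' (z, z1, y, y1), d, G' (z, z1, y, y1))"
    and X: "X \<in> D"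
  shows "F' X = F X \<and> G' X = G X"
proof -
  obtain z z1 y y1 where X': "X = (z, z1, y, y1)" by (cases X)
  obtain R u v where R: "0 < R" "smooth_on u (osq R)" "smooth_on v (osq R)" "jet u v ` osq R \<subseteq> D"
    "solves_system F' G' (osq R) u v" "jet u v (0, 0) = (z, z1, y, y1)"
    "pd2 u (0, 0) = 0" "pd2 v (0, 0) = 0" "pd1 (pd1 u) (0, 0) = 0" "pd1 (pd1 v) (0, 0) = 0"
    using goursat_smooth[OF D F' G' X[unfolded X']] .
  have 00: "(0, 0) \<in> osq R" using R(1) by simp
  have f: "\<forall>i\<in>{1,2,3}. \<forall>j\<in>{1,2}. smooth_on (f i j) D"
    using ds unfolding describes_surfaces_def by blast
  have "structure_at \<delta> f (jet u v q) (pd1 u q, pd1 (pd1 u) q, pd1 v q, pd1 (pd1 v) q)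
      (pd2 u q, pd2 (pd1 u) q, pd2 v q, pd2 (pd1 v) q)" if q: "q \<in> osq R" for q
  proof -
    have j: "(u q, pd1 u q, v q, pd1 v q) \<in> D" using R(4) q by (auto simp: jet_def)
    have "pd2 (pd1 u) q = F' (jet u v q)" "pd2 (pd1 v) q = G' (jet u v q)"
      using R(5) q by (auto simp: solves_system_def)
    then show ?thesis using st[OF j] by (simp add: jet_def)
  qed
  then have "structure_equations \<delta> f (osq R) u v"
    using structure_equations_iff[OF open_osq R(2-4) f] by blast
  then have "solves_system F G (osq R) u v"
    using ds R(2-4) open_osq unfolding describes_surfaces_def by blast
  then show ?thesis
    using R(5,6) 00 unfolding solves_system_def X' by metis
qed

section \<open>Functions of fewer variables\<close>

lemma open_proj0: "open D \<Longrightarrow> open (proj0 D)"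
proof -
  assume D: "open D"
  have "proj0 D = (\<Union>(b, d)\<in>UNIV. (\<lambda>p. (fst p, b, snd p, d)) -` D)"
    by (force simp: proj0_def)
  moreover have "open ((\<lambda>p. (fst p, b, snd p, d)) -` D)" for b d
    by (rule open_vimage[OF D]) (intro continuous_intros)
  ultimately show ?thesis by auto
qed

lemma open_proj1: "open D \<Longrightarrow> open (proj1 D)"
proof -
  assume D: "open D"
  have "proj1 D = (\<Union>(b, d)\<in>UNIV. (\<lambda>p. (b, fst p, d, snd p)) -` D)"
    by (force simp: proj1_def)
  moreover have "open ((\<lambda>p. (b, fst p, d, snd p)) -` D)" for b d
    by (rule open_vimage[OF D]) (intro continuous_intros)
  ultimately show ?thesis by auto
qed

lemma open_xi_range:
  assumes D: "open D" and ab: "a \<noteq> 0 \<or> b \<noteq> 0" shows "open (xi_range a b D)"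
proof (cases "a = 0")
  case False
  have "xi_range a b D = (\<Union>(z, z1, y1)\<in>UNIV. (\<lambda>\<xi>. (z, z1, (\<xi> - b * z) / a, y1)) -` D)"
  proof (intro equalityI subsetI)
    fix \<xi> assume "\<xi> \<in> xi_range a b D"
    then obtain z z1 y y1 where "(z, z1, y, y1) \<in> D" "\<xi> = a * y + b * z" by (auto simp: xi_range_def)
    moreover from this have "(\<xi> - b * z) / a = y" using False by simp
    ultimately have "\<xi> \<in> (\<lambda>\<xi>. (z, z1, (\<xi> - b * z) / a, y1)) -` D" by simp
    then show "\<xi> \<in> (\<Union>(z, z1, y1)\<in>UNIV. (\<lambda>\<xi>. (z, z1, (\<xi> - b * z) / a, y1)) -` D)" by blast
  next
    fix \<xi> assume "\<xi> \<in> (\<Union>(z, z1, y1)\<in>UNIV. (\<lambda>\<xi>. (z, z1, (\<xi> - b * z) / a, y1)) -` D)"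
    then obtain z z1 y1 where "(z, z1, (\<xi> - b * z) / a, y1) \<in> D" by auto
    moreover have "\<xi> = a * ((\<xi> - b * z) / a) + b * z" using False by simp
    ultimately show "\<xi> \<in> xi_range a b D" unfolding xi_range_def by force
  qed
  moreover have "open ((\<lambda>\<xi>. (z, z1, (\<xi> - b * z) / a, y1)) -` D)" for z z1 y1
    by (rule open_vimage[OF D]) (intro continuous_intros; use False in simp)
  ultimately show ?thesis by auto
next
  case True
  then have b: "b \<noteq> 0" using ab by simp
  have "xi_range a b D = (\<Union>(z1, y, y1)\<in>UNIV. (\<lambda>\<xi>. (\<xi> / b, z1, y, y1)) -` D)"
  proof (intro equalityI subsetI)
    fix \<xi> assume "\<xi> \<in> xi_range a b D"
    then obtain z z1 y y1 where "(z, z1, y, y1) \<in> D" "\<xi> = b * z" using True by (auto simp: xi_range_def)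
    then have "\<xi> \<in> (\<lambda>\<xi>. (\<xi> / b, z1, y, y1)) -` D" using b by simp
    then show "\<xi> \<in> (\<Union>(z1, y, y1)\<in>UNIV. (\<lambda>\<xi>. (\<xi> / b, z1, y, y1)) -` D)" by blast
  next
    fix \<xi> assume "\<xi> \<in> (\<Union>(z1, y, y1)\<in>UNIV. (\<lambda>\<xi>. (\<xi> / b, z1, y, y1)) -` D)"
    then obtain z1 y y1 where "(\<xi> / b, z1, y, y1) \<in> D" by auto
    moreover have "\<xi> = a * y + b * (\<xi> / b)" using b True by simp
    ultimately show "\<xi> \<in> xi_range a b D" unfolding xi_range_def by force
  qed
  moreover have "open ((\<lambda>\<xi>. (\<xi> / b, z1, y, y1)) -` D)" for z1 y y1
    by (rule open_vimage[OF D]) (intro continuous_intros; use b in simp)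
  ultimately show ?thesis by auto
qed

lemma smooth_on_coords:
  "smooth_on (\<lambda>X :: jet_pt. fst X) S" "smooth_on (\<lambda>X :: jet_pt. fst (snd X)) S"
  "smooth_on (\<lambda>X :: jet_pt. fst (snd (snd X))) S" "smooth_on (\<lambda>X :: jet_pt. snd (snd (snd X))) S"
  by (intro smooth_on_linear bounded_linear_fst bounded_linear_compose[OF bounded_linear_fst]
          bounded_linear_compose[OF bounded_linear_snd] bounded_linear_snd)+

lemma
  assumes D: "open D" and p: "smooth_on p (proj0 D)" and f: "\<And>z z1 y y1. (z, z1, y, y1) \<in> D \<Longrightarrow> f (z, z1, y, y1) = p (z, y)"
  shows smooth_on_pullback0: "smooth_on f D"
    and fd_pullback0: "(z, z1, y, y1) \<in> D \<Longrightarrow>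
      fd f (z, z1, y, y1) (a, b, c, d) = a * pd1 p (z, y) + c * pd2 p (z, y)"
proof -
  have in_proj: "(z, y) \<in> proj0 D" if "(z, z1, y, y1) \<in> D" for z z1 y y1
    using that by (force simp: proj0_def)
  have eq: "p (fst X, fst (snd (snd X))) = f X" if "X \<in> D" for X using f that by (cases X) auto
  have "smooth_on (\<lambda>X :: jet_pt. p (fst X, fst (snd (snd X)))) D"
    by (rule smooth_on_compose_pair[OF D _ p smooth_on_coords(1,3)]) (use in_proj in auto)
  then show "smooth_on f D" using smooth_on_cong[OF D eq] by simp
  assume X: "(z, z1, y, y1) \<in> D"
  have dp: "p differentiable (at (z, y))" using smooth_on_differentiable[OF p in_proj[OF X]] .
  have "((\<lambda>X :: jet_pt. (fst X, fst (snd (snd X)))) has_derivative (\<lambda>X. (fst X, fst (snd (snd X))))) (at (z, z1, y, y1))"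
    by (auto intro!: derivative_eq_intros)
  from diff_chain_at[OF this, of p "fd p (z, y)"] fd_has_derivative[OF dp]
  have "((\<lambda>X :: jet_pt. p (fst X, fst (snd (snd X)))) has_derivative (\<lambda>X. fd p (z, y) (fst X, fst (snd (snd X))))) (at (z, z1, y, y1))"
    by (simp add: o_def)
  then have "(f has_derivative (\<lambda>X. fd p (z, y) (fst X, fst (snd (snd X))))) (at (z, z1, y, y1))"
    by (rule has_derivative_transform_within_open[OF _ D X]) (rule eq)
  from fd_eqI[OF this] show "fd f (z, z1, y, y1) (a, b, c, d) = a * pd1 p (z, y) + c * pd2 p (z, y)"
    by (simp add: fd_prod2[OF dp])
qed

lemma
  assumes D: "open D" and g: "smooth_on g (proj1 D)" and f: "\<And>z z1 y y1. (z, z1, y, y1) \<in> D \<Longrightarrow> f (z, z1, y, y1) = g (z1, y1)"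
  shows smooth_on_pullback1: "smooth_on f D"
    and fd_pullback1: "(z, z1, y, y1) \<in> D \<Longrightarrow>
      fd f (z, z1, y, y1) (a, b, c, d) = b * pd1 g (z1, y1) + d * pd2 g (z1, y1)"
proof -
  have in_proj: "(z1, y1) \<in> proj1 D" if "(z, z1, y, y1) \<in> D" for z z1 y y1
    using that by (force simp: proj1_def)
  have eq: "g (fst (snd X), snd (snd (snd X))) = f X" if "X \<in> D" for X using f that by (cases X) auto
  have "smooth_on (\<lambda>X :: jet_pt. g (fst (snd X), snd (snd (snd X)))) D"
    by (rule smooth_on_compose_pair[OF D _ g smooth_on_coords(2,4)]) (use in_proj in auto)
  then show "smooth_on f D" using smooth_on_cong[OF D eq] by simp
  assume X: "(z, z1, y, y1) \<in> D"
  have dg: "g differentiable (at (z1, y1))" using smooth_on_differentiable[OF g in_proj[OF X]] .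
  have "((\<lambda>X :: jet_pt. (fst (snd X), snd (snd (snd X)))) has_derivative (\<lambda>X. (fst (snd X), snd (snd (snd X))))) (at (z, z1, y, y1))"
    by (auto intro!: derivative_eq_intros)
  from diff_chain_at[OF this, of g "fd g (z1, y1)"] fd_has_derivative[OF dg]
  have "((\<lambda>X :: jet_pt. g (fst (snd X), snd (snd (snd X)))) has_derivative (\<lambda>X. fd g (z1, y1) (fst (snd X), snd (snd (snd X))))) (at (z, z1, y, y1))"
    by (simp add: o_def)
  then have "(f has_derivative (\<lambda>X. fd g (z1, y1) (fst (snd X), snd (snd (snd X))))) (at (z, z1, y, y1))"
    by (rule has_derivative_transform_within_open[OF _ D X]) (rule eq)
  from fd_eqI[OF this] show "fd f (z, z1, y, y1) (a, b, c, d) = b * pd1 g (z1, y1) + d * pd2 g (z1, y1)"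
    by (simp add: fd_prod2[OF dg])
qed

text \<open>The shape that the free variables force on the associated functions.\<close>

definition separated ::
  "real \<Rightarrow> jet_pt set \<Rightarrow> assoc_funs \<Rightarrow> (real \<times> real \<Rightarrow> real) \<Rightarrow> (real \<times> real \<Rightarrow> real) \<Rightarrow> (real \<times> real \<Rightarrow> real)
    \<Rightarrow> (real \<times> real \<Rightarrow> real) \<Rightarrow> (real \<times> real \<Rightarrow> real) \<Rightarrow> bool" where
  "separated \<eta> D f p q r g h \<longleftrightarrow>
     smooth_on p (proj0 D) \<and> smooth_on q (proj0 D) \<and> smooth_on r (proj0 D) \<and>
     smooth_on g (proj1 D) \<and> smooth_on h (proj1 D) \<and>
     (\<forall>z z1 y y1. (z, z1, y, y1) \<in> D \<longrightarrow>
        f 1 1 (z, z1, y, y1) = \<eta> \<and> f 1 2 (z, z1, y, y1) = p (z, y) \<and>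
        f 2 1 (z, z1, y, y1) = g (z1, y1) \<and> f 2 2 (z, z1, y, y1) = q (z, y) \<and>
        f 3 1 (z, z1, y, y1) = - h (z1, y1) \<and> f 3 2 (z, z1, y, y1) = r (z, y))"

definition first_equation where
  "first_equation p q r g h = (\<lambda>(z, z1, y, y1).
     z1 * pd1 p (z, y) + y1 * pd2 p (z, y) = - h (z1, y1) * q (z, y) - r (z, y) * g (z1, y1))"

text \<open>\<open>b\<close> and \<open>c\<close> stand for the \<open>t\<close>-derivatives of \<open>z1\<close> and \<open>y1\<close>.\<close>

definition second_equation :: "real \<Rightarrow> _ \<Rightarrow> _ \<Rightarrow> _ \<Rightarrow> _ \<Rightarrow> _ \<Rightarrow> jet_pt \<Rightarrow> real \<Rightarrow> real \<Rightarrow> bool" where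
  "second_equation \<eta> p q r g h = (\<lambda>(z, z1, y, y1) b c.
     b * pd1 g (z1, y1) + c * pd2 g (z1, y1)
       = z1 * pd1 q (z, y) + y1 * pd2 q (z, y) - \<eta> * r (z, y) - p (z, y) * h (z1, y1))"

definition third_equation :: "real \<Rightarrow> real \<Rightarrow> _ \<Rightarrow> _ \<Rightarrow> _ \<Rightarrow> _ \<Rightarrow> _ \<Rightarrow> jet_pt \<Rightarrow> real \<Rightarrow> real \<Rightarrow> bool" where
  "third_equation \<delta> \<eta> p q r g h = (\<lambda>(z, z1, y, y1) b c.
     b * pd1 h (z1, y1) + c * pd2 h (z1, y1)
       = \<delta> * (\<eta> * q (z, y) - p (z, y) * g (z1, y1)) - z1 * pd1 r (z, y) - y1 * pd2 r (z, y))"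

lemma separated_smooth:
  assumes D: "open D" and s: "separated \<eta> D f p q r g h"
  shows "\<forall>i\<in>{1,2,3}. \<forall>j\<in>{1,2}. smooth_on (f i j) D"
proof -
  have "smooth_on (\<lambda>w. - h w) (proj1 D)"
    using s smooth_on_minus[OF open_proj1[OF D]] unfolding separated_def by blast
  moreover have "smooth_on (f 1 1) D \<longleftrightarrow> smooth_on (\<lambda>X. \<eta>) D"
    by (rule smooth_on_cong[OF D]) (use s in \<open>auto simp: separated_def\<close>)
  ultimately show ?thesis
    using s smooth_on_pullback0[OF D, of p "f 1 2"] smooth_on_pullback0[OF D, of q "f 2 2"]
      smooth_on_pullback0[OF D, of r "f 3 2"] smooth_on_pullback1[OF D, of g "f 2 1"]
      smooth_on_pullback1[OF D, of "\<lambda>w. - h w" "f 3 1"] smooth_on_const[of \<eta> D]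
    unfolding separated_def by auto
qed

lemma structure_at_separated:
  assumes D: "open D" and s: "separated \<eta> D f p q r g h" and X: "(z, z1, y, y1) \<in> D"
  shows "structure_at \<delta> f (z, z1, y, y1) (z1, a, y1, b) (c, F, d, G) \<longleftrightarrow>
    first_equation p q r g h (z, z1, y, y1) \<and> second_equation \<eta> p q r g h (z, z1, y, y1) F G \<and>
    third_equation \<delta> \<eta> p q r g h (z, z1, y, y1) F G"
proof -
  have sh: "smooth_on (\<lambda>w. - h w) (proj1 D)"
    using s smooth_on_minus[OF open_proj1[OF D]] unfolding separated_def by blast
  have w: "(z1, y1) \<in> proj1 D" using X by (force simp: proj1_def)
  have dh: "h differentiable (at (z1, y1))"
    using s w smooth_on_differentiable unfolding separated_def by blast
  have "((\<lambda>w. - h w) has_derivative (\<lambda>v. - fd h (z1, y1) v)) (at (z1, y1))"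
    by (rule has_derivative_minus[OF fd_has_derivative[OF dh]])
  then have mh: "pd1 (\<lambda>w. - h w) (z1, y1) = - pd1 h (z1, y1)" "pd2 (\<lambda>w. - h w) (z1, y1) = - pd2 h (z1, y1)"
    using pd1_eq_fd pd2_eq_fd dh fd_eqI by (metis differentiable_def)+
  have "((\<lambda>X :: jet_pt. \<eta>) has_derivative (\<lambda>v. 0)) (at (z, z1, y, y1))" by simp
  then have "(f 1 1 has_derivative (\<lambda>v. 0)) (at (z, z1, y, y1))"
    by (rule has_derivative_transform_within_open[OF _ D X]) (use s in \<open>auto simp: separated_def\<close>)
  then have f11: "fd (f 1 1) (z, z1, y, y1) v = 0" for v by (rule fd_eqI)
  have f12: "fd (f 1 2) (z, z1, y, y1) (a, b, c, d) = a * pd1 p (z, y) + c * pd2 p (z, y)"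
    and f22: "fd (f 2 2) (z, z1, y, y1) (a, b, c, d) = a * pd1 q (z, y) + c * pd2 q (z, y)"
    and f32: "fd (f 3 2) (z, z1, y, y1) (a, b, c, d) = a * pd1 r (z, y) + c * pd2 r (z, y)"
    and f21: "fd (f 2 1) (z, z1, y, y1) (a, b, c, d) = b * pd1 g (z1, y1) + d * pd2 g (z1, y1)"
    and f31: "fd (f 3 1) (z, z1, y, y1) (a, b, c, d) = - b * pd1 h (z1, y1) - d * pd2 h (z1, y1)" for a b c d
    using s fd_pullback0[OF D _ _ X, of p "f 1 2"] fd_pullback0[OF D _ _ X, of q "f 2 2"] fd_pullback0[OF D _ _ X, of r "f 3 2"]
      fd_pullback1[OF D _ _ X, of g "f 2 1"] fd_pullback1[OF D sh _ X, of "f 3 1"]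
    unfolding separated_def mh by auto
  have v: "f 1 1 (z, z1, y, y1) = \<eta>" "f 1 2 (z, z1, y, y1) = p (z, y)"
        "f 2 1 (z, z1, y, y1) = g (z1, y1)" "f 2 2 (z, z1, y, y1) = q (z, y)"
        "f 3 1 (z, z1, y, y1) = - h (z1, y1)" "f 3 2 (z, z1, y, y1) = r (z, y)"
    using s X unfolding separated_def by auto
  show ?thesis
    unfolding structure_at_def f11 f12 f22 f32 f21 f31 v first_equation_def second_equation_def third_equation_def
      case_prod_conv
    by (auto simp: algebra_simps)
qed

text \<open>Pointwise equivalence suffices here: both conditions are evaluated on the jets of arbitrary
  functions, whether or not these solve anything.\<close>

lemma separated_describes_surfaces:
  assumes D: "open D" and s: "separated \<eta> D f p q r g h"
    and gn: "generically_nonzero D (\<lambda>X. f 1 1 X * f 2 2 X - f 1 2 X * f 2 1 X)"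
    and 1: "\<And>X. X \<in> D \<Longrightarrow> first_equation p q r g h X"
    and 23: "\<And>X b c. X \<in> D \<Longrightarrow> (second_equation \<eta> p q r g h X b c \<and> third_equation \<delta> \<eta> p q r g h X b c)
      \<longleftrightarrow> b = F X \<and> c = G X"
  shows "describes_surfaces \<delta> D F G f"
  unfolding describes_surfaces_def
proof (intro conjI allI impI)
  show sm: "\<forall>i\<in>{1, 2, 3}. \<forall>j\<in>{1, 2}. smooth_on (f i j) D" by (rule separated_smooth[OF D s])
  show "generically_nonzero D (\<lambda>X. f 1 1 X * f 2 2 X - f 1 2 X * f 2 1 X)" by (rule gn)
  fix Q u v
  assume Q: "open Q \<and> smooth_on u Q \<and> smooth_on v Q \<and> jet u v ` Q \<subseteq> D"
  have "structure_equations \<delta> f Q u v \<longleftrightarrow> (\<forall>q\<in>Q. structure_at \<delta> f (jet u v q)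
    (pd1 u q, pd1 (pd1 u) q, pd1 v q, pd1 (pd1 v) q) (pd2 u q, pd2 (pd1 u) q, pd2 v q, pd2 (pd1 v) q))"
    using Q sm by (intro structure_equations_iff) auto
  also have "\<dots> \<longleftrightarrow> (\<forall>q\<in>Q. pd2 (pd1 u) q = F (jet u v q) \<and> pd2 (pd1 v) q = G (jet u v q))"
  proof (intro ball_cong refl)
    fix q assume "q \<in> Q"
    then have X: "(u q, pd1 u q, v q, pd1 v q) \<in> D" using Q by (auto simp: jet_def)
    show "structure_at \<delta> f (jet u v q)
      (pd1 u q, pd1 (pd1 u) q, pd1 v q, pd1 (pd1 v) q) (pd2 u q, pd2 (pd1 u) q, pd2 v q, pd2 (pd1 v) q) \<longleftrightarrow>
      pd2 (pd1 u) q = F (jet u v q) \<and> pd2 (pd1 v) q = G (jet u v q)"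
      unfolding jet_def structure_at_separated[OF D s X] using 1[OF X] 23[OF X] by blast
  qed
  finally show "solves_system F G Q u v = structure_equations \<delta> f Q u v"
    by (simp add: solves_system_def)
qed

section \<open>Cubes in the jet space\<close>

definition cube :: "jet_pt \<Rightarrow> real \<Rightarrow> jet_pt set" where
  "cube = (\<lambda>(z, z1, y, y1) r.
     {z - r<..<z + r} \<times> {z1 - r<..<z1 + r} \<times> {y - r<..<y + r} \<times> {y1 - r<..<y1 + r})"

lemma in_cube: "(a, b, c, d) \<in> cube (z, z1, y, y1) r \<longleftrightarrow>
    \<bar>a - z\<bar> < r \<and> \<bar>b - z1\<bar> < r \<and> \<bar>c - y\<bar> < r \<and> \<bar>d - y1\<bar> < r"
  by (auto simp: cube_def abs_less_iff)

lemma open_cube: "open (cube X r)" and convex_cube: "convex (cube X r)"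
  by (auto simp: cube_def split: prod.splits intro!: open_Times convex_Times)

lemma centre_in_cube: "0 < r \<Longrightarrow> X \<in> cube X r"
  by (cases X) (simp add: in_cube)

lemma is_domain_cube: "0 < r \<Longrightarrow> is_domain (cube X r)"
  unfolding is_domain_def using open_cube convex_cube convex_connected centre_in_cube by blast

lemma cube_mono: "r \<le> s \<Longrightarrow> cube X r \<subseteq> cube X s"
  by (cases X) (auto simp: in_cube)

lemma cube_subset_open:
  assumes "open D" "X \<in> D"
  obtains r where "0 < r" "cube X r \<subseteq> D"
proof -
  obtain e where e: "0 < e" "ball X e \<subseteq> D" using assms open_contains_ball by blast
  obtain z z1 y y1 where X: "X = (z, z1, y, y1)" by (cases X)
  have "cube X (e / 4) \<subseteq> ball X e"
  proof
    fix Y assume Y: "Y \<in> cube X (e / 4)"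
    obtain a b c d where Y': "Y = (a, b, c, d)" by (cases Y)
    have "dist X Y = norm (Y - X)" by (simp add: dist_norm norm_minus_commute)
    also have "\<dots> = norm (a - z, b - z1, c - y, d - y1)" by (simp add: X Y')
    also have "\<dots> \<le> \<bar>a - z\<bar> + \<bar>b - z1\<bar> + \<bar>c - y\<bar> + \<bar>d - y1\<bar>" by (rule norm_jet_le)
    also have "\<dots> < e" using Y by (simp add: X Y' in_cube)
    finally show "Y \<in> ball X e" by simp
  qed
  then show ?thesis using that[of "e / 4"] e by auto
qed

lemma positive_on_cube:
  fixes e :: "jet_pt \<Rightarrow> real"
  assumes "open D" "X \<in> D" "continuous_on D e" "0 < e X"
  obtains r :: real where "0 < r" "cube X r \<subseteq> D" "\<And>Y. Y \<in> cube X r \<Longrightarrow> 0 < e Y"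
proof -
  have "open (D \<inter> e -` {0<..})"
    by (intro continuous_open_preimage assms open_greaterThan)
  moreover have "X \<in> D \<inter> e -` {0<..}" using assms by simp
  ultimately obtain r where "0 < r" "cube X r \<subseteq> D \<inter> e -` {0<..}" by (rule cube_subset_open)
  then show ?thesis using that[of r] by auto
qed

lemma nonzero_on_cube:
  fixes e :: "jet_pt \<Rightarrow> real"
  assumes "open D" "X \<in> D" "continuous_on D e" "e X \<noteq> 0"
  obtains r :: real where "0 < r" "cube X r \<subseteq> D" "\<And>Y. Y \<in> cube X r \<Longrightarrow> e Y \<noteq> 0"
proof -
  have c: "continuous_on D (\<lambda>X. (e X)\<^sup>2)" by (intro continuous_intros assms)
  have "0 < (e X)\<^sup>2" using assms by simp
  then obtain r :: real where "0 < r" "cube X r \<subseteq> D" "\<And>Y. Y \<in> cube X r \<Longrightarrow> 0 < (e Y)\<^sup>2"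
    using positive_on_cube[OF assms(1,2) c] by blast
  then show ?thesis using that[of r] by auto
qed

lemma generically_nonzero_point:
  assumes "generically_nonzero D e" "open U" "U \<subseteq> D" "U \<noteq> {}"
  obtains X where "X \<in> U" "e X \<noteq> 0"
proof -
  have "\<not> U \<subseteq> {X \<in> D. e X = 0}"
    using assms open_not_negligible negligible_subset unfolding generically_nonzero_def by blast
  then show ?thesis using that assms(3) by blast
qed

lemma generically_nonzeroI: "(\<And>X. X \<in> D \<Longrightarrow> e X \<noteq> 0) \<Longrightarrow> generically_nonzero D e"
proof -
  assume "\<And>X. X \<in> D \<Longrightarrow> e X \<noteq> 0"
  then have "{X \<in> D. e X = 0} = {}" by blast
  then have "negligible {X \<in> D. e X = 0}" by (simp only: negligible_empty)
  then show ?thesis unfolding generically_nonzero_def .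
qed

lemma
  assumes "0 < r"
  shows in_proj0_cube: "(a, c) \<in> proj0 (cube (z, z1, y, y1) r) \<longleftrightarrow> \<bar>a - z\<bar> < r \<and> \<bar>c - y\<bar> < r"
    and in_proj1_cube: "(b, d) \<in> proj1 (cube (z, z1, y, y1) r) \<longleftrightarrow> \<bar>b - z1\<bar> < r \<and> \<bar>d - y1\<bar> < r"
proof -
  have "(a, c) \<in> proj0 (cube (z, z1, y, y1) r)" if "\<bar>a - z\<bar> < r" "\<bar>c - y\<bar> < r"
    unfolding proj0_def by (rule image_eqI[of _ _ "(a, z1, c, y1)"]) (use that assms in \<open>auto simp: in_cube\<close>)
  moreover have "(b, d) \<in> proj1 (cube (z, z1, y, y1) r)" if "\<bar>b - z1\<bar> < r" "\<bar>d - y1\<bar> < r"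
    unfolding proj1_def by (rule image_eqI[of _ _ "(z, b, y, d)"]) (use that assms in \<open>auto simp: in_cube\<close>)
  ultimately show "(a, c) \<in> proj0 (cube (z, z1, y, y1) r) \<longleftrightarrow> \<bar>a - z\<bar> < r \<and> \<bar>c - y\<bar> < r"
    "(b, d) \<in> proj1 (cube (z, z1, y, y1) r) \<longleftrightarrow> \<bar>b - z1\<bar> < r \<and> \<bar>d - y1\<bar> < r"
    by (auto simp: proj0_def proj1_def in_cube)
qed

lemma cube_iff_proj:
  assumes "0 < r"
  shows "(z, z1, y, y1) \<in> cube X r \<longleftrightarrow> (z, y) \<in> proj0 (cube X r) \<and> (z1, y1) \<in> proj1 (cube X r)"
  by (cases X) (auto simp: in_proj0_cube[OF assms] in_proj1_cube[OF assms] in_cube)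

lemma convex_proj0_cube: "convex (proj0 (cube X r))"
proof (cases "0 < r")
  case True
  obtain z z1 y y1 where X: "X = (z, z1, y, y1)" by (cases X)
  have "proj0 (cube X r) = {z - r<..<z + r} \<times> {y - r<..<y + r}"
    using in_proj0_cube[OF True] by (auto simp: X abs_less_iff)
  then show ?thesis by (simp add: convex_Times)
next
  case False
  then have "cube X r = {}" by (cases X) (auto simp: in_cube)
  then show ?thesis by (simp add: proj0_def)
qed

section \<open>From the normal forms to surfaces\<close>

lemma cramer:
  fixes g1 :: real
  assumes "g1 * h2 - g2 * h1 \<noteq> 0"
  shows "b * g1 + c * g2 = A \<and> b * h1 + c * h2 = B \<longleftrightarrow>
    b = (A * h2 - B * g2) / (g1 * h2 - g2 * h1) \<and> c = (B * g1 - A * h1) / (g1 * h2 - g2 * h1)"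
proof
  assume *: "b * g1 + c * g2 = A \<and> b * h1 + c * h2 = B"
  have "b * (g1 * h2 - g2 * h1) = (b * g1 + c * g2) * h2 - (b * h1 + c * h2) * g2"
    "c * (g1 * h2 - g2 * h1) = (b * h1 + c * h2) * g1 - (b * g1 + c * g2) * h1"
    by (simp_all add: algebra_simps)
  then show "b = (A * h2 - B * g2) / (g1 * h2 - g2 * h1) \<and> c = (B * g1 - A * h1) / (g1 * h2 - g2 * h1)"
    using assms * by (simp add: eq_divide_eq)
next
  assume *: "b = (A * h2 - B * g2) / (g1 * h2 - g2 * h1) \<and> c = (B * g1 - A * h1) / (g1 * h2 - g2 * h1)"
  define W where "W = g1 * h2 - g2 * h1"
  have W: "W \<noteq> 0" using assms by (simp add: W_def)
  have "b * g1 + c * g2 = ((A * h2 - B * g2) * g1 + (B * g1 - A * h1) * g2) / W"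
    "b * h1 + c * h2 = ((A * h2 - B * g2) * h1 + (B * g1 - A * h1) * h2) / W"
    using * by (simp_all add: W_def[symmetric] add_divide_distrib)
  moreover have "(A * h2 - B * g2) * g1 + (B * g1 - A * h1) * g2 = A * W"
    "(A * h2 - B * g2) * h1 + (B * g1 - A * h1) * h2 = B * W"
    by (simp_all add: W_def algebra_simps)
  ultimately show "b * g1 + c * g2 = A \<and> b * h1 + c * h2 = B" using W by simp
qed

lemma
  assumes D: "open D" and ab: "a \<noteq> 0 \<or> b \<noteq> 0" and \<psi>: "smooth_on \<psi> (xi_range a b D)"
  shows smooth_on_xi: "smooth_on (\<lambda>w. \<psi> (a * snd w + b * fst w)) (proj0 D)"
    and pd1_xi: "(z, y) \<in> proj0 D \<Longrightarrow> pd1 (\<lambda>w. \<psi> (a * snd w + b * fst w)) (z, y) = b * deriv \<psi> (a * y + b * z)"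
    and pd2_xi: "(z, y) \<in> proj0 D \<Longrightarrow> pd2 (\<lambda>w. \<psi> (a * snd w + b * fst w)) (z, y) = a * deriv \<psi> (a * y + b * z)"
proof -
  have im: "(\<lambda>w. a * snd w + b * fst w) ` proj0 D \<subseteq> xi_range a b D"
    by (force simp: proj0_def xi_range_def)
  have "smooth_on (\<lambda>w. a * snd w + b * fst w) (proj0 D)"
    by (intro smooth_on_add smooth_on_cmult smooth_on_linear open_proj0[OF D] bounded_linear_fst bounded_linear_snd)
  then show s: "smooth_on (\<lambda>w. \<psi> (a * snd w + b * fst w)) (proj0 D)"
    by (intro smooth_on_compose[OF open_proj0[OF D] im \<psi>]) auto
  assume zy: "(z, y) \<in> proj0 D"
  have d: "(\<psi> has_real_derivative deriv \<psi> (a * y + b * z)) (at (a * y + b * z))"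
    by (rule smooth_on_DERIV[OF \<psi>]) (use im zy in auto)
  have "((\<lambda>x. \<psi> (a * y + b * x)) has_real_derivative deriv \<psi> (a * y + b * z) * b) (at z)"
    by (rule DERIV_chain2[where g = "\<lambda>x. a * y + b * x", OF d]) (auto intro!: derivative_eq_intros)
  then show "pd1 (\<lambda>w. \<psi> (a * snd w + b * fst w)) (z, y) = b * deriv \<psi> (a * y + b * z)"
    by (simp add: pd1_def DERIV_imp_deriv)
  have "((\<lambda>x. \<psi> (a * x + b * z)) has_real_derivative deriv \<psi> (a * y + b * z) * a) (at y)"
    by (rule DERIV_chain2[where g = "\<lambda>x. a * x + b * z", OF d]) (auto intro!: derivative_eq_intros)
  then show "pd2 (\<lambda>w. \<psi> (a * snd w + b * fst w)) (z, y) = a * deriv \<psi> (a * y + b * z)"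
    by (simp add: pd2_def DERIV_imp_deriv)
qed

lemma separated_subset:
  assumes "separated \<eta> D f p q r g h" "D' \<subseteq> D" shows "separated \<eta> D' f p q r g h"
proof -
  have "proj0 D' \<subseteq> proj0 D" "proj1 D' \<subseteq> proj1 D" 
    using assms(2) unfolding proj0_def proj1_def by (simp_all only: image_mono)
  then show ?thesis using assms unfolding separated_def by (blast intro: smooth_on_subset)
qed

lemma continuous_on_Wdet:
  assumes D: "open D" and s: "smooth_on g (proj1 D)" "smooth_on h (proj1 D)"
  shows "continuous_on D (\<lambda>(z, z1, y, y1). Wdet g h (z1, y1))"
proof -
  note o = open_proj1[OF D]
  have "smooth_on (\<lambda>w. Wdet g h w) (proj1 D)"
    unfolding Wdet_def by (intro smooth_on_diff smooth_on_mult smooth_on_pd1 smooth_on_pd2 o s)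
  from smooth_on_pullback1[OF D this, of "\<lambda>(z, z1, y, y1). Wdet g h (z1, y1)"] show ?thesis
    by (auto intro: smooth_on_continuous)
qed

lemma second_third_iff:
  assumes "Wdet g h (z1, y1) \<noteq> 0"
  shows "second_equation \<eta> p q r g h (z, z1, y, y1) b c \<and> third_equation \<delta> \<eta> p q r g h (z, z1, y, y1) b c \<longleftrightarrow>
    b = ((z1 * pd1 q (z, y) + y1 * pd2 q (z, y) - \<eta> * r (z, y) - p (z, y) * h (z1, y1)) * pd2 h (z1, y1)
      - (\<delta> * (\<eta> * q (z, y) - p (z, y) * g (z1, y1)) - z1 * pd1 r (z, y) - y1 * pd2 r (z, y)) * pd2 g (z1, y1))
      / Wdet g h (z1, y1) \<and>
    c = ((\<delta> * (\<eta> * q (z, y) - p (z, y) * g (z1, y1)) - z1 * pd1 r (z, y) - y1 * pd2 r (z, y)) * pd1 g (z1, y1)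
      - (z1 * pd1 q (z, y) + y1 * pd2 q (z, y) - \<eta> * r (z, y) - p (z, y) * h (z1, y1)) * pd1 h (z1, y1))
      / Wdet g h (z1, y1)"
  unfolding second_equation_def third_equation_def case_prod_conv Wdet_def
  by (rule cramer) (use assms in \<open>simp add: Wdet_def\<close>)

text \<open>The right-hand sides of the first normal form, as a pair.\<close>

definition rhs_i where
  "rhs_i \<delta> \<eta> a b \<mu> lam g h \<phi> = (\<lambda>(z, z1, y, y1).
     let w = (z1, y1); \<xi> = a * y + b * z; W = Wdet g h w; k = (\<lambda>w. (h w)\<^sup>2 - \<delta> * (g w)\<^sup>2)
     in (1 / W * (- a * (b * z1 + a * y1) * deriv (deriv \<phi>) \<xi>
                      + \<eta> * (\<mu> * pd2 h w - \<delta> * lam * pd2 g w) * deriv \<phi> \<xi>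
                      - 1 / 2 * pd2 k w * \<phi> \<xi>),
         1 / W * (b * (b * z1 + a * y1) * deriv (deriv \<phi>) \<xi>
                      - \<eta> * (\<mu> * pd1 h w - \<delta> * lam * pd1 g w) * deriv \<phi> \<xi>
                      + 1 / 2 * pd1 k w * \<phi> \<xi>)))"

text \<open>Solving the last two structure equations for the \<open>t\<close>-derivatives gives the first
  normal form. The gradient of the relation between \<open>g\<close> and \<open>h\<close> is constant; it supplies the
  factors \<open>a\<close> and \<open>b\<close> of the second derivative of \<open>\<phi>\<close>.\<close>

lemma solve_i:
  assumes D: "open D" and ab: "a \<noteq> 0 \<or> b \<noteq> 0" and \<phi>: "smooth_on \<phi> (xi_range a b D)"
    and g: "smooth_on g (proj1 D)" and h: "smooth_on h (proj1 D)"
    and rel: "\<And>z1 y1. (z1, y1) \<in> proj1 D \<Longrightarrow> \<mu> * g (z1, y1) - lam * h (z1, y1) = a * y1 + b * z1"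
    and p: "p = (\<lambda>w. \<phi> (a * snd w + b * fst w))"
    and q: "q = (\<lambda>w. lam * deriv \<phi> (a * snd w + b * fst w))"
    and r: "r = (\<lambda>w. - \<mu> * deriv \<phi> (a * snd w + b * fst w))"
    and X: "(z, z1, y, y1) \<in> D" and W: "Wdet g h (z1, y1) \<noteq> 0"
  shows "second_equation \<eta> p q r g h (z, z1, y, y1) F G \<and> third_equation \<delta> \<eta> p q r g h (z, z1, y, y1) F G \<longleftrightarrow>
    (F, G) = rhs_i \<delta> \<eta> a b \<mu> lam g h \<phi> (z, z1, y, y1)"
proof -
  have zy: "(z, y) \<in> proj0 D" and w: "(z1, y1) \<in> proj1 D" using X by (force simp: proj0_def proj1_def)+
  have ox: "open (xi_range a b D)" by (rule open_xi_range[OF D ab])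
  have d\<phi>: "smooth_on (deriv \<phi>) (xi_range a b D)" by (rule smooth_on_deriv[OF ox \<phi>])
  let ?d\<phi> = "\<lambda>w. deriv \<phi> (a * snd w + b * fst w)"
  have dd: "?d\<phi> differentiable (at (z, y))"
    by (rule smooth_on_differentiable[OF smooth_on_xi[OF D ab d\<phi>] zy])
  note pd = pd1_cmult[OF dd] pd2_cmult[OF dd] pd1_xi[OF D ab d\<phi> zy] pd2_xi[OF D ab d\<phi> zy]
  have dg: "g differentiable (at (z1, y1))" and dh: "h differentiable (at (z1, y1))"
    using smooth_on_differentiable g h w by blast+
  have rel': "\<mu> * g w + (- lam) * h w = b * fst w + a * snd w + 0" if "w \<in> proj1 D" for w
    using rel[of "fst w" "snd w"] that by simp
  have rel1: "\<mu> * pd1 g (z1, y1) + (- lam) * pd1 h (z1, y1) = b"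
    using pd1_affine[OF open_proj1[OF D] w rel'] pd1_lincomb[OF dg dh, of \<mu> "- lam"] by simp
  have rel2: "\<mu> * pd2 g (z1, y1) + (- lam) * pd2 h (z1, y1) = a"
    using pd2_affine[OF open_proj1[OF D] w rel'] pd2_lincomb[OF dg dh, of \<mu> "- lam"] by simp
  have alg: "(z1 * (lam * (b * d2)) + y1 * (lam * (a * d2)) - \<eta> * (- \<mu> * d1) - d0 * h') * h2
      - (\<delta> * (\<eta> * (lam * d1) - d0 * g') - z1 * (- \<mu> * (b * d2)) - y1 * (- \<mu> * (a * d2))) * g2
    = - a * (b * z1 + a * y1) * d2 + \<eta> * (\<mu> * h2 - \<delta> * lam * g2) * d1
      - 1 / 2 * (2 * h' * h2 - \<delta> * (2 * g' * g2)) * d0"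
    "(\<delta> * (\<eta> * (lam * d1) - d0 * g') - z1 * (- \<mu> * (b * d2)) - y1 * (- \<mu> * (a * d2))) * g1
      - (z1 * (lam * (b * d2)) + y1 * (lam * (a * d2)) - \<eta> * (- \<mu> * d1) - d0 * h') * h1
    = b * (b * z1 + a * y1) * d2 - \<eta> * (\<mu> * h1 - \<delta> * lam * g1) * d1
      + 1 / 2 * (2 * h' * h1 - \<delta> * (2 * g' * g1)) * d0"
    if "\<mu> * g1 + (- lam) * h1 = b" "\<mu> * g2 + (- lam) * h2 = a" for g1 g2 h1 h2 g' h' d0 d1 d2
    unfolding that[symmetric] by (simp_all add: field_simps)
  show ?thesis
    unfolding second_third_iff[OF W] rhs_i_def case_prod_conv Let_def prod.inject
      pd1_squares[OF dh dg] pd2_squares[OF dh dg] p q r pd fst_conv snd_conv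
      alg[OF rel1 rel2] by simp
qed

lemma separated_i:
  assumes D: "open D" and ab: "a \<noteq> 0 \<or> b \<noteq> 0" and \<phi>: "smooth_on \<phi> (xi_range a b D)"
    and g: "smooth_on g (proj1 D)" and h: "smooth_on h (proj1 D)"
  shows "separated \<eta> D f (\<lambda>w. \<phi> (a * snd w + b * fst w)) (\<lambda>w. lam * deriv \<phi> (a * snd w + b * fst w))
      (\<lambda>w. - \<mu> * deriv \<phi> (a * snd w + b * fst w)) g h \<longleftrightarrow> assoc_i \<eta> D f a b \<mu> lam g h \<phi>"
proof -
  have ox: "open (xi_range a b D)" by (rule open_xi_range[OF D ab])
  have d\<phi>: "smooth_on (\<lambda>w. deriv \<phi> (a * snd w + b * fst w)) (proj0 D)"
    by (rule smooth_on_xi[OF D ab smooth_on_deriv[OF ox \<phi>]])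
  note o = open_proj0[OF D]
  show ?thesis
    unfolding separated_def assoc_i_def Let_def
    using smooth_on_xi[OF D ab \<phi>] smooth_on_cmult[OF o d\<phi>, of lam] smooth_on_cmult[OF o d\<phi>, of "- \<mu>"] g h
    by auto
qed

text \<open>On a cube where \<open>W\<close>, \<open>\<phi>\<close> and \<open>f\<^sub>1\<^sub>1 f\<^sub>2\<^sub>2 - f\<^sub>1\<^sub>2 f\<^sub>2\<^sub>1 = - \<phi> (g - \<lambda> \<eta> \<phi>' / \<phi>)\<close> do not vanish, the first
  structure equation is the relation between \<open>g\<close> and \<open>h\<close> multiplied by \<open>\<phi>'\<close>, and the other two
  are equivalent to the system. Such a cube is found in three steps, as the conditions are only
  given off null sets.\<close>

lemma case_i_describes_surfaces:
  assumes dom: "is_domain D" and data: "data_i \<eta> D a b \<mu> lam g h \<phi>"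
    and sys: "system_i \<delta> \<eta> D F G a b \<mu> lam g h \<phi>" and assoc: "assoc_i \<eta> D f a b \<mu> lam g h \<phi>"
  shows "after_shrinking D (\<lambda>D'. describes_surfaces \<delta> D' F G f \<and> (\<forall>X\<in>D'. f 1 1 X = \<eta>))"
proof -
  have D: "open D" "D \<noteq> {}" using dom by (auto simp: is_domain_def)
  have g: "smooth_on g (proj1 D)" and h: "smooth_on h (proj1 D)" and \<phi>: "smooth_on \<phi> (xi_range a b D)"
    and mono: "strict_mono_on (xi_range a b D) \<phi> \<or> strict_antimono_on (xi_range a b D) \<phi>"
    and ab2: "a\<^sup>2 + b\<^sup>2 \<noteq> 0"
    and gW: "generically_nonzero D (\<lambda>(z, z1, y, y1). Wdet g h (z1, y1))"
    and rel: "\<forall>(z1, y1)\<in>proj1 D. \<mu> * g (z1, y1) - lam * h (z1, y1) = a * y1 + b * z1"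
    and gn: "generically_nonzero D (\<lambda>(z, z1, y, y1).
       let \<xi> = a * y + b * z in g (z1, y1) - lam * \<eta> * (deriv \<phi> \<xi> / \<phi> \<xi>))"
    using data unfolding data_i_def by blast+
  have ab: "a \<noteq> 0 \<or> b \<noteq> 0" using ab2 by auto
  define p where "p = (\<lambda>w. \<phi> (a * snd w + b * fst w))"
  define q where "q = (\<lambda>w. lam * deriv \<phi> (a * snd w + b * fst w))"
  define r where "r = (\<lambda>w. - \<mu> * deriv \<phi> (a * snd w + b * fst w))"
  have sep: "separated \<eta> D f p q r g h"
    using separated_i[OF D(1) ab \<phi> g h] assoc unfolding p_def q_def r_def by blast
  \<comment> \<open>a cube on which \<open>W\<close> does not vanish\<close>
  obtain X1 where X1: "X1 \<in> D" "(case X1 of (z, z1, y, y1) \<Rightarrow> Wdet g h (z1, y1)) \<noteq> 0"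
    by (rule generically_nonzero_point[OF gW D(1) subset_refl D(2)])
  obtain r1 where r1: "0 < r1" "cube X1 r1 \<subseteq> D"
    "\<And>Y. Y \<in> cube X1 r1 \<Longrightarrow> (case Y of (z, z1, y, y1) \<Rightarrow> Wdet g h (z1, y1)) \<noteq> 0"
    by (rule nonzero_on_cube[OF D(1) X1(1) continuous_on_Wdet[OF D(1) g h] X1(2)]) blast
  \<comment> \<open>inside it, a cube on which \<open>\<phi>\<close> does not vanish, by strict monotonicity\<close>
  have "\<exists>X2\<in>cube X1 r1. (case X2 of (z, z1, y, y1) \<Rightarrow> \<phi> (a * y + b * z)) \<noteq> 0"
  proof (rule ccontr)
    assume *: "\<not> ?thesis"
    obtain z z1 y y1 where X1': "X1 = (z, z1, y, y1)" by (cases X1)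
    define s where "s = r1 / (2 * (\<bar>a\<bar> + \<bar>b\<bar>))"
    have n: "0 < \<bar>a\<bar> + \<bar>b\<bar>" using ab by auto
    have s: "0 < s" using n r1(1) by (simp add: s_def)
    have "\<bar>c * s\<bar> < r1" if "\<bar>c\<bar> \<le> \<bar>a\<bar> + \<bar>b\<bar>" for c
    proof -
      have "\<bar>c * s\<bar> = \<bar>c\<bar> * s" using s by (simp add: abs_mult)
      also have "\<dots> \<le> (\<bar>a\<bar> + \<bar>b\<bar>) * s" using that s by (intro mult_right_mono) auto
      also have "\<dots> = r1 / 2" using n by (simp add: s_def field_simps)
      finally show ?thesis using r1(1) by linarith
    qed
    then have "(z, z1, y, y1) \<in> cube X1 r1" "(z + b * s, z1, y + a * s, y1) \<in> cube X1 r1"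
      using r1(1) by (auto simp: X1' in_cube)
    then have "\<phi> (a * y + b * z) = 0" "\<phi> (a * (y + a * s) + b * (z + b * s)) = 0"
      "a * y + b * z \<in> xi_range a b D" "a * (y + a * s) + b * (z + b * s) \<in> xi_range a b D"
      using * r1(2) by (force simp: xi_range_def)+
    moreover have "a * y + b * z < a * (y + a * s) + b * (z + b * s)"
    proof -
      have "0 < (a\<^sup>2 + b\<^sup>2) * s" using s ab2 by (simp add: sum_power2_gt_zero_iff sum_power2_eq_zero_iff)
      then show ?thesis by (simp add: algebra_simps power2_eq_square)
    qed
    ultimately show False
      using mono by (auto simp: monotone_on_def) (metis less_irrefl)+
  qed
  then obtain X2 where X2: "X2 \<in> cube X1 r1" "(case X2 of (z, z1, y, y1) \<Rightarrow> \<phi> (a * y + b * z)) \<noteq> 0" by blast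
  have cp: "continuous_on D (\<lambda>(z, z1, y, y1). \<phi> (a * y + b * z))"
    using smooth_on_pullback0[OF D(1), of p "\<lambda>(z, z1, y, y1). \<phi> (a * y + b * z)"] sep
    by (auto simp: separated_def p_def intro: smooth_on_continuous)
  obtain r2 where r2: "0 < r2" "cube X2 r2 \<subseteq> cube X1 r1"
    "\<And>Y. Y \<in> cube X2 r2 \<Longrightarrow> (case Y of (z, z1, y, y1) \<Rightarrow> \<phi> (a * y + b * z)) \<noteq> 0"
    by (rule nonzero_on_cube[OF open_cube X2(1) continuous_on_subset[OF cp r1(2)] X2(2)]) blast
  \<comment> \<open>inside that, a cube on which \<open>\<omega>\<^sub>1 \<and> \<omega>\<^sub>2\<close> does not vanish\<close>
  have ne: "cube X2 r2 \<noteq> {}" using centre_in_cube[OF r2(1)] by blast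
  have sub2: "cube X2 r2 \<subseteq> D" using r1 r2 by blast
  obtain X3 where X3: "X3 \<in> cube X2 r2" "(case X3 of (z, z1, y, y1) \<Rightarrow>
       let \<xi> = a * y + b * z in g (z1, y1) - lam * \<eta> * (deriv \<phi> \<xi> / \<phi> \<xi>)) \<noteq> 0"
    by (rule generically_nonzero_point[OF gn open_cube sub2 ne])
  define e where "e X = f 1 1 X * f 2 2 X - f 1 2 X * f 2 1 X" for X
  have sm: "\<forall>i\<in>{1,2,3}. \<forall>j\<in>{1,2}. smooth_on (f i j) D" by (rule separated_smooth[OF D(1) sep])
  have ce: "continuous_on D e"
    unfolding e_def using sm by (intro continuous_intros smooth_on_continuous) auto
  have eX3: "e X3 \<noteq> 0"
  proof -
    obtain z z1 y y1 where X: "X3 = (z, z1, y, y1)" by (cases X3)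
    have XD: "(z, z1, y, y1) \<in> D" using X3(1) sub2 X by auto
    have "\<phi> (a * y + b * z) \<noteq> 0" using r2(3)[OF X3(1)] X by simp
    then have "e X3 = - \<phi> (a * y + b * z) * (g (z1, y1) - lam * \<eta> * (deriv \<phi> (a * y + b * z) / \<phi> (a * y + b * z)))"
      using sep XD by (simp add: X e_def separated_def p_def q_def algebra_simps)
    then show ?thesis using X3(2) \<open>\<phi> (a * y + b * z) \<noteq> 0\<close> by (simp add: X Let_def)
  qed
  obtain r3 where r3: "0 < r3" "cube X3 r3 \<subseteq> cube X2 r2" "\<And>Y. Y \<in> cube X3 r3 \<Longrightarrow> e Y \<noteq> 0"
    by (rule nonzero_on_cube[OF open_cube X3(1) continuous_on_subset[OF ce sub2] eX3]) blast
  define C where "C = cube X3 r3"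
  have C: "is_domain C" "open C" "C \<subseteq> D" using is_domain_cube[OF r3(1)] open_cube r3(2) sub2 by (auto simp: C_def)
  have sepC: "separated \<eta> C f p q r g h" by (rule separated_subset[OF sep C(3)])
  have WC: "Wdet g h (z1, y1) \<noteq> 0" if "(z, z1, y, y1) \<in> C" for z z1 y y1
    using r1(3)[of "(z, z1, y, y1)"] that r2(2) r3(2) by (auto simp: C_def)
  have "describes_surfaces \<delta> C F G f"
  proof (rule separated_describes_surfaces[OF C(2) sepC])
    show "generically_nonzero C (\<lambda>X. f 1 1 X * f 2 2 X - f 1 2 X * f 2 1 X)"
      by (rule generically_nonzeroI) (use r3(3) in \<open>auto simp: C_def e_def\<close>)
    fix X assume X: "X \<in> C"
    obtain z z1 y y1 where X': "X = (z, z1, y, y1)" by (cases X)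
    have XD: "(z, z1, y, y1) \<in> D" using X X' C(3) by auto
    then have zy: "(z, y) \<in> proj0 D" and w: "(z1, y1) \<in> proj1 D" by (force simp: proj0_def proj1_def)+
    have \<rho>: "\<mu> * g (z1, y1) - lam * h (z1, y1) = a * y1 + b * z1" using rel w by auto
    have "z1 * (b * deriv \<phi> (a * y + b * z)) + y1 * (a * deriv \<phi> (a * y + b * z))
        = (a * y1 + b * z1) * deriv \<phi> (a * y + b * z)" by (simp add: algebra_simps)
    also have "\<dots> = - h (z1, y1) * (lam * deriv \<phi> (a * y + b * z)) - (- \<mu> * deriv \<phi> (a * y + b * z)) * g (z1, y1)"
      unfolding \<rho>[symmetric] by (simp add: algebra_simps)
    finally show "first_equation p q r g h X"
      unfolding X' first_equation_def p_def q_def r_def case_prod_conv pd1_xi[OF D(1) ab \<phi> zy] pd2_xi[OF D(1) ab \<phi> zy]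
      by simp
    fix B C'
    have "(second_equation \<eta> p q r g h X B C' \<and> third_equation \<delta> \<eta> p q r g h X B C') \<longleftrightarrow>
        (B, C') = rhs_i \<delta> \<eta> a b \<mu> lam g h \<phi> X"
      unfolding X'
      by (rule solve_i[OF D(1) ab \<phi> g h _ p_def q_def r_def XD WC]) (use rel X X' in auto)
    moreover have "(F X, G X) = rhs_i \<delta> \<eta> a b \<mu> lam g h \<phi> X"
      using sys XD WC[OF X[unfolded X']] unfolding system_i_def rhs_i_def X' Let_def by auto
    ultimately show "(second_equation \<eta> p q r g h X B C' \<and> third_equation \<delta> \<eta> p q r g h X B C') \<longleftrightarrow>
        B = F X \<and> C' = G X" by (metis prod.inject)
  qed
  moreover have "\<forall>X\<in>C. f 1 1 X = \<eta>" using sepC by (auto simp: separated_def)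
  ultimately show ?thesis using C unfolding after_shrinking_def by blast
qed

text \<open>The right-hand sides of the second normal form, as a pair.\<close>

definition rhs_ii where
  "rhs_ii \<delta> \<eta> a1 b1 a3 b3 p = (\<lambda>(z, z1, y, y1).
        let \<gamma> = a1 * b3 - b1 * a3; \<alpha> = a3\<^sup>2 - \<delta> * a1\<^sup>2; \<beta> = b3\<^sup>2 - \<delta> * b1\<^sup>2;
            \<tau> = a3 * b3 - \<delta> * a1 * b1;
            P = p (z, y); pz = pd1 p (z, y); py = pd2 p (z, y);
            pzz = pd1 (pd1 p) (z, y); pzy = pd2 (pd1 p) (z, y); pyy = pd2 (pd2 p) (z, y)
        in (- z1 / \<gamma> * (pzy + \<tau> * P) - y1 / \<gamma> * (pyy + \<beta> * P) + \<eta> / \<gamma>\<^sup>2 * (\<beta> * pz - \<tau> * py),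
            z1 / \<gamma> * (pzz + \<alpha> * P) + y1 / \<gamma> * (pzy + \<tau> * P) - \<eta> / \<gamma>\<^sup>2 * (\<tau> * pz - \<alpha> * py)))"

text \<open>The gradients of \<open>g\<close> and \<open>h\<close> are constant and \<open>W = \<gamma>\<close>; the symmetry of the second derivatives
  of \<open>p\<close> merges the coefficients of \<open>p\<^sub>z\<^sub>y\<close> and \<open>p\<^sub>y\<^sub>z\<close>.\<close>

lemma solve_ii:
  assumes D: "open D" and \<gamma>: "a1 * b3 - b1 * a3 \<noteq> 0" and p: "smooth_on p (proj0 D)"
    and q: "\<And>w. w \<in> proj0 D \<Longrightarrow> q w = b1 / (a1 * b3 - b1 * a3) * pd1 p w + (- a1 / (a1 * b3 - b1 * a3)) * pd2 p w"
    and r: "\<And>w. w \<in> proj0 D \<Longrightarrow> r w = (- b3 / (a1 * b3 - b1 * a3)) * pd1 p w + a3 / (a1 * b3 - b1 * a3) * pd2 p w"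
    and g: "\<And>w. w \<in> proj1 D \<Longrightarrow> g w = a1 * fst w + b1 * snd w"
    and h: "\<And>w. w \<in> proj1 D \<Longrightarrow> h w = a3 * fst w + b3 * snd w"
    and X: "(z, z1, y, y1) \<in> D"
  shows "second_equation \<eta> p q r g h (z, z1, y, y1) F G \<and> third_equation \<delta> \<eta> p q r g h (z, z1, y, y1) F G \<longleftrightarrow>
    (F, G) = rhs_ii \<delta> \<eta> a1 b1 a3 b3 p (z, z1, y, y1)"
proof -
  have zy: "(z, y) \<in> proj0 D" and w: "(z1, y1) \<in> proj1 D" using X by (force simp: proj0_def proj1_def)+
  note o0 = open_proj0[OF D] and o1 = open_proj1[OF D]
  have pdg: "pd1 g (z1, y1) = a1" "pd2 g (z1, y1) = b1" "pd1 h (z1, y1) = a3" "pd2 h (z1, y1) = b3"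
    using pd1_affine[OF o1 w, of g a1 b1 0] pd2_affine[OF o1 w, of g a1 b1 0] g
      pd1_affine[OF o1 w, of h a3 b3 0] pd2_affine[OF o1 w, of h a3 b3 0] h by auto
  have W: "Wdet g h (z1, y1) = a1 * b3 - b1 * a3" by (simp add: Wdet_def pdg)
  have d: "pd1 p differentiable (at (z, y))" "pd2 p differentiable (at (z, y))"
    using smooth_on_differentiable[OF smooth_on_pd1[OF o0 p] zy] smooth_on_differentiable[OF smooth_on_pd2[OF o0 p] zy] .
  have lin: "(\<lambda>w. c * pd1 p w + e * pd2 p w) differentiable (at (z, y))" for c e
    by (intro differentiable_add differentiable_mult differentiable_const d)
  have pdq: "pd1 q (z, y) = b1 / (a1 * b3 - b1 * a3) * pd1 (pd1 p) (z, y) + (- a1 / (a1 * b3 - b1 * a3)) * pd2 (pd1 p) (z, y)"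
    "pd2 q (z, y) = b1 / (a1 * b3 - b1 * a3) * pd2 (pd1 p) (z, y) + (- a1 / (a1 * b3 - b1 * a3)) * pd2 (pd2 p) (z, y)"
    "pd1 r (z, y) = (- b3 / (a1 * b3 - b1 * a3)) * pd1 (pd1 p) (z, y) + a3 / (a1 * b3 - b1 * a3) * pd2 (pd1 p) (z, y)"
    "pd2 r (z, y) = (- b3 / (a1 * b3 - b1 * a3)) * pd2 (pd1 p) (z, y) + a3 / (a1 * b3 - b1 * a3) * pd2 (pd2 p) (z, y)"
    using pd1_cong[OF o0 zy q lin] pd2_cong[OF o0 zy q lin] pd1_cong[OF o0 zy r lin] pd2_cong[OF o0 zy r lin] pd_commute[OF o0 p zy]
    by (simp_all only: pd1_lincomb[OF d] pd2_lincomb[OF d])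
  define \<gamma>' where "\<gamma>' = a1 * b3 - b1 * a3"
  have \<gamma>': "\<gamma>' \<noteq> 0" using \<gamma> by (simp add: \<gamma>'_def)
  have alg: "((z1 * (b1 / \<gamma>' * pzz + - a1 / \<gamma>' * pzy) + y1 * (b1 / \<gamma>' * pzy + - a1 / \<gamma>' * pyy)
        - \<eta> * (- b3 / \<gamma>' * pz + a3 / \<gamma>' * py) - P * (a3 * z1 + b3 * y1)) * b3
      - (\<delta> * (\<eta> * (b1 / \<gamma>' * pz + - a1 / \<gamma>' * py) - P * (a1 * z1 + b1 * y1))
        - z1 * (- b3 / \<gamma>' * pzz + a3 / \<gamma>' * pzy) - y1 * (- b3 / \<gamma>' * pzy + a3 / \<gamma>' * pyy)) * b1) / \<gamma>'
    = - z1 / \<gamma>' * (pzy + (a3 * b3 - \<delta> * a1 * b1) * P) - y1 / \<gamma>' * (pyy + (b3\<^sup>2 - \<delta> * b1\<^sup>2) * P)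
      + \<eta> / \<gamma>'\<^sup>2 * ((b3\<^sup>2 - \<delta> * b1\<^sup>2) * pz - (a3 * b3 - \<delta> * a1 * b1) * py)" (is ?A)
   "((\<delta> * (\<eta> * (b1 / \<gamma>' * pz + - a1 / \<gamma>' * py) - P * (a1 * z1 + b1 * y1))
        - z1 * (- b3 / \<gamma>' * pzz + a3 / \<gamma>' * pzy) - y1 * (- b3 / \<gamma>' * pzy + a3 / \<gamma>' * pyy)) * a1
      - (z1 * (b1 / \<gamma>' * pzz + - a1 / \<gamma>' * pzy) + y1 * (b1 / \<gamma>' * pzy + - a1 / \<gamma>' * pyy)
        - \<eta> * (- b3 / \<gamma>' * pz + a3 / \<gamma>' * py) - P * (a3 * z1 + b3 * y1)) * a3) / \<gamma>'
    = z1 / \<gamma>' * (pzz + (a3\<^sup>2 - \<delta> * a1\<^sup>2) * P) + y1 / \<gamma>' * (pzy + (a3 * b3 - \<delta> * a1 * b1) * P)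
      - \<eta> / \<gamma>'\<^sup>2 * ((a3 * b3 - \<delta> * a1 * b1) * pz - (a3\<^sup>2 - \<delta> * a1\<^sup>2) * py)" (is ?B) for pzz pzy pyy pz py P
  proof -
    define k where "k = 1 / \<gamma>'"
    have k: "k * (a1 * b3 - b1 * a3) = 1" using \<gamma>' by (simp add: k_def \<gamma>'_def[symmetric])
    have div: "x / \<gamma>' = x * k" "x / \<gamma>'\<^sup>2 = x * (k * k)" for x by (simp_all add: k_def power2_eq_square)
    show ?A unfolding div unfolding power2_eq_square using k by algebra
    show ?B unfolding div unfolding power2_eq_square using k by algebra
  qed
  have Wn: "Wdet g h (z1, y1) \<noteq> 0" using \<gamma> by (simp add: W)
  show ?thesis
    unfolding second_third_iff[OF Wn] rhs_ii_def case_prod_conv Let_def prod.inject W pdg pdq q[OF zy] r[OF zy] g[OF w] h[OF w]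
      fst_conv snd_conv \<gamma>'_def[symmetric] alg ..
qed

lemma first_equation_ii:
  fixes a1 b1 a3 b3 z1 y1 pz py :: real
  assumes \<gamma>: "a1 * b3 - b1 * a3 \<noteq> 0"
  shows "z1 * pz + y1 * py = - (a3 * z1 + b3 * y1) * (b1 / (a1 * b3 - b1 * a3) * pz + (- a1 / (a1 * b3 - b1 * a3)) * py)
    - ((- b3 / (a1 * b3 - b1 * a3)) * pz + a3 / (a1 * b3 - b1 * a3) * py) * (a1 * z1 + b1 * y1)"
proof -
  define k where "k = 1 / (a1 * b3 - b1 * a3)"
  have k: "k * (a1 * b3 - b1 * a3) = 1" using \<gamma> by (simp add: k_def)
  have div: "x / (a1 * b3 - b1 * a3) = x * k" for x by (simp add: k_def)
  show ?thesis unfolding div using k by algebra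
qed

lemma separated_ii:
  assumes D: "open D" and p: "smooth_on p (proj0 D)"
  shows "separated \<eta> D f p
      (\<lambda>w. b1 / (a1 * b3 - b1 * a3) * pd1 p w + (- a1 / (a1 * b3 - b1 * a3)) * pd2 p w)
      (\<lambda>w. (- b3 / (a1 * b3 - b1 * a3)) * pd1 p w + a3 / (a1 * b3 - b1 * a3) * pd2 p w)
      (\<lambda>w. a1 * fst w + b1 * snd w) (\<lambda>w. a3 * fst w + b3 * snd w) \<longleftrightarrow> assoc_ii \<eta> D f a1 b1 a3 b3 p"
proof -
  note o0 = open_proj0[OF D] and o1 = open_proj1[OF D]
  have lin: "smooth_on (\<lambda>w. c * fst w + d * snd w) (proj1 D)" for c d
    by (intro smooth_on_add smooth_on_cmult smooth_on_linear o1 bounded_linear_fst bounded_linear_snd)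
  have comb: "smooth_on (\<lambda>w. c * pd1 p w + d * pd2 p w) (proj0 D)" for c d
    by (intro smooth_on_add smooth_on_cmult smooth_on_pd1 smooth_on_pd2 o0 p)
  have e: "1 / \<gamma> * (b1 * s - a1 * t) = b1 / \<gamma> * s + - a1 / \<gamma> * t"
    "- (1 / \<gamma>) * (b3 * s - a3 * t) = - b3 / \<gamma> * s + a3 / \<gamma> * t"
    "- a3 * s - b3 * t = - (a3 * s + b3 * t)" for \<gamma> s t
    by (simp_all add: diff_divide_distrib right_diff_distrib)
  show ?thesis
    unfolding separated_def assoc_ii_def Let_def e
    by (simp only: p lin comb simp_thms fst_conv snd_conv) auto
qed

text \<open>Here \<open>W = \<gamma>\<close> never vanishes. If \<open>f\<^sub>1\<^sub>1 f\<^sub>2\<^sub>2 - f\<^sub>1\<^sub>2 f\<^sub>2\<^sub>1\<close>, which is affine in \<open>(z1, y1)\<close> with linear part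
  \<open>- p (a1 z1 + b1 y1)\<close>, vanished identically, so would \<open>p\<close>, against the linear independence of its
  partial derivatives.\<close>

lemma case_ii_describes_surfaces:
  assumes dom: "is_domain D" and data: "data_ii D a1 b1 a3 b3 p"
    and sys: "system_ii \<delta> \<eta> D F G a1 b1 a3 b3 p" and assoc: "assoc_ii \<eta> D f a1 b1 a3 b3 p"
  shows "after_shrinking D (\<lambda>D'. describes_surfaces \<delta> D' F G f \<and> (\<forall>X\<in>D'. f 1 1 X = \<eta>))"
proof -
  have D: "open D" "D \<noteq> {}" using dom by (auto simp: is_domain_def)
  have \<gamma>: "a1 * b3 - b1 * a3 \<noteq> 0" and p: "smooth_on p (proj0 D)"
    and indep: "\<And>c d. (\<forall>w\<in>proj0 D. c * pd1 p w + d * pd2 p w = 0) \<Longrightarrow> c = 0 \<and> d = 0"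
    using data unfolding data_ii_def by blast+
  define q where "q w = b1 / (a1 * b3 - b1 * a3) * pd1 p w + (- a1 / (a1 * b3 - b1 * a3)) * pd2 p w" for w
  define r where "r w = (- b3 / (a1 * b3 - b1 * a3)) * pd1 p w + a3 / (a1 * b3 - b1 * a3) * pd2 p w" for w
  define g where "g w = a1 * fst w + b1 * snd w" for w
  define h where "h w = a3 * fst w + b3 * snd w" for w
  have sep: "separated \<eta> D f p q r g h"
    using separated_ii[OF D(1) p] assoc unfolding q_def[abs_def] r_def[abs_def] g_def[abs_def] h_def[abs_def] by blast
  define e where "e X = f 1 1 X * f 2 2 X - f 1 2 X * f 2 1 X" for X
  have sm: "\<forall>i\<in>{1,2,3}. \<forall>j\<in>{1,2}. smooth_on (f i j) D" by (rule separated_smooth[OF D(1) sep])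
  have ce: "continuous_on D e"
    unfolding e_def using sm by (intro continuous_intros smooth_on_continuous) auto
  have eX: "e (z, z1, y, y1) = \<eta> * q (z, y) - p (z, y) * (a1 * z1 + b1 * y1)" if "(z, z1, y, y1) \<in> D" for z z1 y y1
    using sep that by (simp add: e_def separated_def g_def)
  have "\<exists>X\<in>D. e X \<noteq> 0"
  proof (rule ccontr)
    assume *: "\<not> ?thesis"
    have p0: "p w = 0" if w: "w \<in> proj0 D" for w
    proof -
      obtain z z1 y y1 where X: "(z, z1, y, y1) \<in> D" "w = (z, y)" using w by (auto simp: proj0_def)
      obtain s where s: "0 < s" "cube (z, z1, y, y1) s \<subseteq> D" by (rule cube_subset_open[OF D(1) X(1)])
      have "(z, z1 + s / 2, y, y1) \<in> D" "(z, z1, y, y1 + s / 2) \<in> D" "(z, z1, y, y1) \<in> D"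
        using s by (auto intro!: subsetD[OF s(2)] simp: in_cube)
      then have eq: "\<eta> * q (z, y) - p (z, y) * (a1 * (z1 + s / 2) + b1 * y1) = 0"
        "\<eta> * q (z, y) - p (z, y) * (a1 * z1 + b1 * (y1 + s / 2)) = 0"
        "\<eta> * q (z, y) - p (z, y) * (a1 * z1 + b1 * y1) = 0"
        using * eX by metis+
      have dif: "P * (c * t) = 0" if "Q - P * (c * (x + t) + d) = 0" "Q - P * (c * x + d) = 0" for P Q c d x t :: real
        using that by (simp add: algebra_simps)
      have "p (z, y) * (a1 * (s / 2)) = 0" by (rule dif[OF eq(1,3)])
      moreover have "p (z, y) * (b1 * (s / 2)) = 0"
        by (rule dif[where d = "a1 * z1" and x = y1 and Q = "\<eta> * q (z, y)"]) (use eq(2,3) in \<open>simp_all only: add.commute\<close>)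
      ultimately show ?thesis using s(1) \<gamma> X(2) by auto
    qed
    have "pd1 p w = 0" "pd2 p w = 0" if "w \<in> proj0 D" for w
      using pd1_affine[OF open_proj0[OF D(1)] that, of p 0 0 0] pd2_affine[OF open_proj0[OF D(1)] that, of p 0 0 0] p0 by auto
    then show False using indep[of 1 1] by simp
  qed
  then obtain X where X: "X \<in> D" "e X \<noteq> 0" by blast
  obtain s where s: "0 < s" "cube X s \<subseteq> D" "\<And>Y. Y \<in> cube X s \<Longrightarrow> e Y \<noteq> 0"
    by (rule nonzero_on_cube[OF D(1) X(1) ce X(2)]) blast
  define C where "C = cube X s"
  have C: "is_domain C" "open C" "C \<subseteq> D" using is_domain_cube[OF s(1)] open_cube s(2) by (auto simp: C_def)
  have sepC: "separated \<eta> C f p q r g h" by (rule separated_subset[OF sep C(3)])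
  have "describes_surfaces \<delta> C F G f"
  proof (rule separated_describes_surfaces[OF C(2) sepC])
    show "generically_nonzero C (\<lambda>X. f 1 1 X * f 2 2 X - f 1 2 X * f 2 1 X)"
      by (rule generically_nonzeroI) (use s(3) in \<open>auto simp: C_def e_def\<close>)
    fix X assume X: "X \<in> C"
    obtain z z1 y y1 where X': "X = (z, z1, y, y1)" by (cases X)
    have XD: "(z, z1, y, y1) \<in> D" using X X' C(3) by auto
    show "first_equation p q r g h X"
      unfolding X' first_equation_def q_def r_def g_def h_def case_prod_conv fst_conv snd_conv
      by (rule first_equation_ii[OF \<gamma>])
    fix B C'
    have "(second_equation \<eta> p q r g h X B C' \<and> third_equation \<delta> \<eta> p q r g h X B C') \<longleftrightarrow>
        (B, C') = rhs_ii \<delta> \<eta> a1 b1 a3 b3 p X"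
      unfolding X' by (rule solve_ii[OF D(1) \<gamma> p q_def r_def g_def h_def XD])
    moreover have "(F X, G X) = rhs_ii \<delta> \<eta> a1 b1 a3 b3 p X"
      using sys XD unfolding system_ii_def rhs_ii_def X' Let_def by auto
    ultimately show "(second_equation \<eta> p q r g h X B C' \<and> third_equation \<delta> \<eta> p q r g h X B C') \<longleftrightarrow>
        B = F X \<and> C' = G X" by (metis prod.inject)
  qed
  moreover have "\<forall>X\<in>C. f 1 1 X = \<eta>" using sepC by (auto simp: separated_def)
  ultimately show ?thesis using C unfolding after_shrinking_def by blast
qed

section \<open>From surfaces to the normal forms\<close>

lemma describes_surfaces_subset:
  assumes "describes_surfaces \<delta> D F G f" "D' \<subseteq> D" shows "describes_surfaces \<delta> D' F G f"
  unfolding describes_surfaces_def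
proof (intro conjI allI impI)
  show "\<forall>i\<in>{1, 2, 3}. \<forall>j\<in>{1, 2}. smooth_on (f i j) D'"
    using assms smooth_on_subset unfolding describes_surfaces_def by blast
  have "negligible {X \<in> D. f 1 1 X * f 2 2 X - f 1 2 X * f 2 1 X = 0}"
    using assms(1) unfolding describes_surfaces_def generically_nonzero_def by blast
  then show "generically_nonzero D' (\<lambda>X. f 1 1 X * f 2 2 X - f 1 2 X * f 2 1 X)"
    unfolding generically_nonzero_def by (rule negligible_subset) (use assms(2) in blast)
  fix Q u v assume "open Q \<and> smooth_on u Q \<and> smooth_on v Q \<and> jet u v ` Q \<subseteq> D'"
  then show "solves_system F G Q u v = structure_equations \<delta> f Q u v"
    using assms unfolding describes_surfaces_def by blast
qed

text \<open>The mean value theorem on the segment from \<open>X\<close> to \<open>Y\<close>.\<close>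

lemma equal_along_null_direction:
  fixes f :: "'a::real_normed_vector \<Rightarrow> real"
  assumes C: "convex C" and d: "\<And>X. X \<in> C \<Longrightarrow> f differentiable (at X)" and X: "X \<in> C" and Y: "Y \<in> C"
    and 0: "\<And>Z. Z \<in> C \<Longrightarrow> fd f Z (Y - X) = 0"
  shows "f Y = f X"
proof -
  have seg: "closed_segment X Y \<subseteq> C" using C X Y by (simp add: closed_segment_subset)
  obtain Z where "Z \<in> closed_segment X Y" "f Y - f X = fd f Z (Y - X)"
    by (rule mean_value_segment[of X Y f]) (use seg d in blast)
  then show ?thesis using 0[of Z] seg by auto
qed

text \<open>The second derivatives in \<open>x\<close> and the first derivatives in \<open>t\<close> of a solution are
  arbitrary, so their coefficients vanish: the functions multiplying \<open>dt\<close> depend on \<open>(z, y)\<close> only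
  and those multiplying \<open>dx\<close> on \<open>(z1, y1)\<close> only.\<close>

lemma describes_surfaces_separated:
  assumes r: "0 < r" and F: "smooth_on F (cube X r)" and G: "smooth_on G (cube X r)"
    and ds: "describes_surfaces \<delta> (cube X r) F G f" and \<eta>: "\<forall>X\<in>cube X r. f 1 1 X = \<eta>"
  obtains p q s g h where "separated \<eta> (cube X r) f p q s g h"
proof -
  obtain z0 c1 y0 c3 where X: "X = (z0, c1, y0, c3)" by (cases X)
  let ?C = "cube X r"
  have sm: "smooth_on (f i j) ?C" if "i \<in> {1,2,3}" "j \<in> {1,2}" for i j
    using ds that unfolding describes_surfaces_def by blast
  have dif: "f i j differentiable (at Y)" if "i \<in> {1,2,3}" "j \<in> {1,2}" "Y \<in> ?C" for i j Y
    using smooth_on_differentiable[OF sm] that by blast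
  note st = describes_surfaces_pointwise[OF open_cube F G ds]
  have null: "fd k Y e2 = 0 \<and> fd k Y e4 = 0 \<and> fd l Y e1 = 0 \<and> fd l Y e3 = 0"
    if k: "k differentiable (at Y)" and l: "l differentiable (at Y)"
      and eq: "\<And>a b c d. fd k Y (z1, a, y1, b) - fd l Y (c, F', d, G') = R" for k l Y z1 y1 F' G' R
  proof -
    have e: "z1 * fd k Y e1 + a * fd k Y e2 + y1 * fd k Y e3 + b * fd k Y e4
      - (c * fd l Y e1 + F' * fd l Y e2 + d * fd l Y e3 + G' * fd l Y e4) = R" for a b c d
      using eq[of a b c d] unfolding fd_jet[OF k, of z1] fd_jet[OF l, of c] .
    show ?thesis using e[of 0 0 0 0] e[of 1 0 0 0] e[of 0 1 0 0] e[of 0 0 1 0] e[of 0 0 0 1] by simp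
  qed
  have nulls: "fd (f i 2) Y e2 = 0 \<and> fd (f i 2) Y e4 = 0 \<and> fd (f i 1) Y e1 = 0 \<and> fd (f i 1) Y e3 = 0"
    if i: "i \<in> {1,2,3}" and Y: "Y \<in> ?C" for i Y
  proof -
    obtain z z1 y y1 where Y': "Y = (z, z1, y, y1)" by (cases Y)
    have "\<exists>R. \<forall>a b c d. fd (f i 2) Y (z1, a, y1, b) - fd (f i 1) Y (c, F Y, d, G Y) = R"
      using st[OF Y[unfolded Y']] i unfolding structure_at_def Y' by blast
    then show ?thesis using null[OF dif[OF i _ Y] dif[OF i _ Y]] by blast
  qed
  have dt: "f i 2 (z, z1, y, y1) = f i 2 (z, c1, y, c3)" and dx: "f i 1 (z, z1, y, y1) = f i 1 (z0, z1, y0, y1)"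
    if i: "i \<in> {1,2,3}" and Y: "(z, z1, y, y1) \<in> ?C" for i z z1 y y1
  proof -
    have "(z, c1, y, c3) \<in> ?C" "(z0, z1, y0, y1) \<in> ?C" using Y r by (auto simp: X in_cube)
    moreover have "fd (f i 2) Z (0, a, 0, b) = 0" "fd (f i 1) Z (a, 0, b, 0) = 0" if "Z \<in> ?C" for Z a b
      using nulls[OF i that] fd_jet[OF dif[OF i _ that], of 2 0 a 0 b] fd_jet[OF dif[OF i _ that], of 1 a 0 b 0] by auto
    ultimately show "f i 2 (z, z1, y, y1) = f i 2 (z, c1, y, c3)" "f i 1 (z, z1, y, y1) = f i 1 (z0, z1, y0, y1)"
      using Y dif[OF i] by (auto intro!: equal_along_null_direction[OF convex_cube[of X r]])
  qed
  note o0 = open_proj0[OF open_cube[of X r]] and o1 = open_proj1[OF open_cube[of X r]]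
  have s0: "smooth_on (\<lambda>w. f i 2 (fst w, c1, snd w, c3)) (proj0 ?C)" if "i \<in> {1,2,3}" for i
    by (rule smooth_on_compose_jet[OF o0 _ sm[OF that]])
      (use r in \<open>auto simp: X in_cube in_proj0_cube[OF r] proj0_def intro!: smooth_on_linear smooth_on_const bounded_linear_fst bounded_linear_snd\<close>)
  have s1: "smooth_on (\<lambda>w. f i 1 (z0, fst w, y0, snd w)) (proj1 ?C)" if "i \<in> {1,2,3}" for i
    by (rule smooth_on_compose_jet[OF o1 _ sm[OF that]])
      (use r in \<open>auto simp: X in_cube in_proj1_cube[OF r] proj1_def intro!: smooth_on_linear smooth_on_const bounded_linear_fst bounded_linear_snd\<close>)
  have "separated \<eta> ?C f (\<lambda>w. f 1 2 (fst w, c1, snd w, c3)) (\<lambda>w. f 2 2 (fst w, c1, snd w, c3))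
      (\<lambda>w. f 3 2 (fst w, c1, snd w, c3)) (\<lambda>w. f 2 1 (z0, fst w, y0, snd w)) (\<lambda>w. - f 3 1 (z0, fst w, y0, snd w))"
    unfolding separated_def fst_conv snd_conv minus_minus
  proof (intro conjI allI impI)
    show "smooth_on (\<lambda>w. - f 3 1 (z0, fst w, y0, snd w)) (proj1 ?C)"
      by (rule smooth_on_minus[OF o1 s1]) simp
    show "smooth_on (\<lambda>w. f 1 2 (fst w, c1, snd w, c3)) (proj0 ?C)" "smooth_on (\<lambda>w. f 2 2 (fst w, c1, snd w, c3)) (proj0 ?C)"
      "smooth_on (\<lambda>w. f 3 2 (fst w, c1, snd w, c3)) (proj0 ?C)" "smooth_on (\<lambda>w. f 2 1 (z0, fst w, y0, snd w)) (proj1 ?C)"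
      by (rule s0 s1; simp)+
    fix z z1 y y1 assume Y: "(z, z1, y, y1) \<in> ?C"
    show "f 1 1 (z, z1, y, y1) = \<eta>" using \<eta> Y by blast
    show "f 1 2 (z, z1, y, y1) = f 1 2 (z, c1, y, c3)" "f 2 2 (z, z1, y, y1) = f 2 2 (z, c1, y, c3)"
      "f 3 2 (z, z1, y, y1) = f 3 2 (z, c1, y, c3)"
      by (rule dt[OF _ Y]; simp)+
    show "f 2 1 (z, z1, y, y1) = f 2 1 (z0, z1, y0, y1)" "f 3 1 (z, z1, y, y1) = f 3 1 (z0, z1, y0, y1)"
      by (rule dx[OF _ Y]; simp)+
  qed
  then show ?thesis by (rule that)
qed

text \<open>If \<open>W\<close> vanished identically, a vector field \<open>(k1, k2)\<close> in the common kernel of the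
  gradients of \<open>g\<close> and \<open>h\<close> could be added to the right-hand side of the system without violating
  the structure equations, which would then have solutions that do not solve the system.\<close>

lemma describes_surfaces_Wdet_nonzero:
  assumes D: "open D" "D \<noteq> {}" and F: "smooth_on F D" and G: "smooth_on G D"
    and ds: "describes_surfaces \<delta> D F G f" and sep: "separated \<eta> D f p q s g h"
  obtains X where "X \<in> D" "(case X of (z, z1, y, y1) \<Rightarrow> Wdet g h (z1, y1)) \<noteq> 0"
proof -
  have False if W0: "\<And>X. X \<in> D \<Longrightarrow> (case X of (z, z1, y, y1) \<Rightarrow> Wdet g h (z1, y1)) = 0"
  proof -
    have W: "pd1 g w * pd2 h w - pd2 g w * pd1 h w = 0" if "w \<in> proj1 D" for w
      using W0 that by (force simp: proj1_def Wdet_def)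
    note o1 = open_proj1[OF D(1)]
    have g: "smooth_on g (proj1 D)" and h: "smooth_on h (proj1 D)" using sep by (auto simp: separated_def)
    note sm = smooth_on_pd1[OF o1 g] smooth_on_pd2[OF o1 g] smooth_on_pd1[OF o1 h] smooth_on_pd2[OF o1 h]
    have "\<exists>k1 k2. smooth_on k1 (proj1 D) \<and> smooth_on k2 (proj1 D) \<and>
      (\<forall>w\<in>proj1 D. k1 w * pd1 g w + k2 w * pd2 g w = 0 \<and> k1 w * pd1 h w + k2 w * pd2 h w = 0) \<and>
      (\<exists>w\<in>proj1 D. k1 w \<noteq> 0 \<or> k2 w \<noteq> 0)"
    \<comment> \<open>the rotated gradient of \<open>g\<close> or, if this vanishes identically, of \<open>h\<close> or, if both vanish, a nonzero constant\<close>
    proof (cases "\<exists>w\<in>proj1 D. pd1 g w \<noteq> 0 \<or> pd2 g w \<noteq> 0")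
      case True
      show ?thesis
        by (rule exI[of _ "pd2 g"], rule exI[of _ "\<lambda>w. - pd1 g w"])
          (use True W sm smooth_on_minus[OF o1] in \<open>auto simp: algebra_simps\<close>)
    next
      case g0: False
      show ?thesis
      proof (cases "\<exists>w\<in>proj1 D. pd1 h w \<noteq> 0 \<or> pd2 h w \<noteq> 0")
        case True
        show ?thesis
          by (rule exI[of _ "pd2 h"], rule exI[of _ "\<lambda>w. - pd1 h w"])
            (use True g0 sm smooth_on_minus[OF o1] in \<open>auto simp: algebra_simps\<close>)
      next
        case False
        have "proj1 D \<noteq> {}" using D(2) by (auto simp: proj1_def)
        then show ?thesis
          by (intro exI[of _ "\<lambda>w. 1"]) (use False g0 in \<open>auto intro!: smooth_on_const\<close>)
      qed
    qed
    then obtain k1 k2 w where k: "smooth_on k1 (proj1 D)" "smooth_on k2 (proj1 D)"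
      "\<And>w. w \<in> proj1 D \<Longrightarrow> k1 w * pd1 g w + k2 w * pd2 g w = 0 \<and> k1 w * pd1 h w + k2 w * pd2 h w = 0"
      and w: "w \<in> proj1 D" "k1 w \<noteq> 0 \<or> k2 w \<noteq> 0" by blast
    define K1 where "K1 = (\<lambda>(z :: real, z1, y :: real, y1). k1 (z1, y1))"
    define K2 where "K2 = (\<lambda>(z :: real, z1, y :: real, y1). k2 (z1, y1))"
    have K: "smooth_on K1 D" "smooth_on K2 D"
      using smooth_on_pullback1[OF D(1) k(1), of K1] smooth_on_pullback1[OF D(1) k(2), of K2] by (auto simp: K1_def K2_def)
    obtain z y where X: "(z, fst w, y, snd w) \<in> D" using w(1) by (auto simp: proj1_def)
    have "F (z, fst w, y, snd w) + K1 (z, fst w, y, snd w) = F (z, fst w, y, snd w) \<and>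
        G (z, fst w, y, snd w) + K2 (z, fst w, y, snd w) = G (z, fst w, y, snd w)"
    proof (rule describes_surfaces_unique[OF D(1) F G _ _ ds _ X])
      show "smooth_on (\<lambda>X. F X + K1 X) D" "smooth_on (\<lambda>X. G X + K2 X) D"
        by (intro smooth_on_add D(1) F G K)+
      fix z z1 y y1 a b c d assume Y: "(z, z1, y, y1) \<in> D"
      then have "(z1, y1) \<in> proj1 D" by (force simp: proj1_def)
      note k' = k(3)[OF this]
      have "structure_at \<delta> f (z, z1, y, y1) (z1, a, y1, b) (c, F (z, z1, y, y1), d, G (z, z1, y, y1))"
        by (rule describes_surfaces_pointwise[OF D(1) F G ds Y])
      then show "structure_at \<delta> f (z, z1, y, y1) (z1, a, y1, b)
         (c, F (z, z1, y, y1) + K1 (z, z1, y, y1), d, G (z, z1, y, y1) + K2 (z, z1, y, y1))"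
        unfolding structure_at_separated[OF D(1) sep Y] second_equation_def third_equation_def case_prod_conv
        using k' by (simp add: K1_def K2_def distrib_right)
    qed
    then show False using w(2) by (simp add: K1_def K2_def)
  qed
  then show ?thesis using that by blast
qed

lemma affine_zero:
  fixes S :: "(real \<times> real) set"
  assumes S: "open S" "S \<noteq> {}" and 0: "\<And>w. w \<in> S \<Longrightarrow> c * fst w + d * snd w + k = 0"
  shows "c = 0 \<and> d = 0"
proof -
  obtain w where w: "w \<in> S" using S by blast
  have "pd1 (\<lambda>w. 0) w = c" "pd2 (\<lambda>w. 0) w = d"
    using pd1_affine[OF S(1) w, of "\<lambda>w. 0" c d k] pd2_affine[OF S(1) w, of "\<lambda>w. 0" c d k] 0 by auto
  moreover have "pd1 (\<lambda>w. 0) w = 0" "pd2 (\<lambda>w. 0) w = 0"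
    using pd1_affine[OF S(1) w, of "\<lambda>w. 0" 0 0 0] pd2_affine[OF S(1) w, of "\<lambda>w. 0" 0 0 0] by auto
  ultimately show ?thesis by simp
qed

text \<open>A linear relation between \<open>g\<close> and \<open>h\<close> passes to the gradients, whose determinant is \<open>W\<close>.\<close>

lemma Wdet_independent:
  assumes S: "open S" "w \<in> S" and g: "smooth_on g S" and h: "smooth_on h S" and W: "Wdet g h w \<noteq> 0"
    and 0: "\<And>w. w \<in> S \<Longrightarrow> \<alpha> * h w + \<beta> * g w = 0"
  shows "\<alpha> = 0 \<and> \<beta> = 0"
proof -
  have d: "h differentiable (at w)" "g differentiable (at w)"
    using smooth_on_differentiable g h S(2) by blast+
  have "\<alpha> * pd1 h w + \<beta> * pd1 g w = 0" "\<alpha> * pd2 h w + \<beta> * pd2 g w = 0"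
    using pd1_affine[OF S, of "\<lambda>w. \<alpha> * h w + \<beta> * g w" 0 0 0] pd2_affine[OF S, of "\<lambda>w. \<alpha> * h w + \<beta> * g w" 0 0 0]
      pd1_lincomb[OF d, of \<alpha> \<beta>] pd2_lincomb[OF d, of \<alpha> \<beta>] 0 by auto
  moreover from this have "\<alpha> * Wdet g h w = 0" "\<beta> * Wdet g h w = 0"
    unfolding Wdet_def by algebra+
  ultimately show ?thesis using W by simp
qed

text \<open>At two points \<open>w, w'\<close> where the gradients of \<open>p\<close> are linearly independent, the first structure
  equation gives two linear equations for \<open>h\<close> and \<open>g\<close> with coefficients \<open>q, s\<close>, whose right-hand
  sides are linear in \<open>(z1, y1)\<close>. Their determinant \<open>\<Delta>\<close> is nonzero, since otherwise a combination
  of them would be a linear relation between \<open>z1\<close> and \<open>y1\<close> alone. So \<open>g\<close> and \<open>h\<close> are linear, and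
  comparing the coefficients of \<open>z1\<close> and \<open>y1\<close> at an arbitrary point determines \<open>q\<close> and \<open>s\<close>.\<close>

lemma ii_from_independence:
  assumes r: "0 < r" and sep: "separated \<eta> (cube X r) f p q s g h"
    and st: "\<And>z z1 y y1. (z, z1, y, y1) \<in> cube X r \<Longrightarrow> structure_at \<delta> f (z, z1, y, y1)
      (z1, 0, y1, 0) (0, F (z, z1, y, y1), 0, G (z, z1, y, y1))"
    and W: "\<And>w. w \<in> proj1 (cube X r) \<Longrightarrow> Wdet g h w \<noteq> 0"
    and indep: "\<And>c d. (\<forall>w\<in>proj0 (cube X r). c * pd1 p w + d * pd2 p w = 0) \<Longrightarrow> c = 0 \<and> d = 0"
  shows "\<exists>a1 b1 a3 b3 p. data_ii (cube X r) a1 b1 a3 b3 p \<and> system_ii \<delta> \<eta> (cube X r) F G a1 b1 a3 b3 p \<and>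
           assoc_ii \<eta> (cube X r) f a1 b1 a3 b3 p"
proof -
  let ?C = "cube X r"
  note oC = open_cube[of X r] and o0 = open_proj0[OF open_cube[of X r]] and o1 = open_proj1[OF open_cube[of X r]]
  have ne: "proj1 ?C \<noteq> {}" "proj0 ?C \<noteq> {}" using centre_in_cube[OF r, of X] by (auto simp: proj0_def proj1_def)
  have sm: "smooth_on p (proj0 ?C)" "smooth_on g (proj1 ?C)" "smooth_on h (proj1 ?C)"
    using sep by (auto simp: separated_def)
  have E1: "fst v * pd1 p w + snd v * pd2 p w = - h v * q w - s w * g v"
    if "w \<in> proj0 ?C" "v \<in> proj1 ?C" for w v
  proof -
    obtain z y z1 y1 where wv: "w = (z, y)" "v = (z1, y1)" by (cases w, cases v)
    then have Y: "(z, z1, y, y1) \<in> ?C" using that cube_iff_proj[OF r] by blast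
    show ?thesis using st[OF Y] unfolding structure_at_separated[OF oC sep Y] by (simp add: first_equation_def wv)
  qed
  \<comment> \<open>For fixed \<open>w\<close>, vanishing of these determinants would be a linear relation between \<open>p\<^sub>z\<close> and \<open>p\<^sub>y\<close>.\<close>
  have "\<exists>w\<in>proj0 ?C. \<exists>w'\<in>proj0 ?C. pd1 p w * pd2 p w' - pd2 p w * pd1 p w' \<noteq> 0"
  proof (rule ccontr)
    assume *: "\<not> ?thesis"
    have "pd1 p w = 0 \<and> pd2 p w = 0" if "w \<in> proj0 ?C" for w
      using indep[of "- pd2 p w" "pd1 p w"] * that by (auto simp: algebra_simps)
    then show False using indep[of 1 1] by simp
  qed
  then obtain w w' where w: "w \<in> proj0 ?C" "w' \<in> proj0 ?C" and dp: "pd1 p w * pd2 p w' - pd2 p w * pd1 p w' \<noteq> 0"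
    by blast
  have \<Delta>: "q w * s w' - s w * q w' \<noteq> 0"
  proof
    assume \<Delta>0: "q w * s w' - s w * q w' = 0"
    have "(pd1 p w * q w' - pd1 p w' * q w) * fst v + (pd2 p w * q w' - pd2 p w' * q w) * snd v + 0 = 0"
      "(pd1 p w * s w' - pd1 p w' * s w) * fst v + (pd2 p w * s w' - pd2 p w' * s w) * snd v + 0 = 0"
      if "v \<in> proj1 ?C" for v
    proof -
      note e = E1[OF w(1) that] E1[OF w(2) that]
      have "(pd1 p w * q w' - pd1 p w' * q w) * fst v + (pd2 p w * q w' - pd2 p w' * q w) * snd v
        = (fst v * pd1 p w + snd v * pd2 p w) * q w' - (fst v * pd1 p w' + snd v * pd2 p w') * q w"
        by (simp add: algebra_simps)
      also have "\<dots> = g v * (q w * s w' - s w * q w')" unfolding e by (simp add: algebra_simps)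
      finally show "(pd1 p w * q w' - pd1 p w' * q w) * fst v + (pd2 p w * q w' - pd2 p w' * q w) * snd v + 0 = 0"
        using \<Delta>0 by simp
      have "(pd1 p w * s w' - pd1 p w' * s w) * fst v + (pd2 p w * s w' - pd2 p w' * s w) * snd v
        = (fst v * pd1 p w + snd v * pd2 p w) * s w' - (fst v * pd1 p w' + snd v * pd2 p w') * s w"
        by (simp add: algebra_simps)
      also have "\<dots> = - h v * (q w * s w' - s w * q w')" unfolding e by (simp add: algebra_simps)
      finally show "(pd1 p w * s w' - pd1 p w' * s w) * fst v + (pd2 p w * s w' - pd2 p w' * s w) * snd v + 0 = 0"
        using \<Delta>0 by simp
    qed
    then have e: "pd1 p w * q w' = pd1 p w' * q w" "pd2 p w * q w' = pd2 p w' * q w"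
      "pd1 p w * s w' = pd1 p w' * s w" "pd2 p w * s w' = pd2 p w' * s w"
      using affine_zero[OF o1 ne(1), of "pd1 p w * q w' - pd1 p w' * q w" "pd2 p w * q w' - pd2 p w' * q w" 0]
        affine_zero[OF o1 ne(1), of "pd1 p w * s w' - pd1 p w' * s w" "pd2 p w * s w' - pd2 p w' * s w" 0] by auto
    have "(pd1 p w * pd2 p w' - pd2 p w * pd1 p w') * q w = 0" using e(1,2) by algebra
    moreover have "(pd1 p w * pd2 p w' - pd2 p w * pd1 p w') * s w = 0" using e(3,4) by algebra
    ultimately have "q w = 0" "s w = 0" using dp by auto
    then have "pd1 p w * fst v + pd2 p w * snd v + 0 = 0" if "v \<in> proj1 ?C" for v
      using E1[OF w(1) that] by (simp add: mult.commute)
    then have "pd1 p w = 0" "pd2 p w = 0" using affine_zero[OF o1 ne(1)] by blast+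
    then show False using dp by simp
  qed
  define \<Delta>' where "\<Delta>' = q w * s w' - s w * q w'"
  define a3 where "a3 = (pd1 p w' * s w - pd1 p w * s w') / \<Delta>'"
  define b3 where "b3 = (pd2 p w' * s w - pd2 p w * s w') / \<Delta>'"
  define a1 where "a1 = (pd1 p w * q w' - pd1 p w' * q w) / \<Delta>'"
  define b1 where "b1 = (pd2 p w * q w' - pd2 p w' * q w) / \<Delta>'"
  have gh: "g v = a1 * fst v + b1 * snd v" "h v = a3 * fst v + b3 * snd v" if "v \<in> proj1 ?C" for v
  proof -
    have "h v * q w + g v * s w = - (fst v * pd1 p w + snd v * pd2 p w)"
      "h v * q w' + g v * s w' = - (fst v * pd1 p w' + snd v * pd2 p w')"
      unfolding E1[OF w(1) that] E1[OF w(2) that] by (simp_all add: algebra_simps)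
    from iffD1[OF cramer[OF \<Delta>] conjI, OF this]
    show "g v = a1 * fst v + b1 * snd v" "h v = a3 * fst v + b3 * snd v"
      unfolding \<Delta>'_def[symmetric] a1_def b1_def a3_def b3_def
      by (simp_all add: add_divide_distrib[symmetric] algebra_simps)
  qed
  obtain v0 where v0: "v0 \<in> proj1 ?C" using ne by blast
  have "Wdet g h v0 = a1 * b3 - b1 * a3"
    using pd1_affine[OF o1 v0, of g a1 b1 0] pd2_affine[OF o1 v0, of g a1 b1 0] gh
      pd1_affine[OF o1 v0, of h a3 b3 0] pd2_affine[OF o1 v0, of h a3 b3 0] by (simp add: Wdet_def)
  then have \<gamma>: "a1 * b3 - b1 * a3 \<noteq> 0" using W[OF v0] by simp
  have qs: "q w = b1 / (a1 * b3 - b1 * a3) * pd1 p w + (- a1 / (a1 * b3 - b1 * a3)) * pd2 p w"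
    "s w = (- b3 / (a1 * b3 - b1 * a3)) * pd1 p w + a3 / (a1 * b3 - b1 * a3) * pd2 p w"
    if w: "w \<in> proj0 ?C" for w
  proof -
    have "(pd1 p w + a3 * q w + a1 * s w) * fst v + (pd2 p w + b3 * q w + b1 * s w) * snd v + 0 = 0" if "v \<in> proj1 ?C" for v
      using E1[OF w that] unfolding gh[OF that] by (simp add: algebra_simps)
    then have e: "pd1 p w + a3 * q w + a1 * s w = 0" "pd2 p w + b3 * q w + b1 * s w = 0"
      using affine_zero[OF o1 ne(1)] by blast+
    have P: "pd1 p w = - a3 * q w - a1 * s w" and R: "pd2 p w = - b3 * q w - b1 * s w"
      using e by linarith+
    have "b1 * pd1 p w - a1 * pd2 p w = q w * (a1 * b3 - b1 * a3)"
      "- b3 * pd1 p w + a3 * pd2 p w = s w * (a1 * b3 - b1 * a3)"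
      unfolding P R by (simp_all add: algebra_simps)
    then have "q w = (b1 * pd1 p w - a1 * pd2 p w) / (a1 * b3 - b1 * a3)"
      "s w = (- b3 * pd1 p w + a3 * pd2 p w) / (a1 * b3 - b1 * a3)"
      using \<gamma> by simp_all
    then show "q w = b1 / (a1 * b3 - b1 * a3) * pd1 p w + (- a1 / (a1 * b3 - b1 * a3)) * pd2 p w"
      "s w = (- b3 / (a1 * b3 - b1 * a3)) * pd1 p w + a3 / (a1 * b3 - b1 * a3) * pd2 p w"
      by (simp_all add: diff_divide_distrib add_divide_distrib)
  qed
  have data: "data_ii ?C a1 b1 a3 b3 p" unfolding data_ii_def using \<gamma> sm(1) indep by blast
  have "system_ii \<delta> \<eta> ?C F G a1 b1 a3 b3 p"
  proof -
    have "(F X, G X) = rhs_ii \<delta> \<eta> a1 b1 a3 b3 p X" if "X \<in> ?C" for X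
    proof -
      obtain z z1 y y1 where Y: "X = (z, z1, y, y1)" by (cases X)
      show ?thesis
        using st[OF that[unfolded Y]] unfolding structure_at_separated[OF oC sep that[unfolded Y]] Y
        using solve_ii[OF oC \<gamma> sm(1) qs gh that[unfolded Y]] by blast
    qed
    then show ?thesis unfolding system_ii_def rhs_ii_def Let_def by auto
  qed
  moreover have "assoc_ii \<eta> ?C f a1 b1 a3 b3 p"
  proof -
    have e: "1 / \<gamma> * (b1 * s - a1 * t) = b1 / \<gamma> * s + - a1 / \<gamma> * t"
      "- (1 / \<gamma>) * (b3 * s - a3 * t) = - b3 / \<gamma> * s + a3 / \<gamma> * t"
      "- a3 * s - b3 * t = - (a3 * s + b3 * t)" for \<gamma> s t
      by (simp_all add: diff_divide_distrib right_diff_distrib)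
    show ?thesis
      unfolding assoc_ii_def Let_def e
    proof (clarify, intro conjI)
      fix z z1 y y1 assume Y: "(z, z1, y, y1) \<in> ?C"
      then have m: "(z, y) \<in> proj0 ?C" "(z1, y1) \<in> proj1 ?C" using cube_iff_proj[OF r] by blast+
      note f = sep[unfolded separated_def, THEN conjunct2, THEN conjunct2, THEN conjunct2, THEN conjunct2, THEN conjunct2, rule_format, OF Y]
      show "f 1 1 (z, z1, y, y1) = \<eta>" "f 1 2 (z, z1, y, y1) = p (z, y)" using f by blast+
      show "f 2 1 (z, z1, y, y1) = a1 * z1 + b1 * y1" "f 3 1 (z, z1, y, y1) = - (a3 * z1 + b3 * y1)"
        using f gh[OF m(2)] by simp_all
      show "f 2 2 (z, z1, y, y1) = b1 / (a1 * b3 - b1 * a3) * pd1 p (z, y) + - a1 / (a1 * b3 - b1 * a3) * pd2 p (z, y)"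
        "f 3 2 (z, z1, y, y1) = - b3 / (a1 * b3 - b1 * a3) * pd1 p (z, y) + a3 / (a1 * b3 - b1 * a3) * pd2 p (z, y)"
        using f qs[OF m(1)] by metis+
    qed
  qed
  ultimately show ?thesis using data by blast
qed

lemma strict_mono_or_antimono_of_deriv:
  fixes \<phi> :: "real \<Rightarrow> real"
  assumes T: "convex T" and d: "\<And>x. x \<in> T \<Longrightarrow> (\<phi> has_real_derivative \<phi>' x) (at x)"
    and s: "\<And>x. x \<in> T \<Longrightarrow> 0 < \<phi>' x * k"
  shows "strict_mono_on T \<phi> \<or> strict_antimono_on T \<phi>"
proof -
  have seg: "x \<in> T" if "a \<in> T" "b \<in> T" "a \<le> x" "x \<le> b" for a b x
  proof -
    have "x \<in> closed_segment a b" using that by (auto simp: closed_segment_eq_real_ivl)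
    then show ?thesis using closed_segment_subset[OF that(1,2) T] by blast
  qed
  show ?thesis
  proof (cases "0 < k")
    case True
    have "\<phi> a < \<phi> b" if "a \<in> T" "b \<in> T" "a < b" for a b
      by (rule DERIV_pos_imp_increasing[OF that(3)])
        (use d s seg[OF that(1,2)] True in \<open>auto simp: zero_less_mult_iff intro!: exI\<close>)
    then show ?thesis by (auto simp: monotone_on_def)
  next
    case False
    have "\<phi> b < \<phi> a" if "a \<in> T" "b \<in> T" "a < b" for a b
      by (rule DERIV_neg_imp_decreasing[OF that(3)])
        (use d s seg[OF that(1,2)] False in \<open>auto simp: zero_less_mult_iff intro!: exI\<close>)
    then show ?thesis by (auto simp: monotone_on_def)
  qed
qed

text \<open>With \<open>q = s = 0\<close> and \<open>p\<close> constant, Cramer's rule expresses \<open>F\<close> and \<open>G\<close> through \<open>z1\<close> and \<open>y1\<close>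
  alone.\<close>

lemma constant_coefficients:
  assumes r: "0 < r" and sep: "separated \<eta> (cube X r) f p q s g h"
    and st: "\<And>z z1 y y1. (z, z1, y, y1) \<in> cube X r \<Longrightarrow> structure_at \<delta> f (z, z1, y, y1)
      (z1, 0, y1, 0) (0, F (z, z1, y, y1), 0, G (z, z1, y, y1))"
    and W: "\<And>w. w \<in> proj1 (cube X r) \<Longrightarrow> Wdet g h w \<noteq> 0"
    and 0: "\<And>w. w \<in> proj0 (cube X r) \<Longrightarrow> pd1 p w = 0 \<and> pd2 p w = 0 \<and> q w = 0 \<and> s w = 0"
    and Y: "Y \<in> cube X r"
  shows "(pdz F Y)\<^sup>2 + (pdy F Y)\<^sup>2 + (pdz G Y)\<^sup>2 + (pdy G Y)\<^sup>2 = 0"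
proof -
  let ?C = "cube X r"
  note oC = open_cube[of X r] and o0 = open_proj0[OF open_cube[of X r]]
  have p: "smooth_on p (proj0 ?C)" using sep by (simp add: separated_def)
  have pd0: "pd1 q w = 0" "pd2 q w = 0" "pd1 s w = 0" "pd2 s w = 0" if "w \<in> proj0 ?C" for w
    using pd1_affine[OF o0 that, of q 0 0 0] pd2_affine[OF o0 that, of q 0 0 0]
      pd1_affine[OF o0 that, of s 0 0 0] pd2_affine[OF o0 that, of s 0 0 0] 0 by auto
  obtain z z1 y y1 where Y': "Y = (z, z1, y, y1)" by (cases Y)
  have m: "(z, y) \<in> proj0 ?C" "(z1, y1) \<in> proj1 ?C" using Y cube_iff_proj[OF r] unfolding Y' by blast+
  have pc: "p w = p (z, y)" if w: "w \<in> proj0 ?C" for w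
  proof (rule equal_along_null_direction[OF convex_proj0_cube _ m(1) w])
    fix v assume v: "v \<in> proj0 ?C"
    show d: "p differentiable (at v)" by (rule smooth_on_differentiable[OF p v])
    obtain a b where "w - (z, y) = (a, b)" by (cases "w - (z, y)")
    then show "fd p v (w - (z, y)) = 0" using fd_prod2[OF d] 0[OF v] by simp
  qed
  have FG: "F (a, z1, c, y1) = (- (p (z, y) * h (z1, y1)) * pd2 h (z1, y1)
        + \<delta> * (p (z, y) * g (z1, y1)) * pd2 g (z1, y1)) / Wdet g h (z1, y1)"
    "G (a, z1, c, y1) = (- (\<delta> * (p (z, y) * g (z1, y1)) * pd1 g (z1, y1))
        + p (z, y) * h (z1, y1) * pd1 h (z1, y1)) / Wdet g h (z1, y1)" if ac: "(a, c) \<in> proj0 ?C" for a c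
  proof -
    have Z: "(a, z1, c, y1) \<in> ?C" using ac m(2) cube_iff_proj[OF r] by blast
    from st[OF Z] show "F (a, z1, c, y1) = (- (p (z, y) * h (z1, y1)) * pd2 h (z1, y1)
        + \<delta> * (p (z, y) * g (z1, y1)) * pd2 g (z1, y1)) / Wdet g h (z1, y1)"
      "G (a, z1, c, y1) = (- (\<delta> * (p (z, y) * g (z1, y1)) * pd1 g (z1, y1))
        + p (z, y) * h (z1, y1) * pd1 h (z1, y1)) / Wdet g h (z1, y1)"
      unfolding structure_at_separated[OF oC sep Z] second_third_iff[OF W[OF m(2)]] pc[OF ac]
      by (simp_all add: 0[OF ac] pd0[OF ac])
  qed
  have sl: "((\<lambda>a. H (a, z1, y, y1)) has_real_derivative 0) (at z)" "((\<lambda>c. H (z, z1, c, y1)) has_real_derivative 0) (at y)"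
    if H: "\<And>a c. (a, c) \<in> proj0 ?C \<Longrightarrow> H (a, z1, c, y1) = K" for H :: "jet_pt \<Rightarrow> real" and K
  proof -
    have o: "open ((\<lambda>a. (a, y)) -` proj0 ?C)" "open ((\<lambda>c. (z, c)) -` proj0 ?C)"
      by (intro open_vimage o0 continuous_intros)+
    show "((\<lambda>a. H (a, z1, y, y1)) has_real_derivative 0) (at z)"
      by (rule has_field_derivative_transform_within_open[OF DERIV_const o(1)]) (use m H in auto)
    show "((\<lambda>c. H (z, z1, c, y1)) has_real_derivative 0) (at y)"
      by (rule has_field_derivative_transform_within_open[OF DERIV_const o(2)]) (use m H in auto)
  qed
  have "pdz F Y = 0" "pdy F Y = 0" "pdz G Y = 0" "pdy G Y = 0"
    using DERIV_imp_deriv[OF sl(1)[of F, OF FG(1)]] DERIV_imp_deriv[OF sl(2)[of F, OF FG(1)]]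
      DERIV_imp_deriv[OF sl(1)[of G, OF FG(2)]] DERIV_imp_deriv[OF sl(2)[of G, OF FG(2)]]
    unfolding pdz_def pdy_def Y' case_prod_conv by blast+
  then show ?thesis by simp
qed

text \<open>The relation between the partial derivatives of \<open>p\<close> means that its gradient is \<open>\<psi> (b, a)\<close>. The
  first structure equation at a point where \<open>\<psi> \<noteq> 0\<close> is the relation \<open>\<mu> g - \<lambda> h = a y1 + b z1\<close>;
  subtracting its multiples from the equation at other points leaves linear relations between \<open>g\<close>
  and \<open>h\<close>, which are trivial as \<open>W \<noteq> 0\<close>, so \<open>q = \<lambda> \<psi>\<close> and \<open>s = - \<mu> \<psi>\<close>. Finally, \<open>p\<close> is constant in
  the direction \<open>(a, -b)\<close>, so it is a function \<open>\<phi>\<close> of \<open>a y + b z\<close>, read off on the line through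
  \<open>(zz, yy)\<close> in the direction \<open>(b, a)\<close>.\<close>

lemma i_from_dependence:
  assumes r: "0 < r" and sep: "separated \<eta> (cube X r) f p q s g h"
    and st: "\<And>z z1 y y1. (z, z1, y, y1) \<in> cube X r \<Longrightarrow> structure_at \<delta> f (z, z1, y, y1)
      (z1, 0, y1, 0) (0, F (z, z1, y, y1), 0, G (z, z1, y, y1))"
    and W: "\<And>w. w \<in> proj1 (cube X r) \<Longrightarrow> Wdet g h w \<noteq> 0"
    and det: "\<And>Y. Y \<in> cube X r \<Longrightarrow> f 1 1 Y * f 2 2 Y - f 1 2 Y * f 2 1 Y \<noteq> 0"
    and gen: "generically_nonzero (cube X r) (\<lambda>X. (pdz F X)\<^sup>2 + (pdy F X)\<^sup>2 + (pdz G X)\<^sup>2 + (pdy G X)\<^sup>2)"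
    and dep: "c \<noteq> 0 \<or> d \<noteq> 0" "\<And>w. w \<in> proj0 (cube X r) \<Longrightarrow> c * pd1 p w + d * pd2 p w = 0"
  shows "after_shrinking (cube X r) (\<lambda>D'. \<exists>a b \<mu> lam g h \<phi>.
    data_i \<eta> D' a b \<mu> lam g h \<phi> \<and> system_i \<delta> \<eta> D' F G a b \<mu> lam g h \<phi> \<and> assoc_i \<eta> D' f a b \<mu> lam g h \<phi>)"
proof -
  let ?C = "cube X r"
  note oC = open_cube[of X r] and o0 = open_proj0[OF open_cube[of X r]] and o1 = open_proj1[OF open_cube[of X r]]
  have ne: "proj1 ?C \<noteq> {}" "proj0 ?C \<noteq> {}" "?C \<noteq> {}" using centre_in_cube[OF r, of X] by (auto simp: proj0_def proj1_def)
  have sm: "smooth_on p (proj0 ?C)" "smooth_on g (proj1 ?C)" "smooth_on h (proj1 ?C)"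
    using sep by (auto simp: separated_def)
  have E1: "fst v * pd1 p w + snd v * pd2 p w = - h v * q w - s w * g v"
    if "w \<in> proj0 ?C" "v \<in> proj1 ?C" for w v
  proof -
    obtain z y z1 y1 where wv: "w = (z, y)" "v = (z1, y1)" by (cases w, cases v)
    then have Y: "(z, z1, y, y1) \<in> ?C" using that cube_iff_proj[OF r] by blast
    show ?thesis using st[OF Y] unfolding structure_at_separated[OF oC sep Y] by (simp add: first_equation_def wv)
  qed
  define a where "a = - c"
  define b where "b = d"
  define n where "n = a\<^sup>2 + b\<^sup>2"
  have n: "0 < n" using dep(1) by (auto simp: n_def a_def b_def sum_power2_gt_zero_iff)
  define \<psi> where "\<psi> w = (b * pd1 p w + a * pd2 p w) / n" for w
  have pp: "pd1 p w = b * \<psi> w" "pd2 p w = a * \<psi> w" if "w \<in> proj0 ?C" for w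
  proof -
    have 0: "b * pd2 p w = a * pd1 p w" using dep(2)[OF that] by (simp add: a_def b_def)
    have "n * pd1 p w = b * (b * pd1 p w) + a * (a * pd1 p w)" "n * pd2 p w = b * (b * pd2 p w) + a * (a * pd2 p w)"
      by (simp_all add: n_def power2_eq_square algebra_simps)
    then have "n * pd1 p w = b * (b * pd1 p w + a * pd2 p w)" "n * pd2 p w = a * (b * pd1 p w + a * pd2 p w)"
      unfolding 0[symmetric] using 0 by (simp_all add: algebra_simps)
    then show "pd1 p w = b * \<psi> w" "pd2 p w = a * \<psi> w"
      using n by (simp_all add: \<psi>_def field_simps)
  qed
  have indep: "\<alpha> = 0 \<and> \<beta> = 0" if "\<And>v. v \<in> proj1 ?C \<Longrightarrow> \<alpha> * h v + \<beta> * g v = 0" for \<alpha> \<beta>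
  proof -
    obtain v where "v \<in> proj1 ?C" using ne by blast
    then show ?thesis using Wdet_independent[OF o1 _ sm(2,3) W that] by blast
  qed
  \<comment> \<open>Where \<open>\<psi> = 0\<close>, independence of \<open>g\<close> and \<open>h\<close> gives \<open>q = s = 0\<close>.\<close>
  have "\<exists>w\<in>proj0 ?C. \<psi> w \<noteq> 0"
  proof (rule ccontr)
    assume *: "\<not> ?thesis"
    have zero: "pd1 p w = 0 \<and> pd2 p w = 0 \<and> q w = 0 \<and> s w = 0" if w: "w \<in> proj0 ?C" for w
    proof -
      have pd0: "pd1 p w = 0" "pd2 p w = 0" using * pp[OF w] w by auto
      have "q w * h v + s w * g v = 0" if "v \<in> proj1 ?C" for v
        using E1[OF w that] pd0 by (simp add: algebra_simps)
      then show ?thesis using indep[of "q w" "s w"] pd0 by blast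
    qed
    have "(pdz F Y)\<^sup>2 + (pdy F Y)\<^sup>2 + (pdz G Y)\<^sup>2 + (pdy G Y)\<^sup>2 = 0" if "Y \<in> ?C" for Y
      by (rule constant_coefficients[OF r sep st W zero that])
    moreover obtain Y where "Y \<in> ?C" "(pdz F Y)\<^sup>2 + (pdy F Y)\<^sup>2 + (pdz G Y)\<^sup>2 + (pdy G Y)\<^sup>2 \<noteq> 0"
      by (rule generically_nonzero_point[OF gen oC subset_refl ne(3)])
    ultimately show False by blast
  qed
  then obtain w1 where w1: "w1 \<in> proj0 ?C" "\<psi> w1 \<noteq> 0" by blast
  have c\<psi>: "continuous_on (proj0 ?C) \<psi>"
  proof -
    have "smooth_on (\<lambda>w. 1 / n * (b * pd1 p w + a * pd2 p w)) (proj0 ?C)"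
      by (intro smooth_on_cmult smooth_on_add smooth_on_pd1 smooth_on_pd2 o0 sm)
    then show ?thesis by (simp add: \<psi>_def[abs_def] smooth_on_continuous)
  qed
  \<comment> \<open>\<open>p\<close> cannot vanish on the open set where its gradient does not.\<close>
  have "\<exists>w\<in>proj0 ?C. \<psi> w \<noteq> 0 \<and> p w \<noteq> 0"
  proof (rule ccontr)
    assume *: "\<not> ?thesis"
    define U where "U = proj0 ?C \<inter> \<psi> -` (- {0})"
    have U: "open U" "w1 \<in> U"
      unfolding U_def using w1 by (auto intro!: continuous_open_preimage c\<psi> o0)
    have "p w = 0" if "w \<in> U" for w using * that by (auto simp: U_def)
    then have "pd1 p w1 = 0" "pd2 p w1 = 0"
      using pd1_affine[OF U, of p 0 0 0] pd2_affine[OF U, of p 0 0 0] by auto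
    then show False using w1(2) by (simp add: \<psi>_def)
  qed
  then obtain zz yy where w0: "(zz, yy) \<in> proj0 ?C" "\<psi> (zz, yy) \<noteq> 0" "p (zz, yy) \<noteq> 0" by auto
  define \<psi>0 where "\<psi>0 = \<psi> (zz, yy)"
  have \<psi>0: "\<psi>0 \<noteq> 0" using w0(2) by (simp add: \<psi>0_def)
  define lam where "lam = q (zz, yy) / \<psi>0"
  define \<mu> where "\<mu> = - s (zz, yy) / \<psi>0"
  have rel: "\<mu> * g v - lam * h v = a * snd v + b * fst v" if "v \<in> proj1 ?C" for v
  proof -
    have "(a * snd v + b * fst v) * \<psi>0 = - h v * q (zz, yy) - s (zz, yy) * g v"
      using E1[OF w0(1) that] unfolding pp[OF w0(1)] \<psi>0_def by (simp add: algebra_simps)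
    then have "a * snd v + b * fst v = (- h v * q (zz, yy) - s (zz, yy) * g v) / \<psi>0"
      using \<psi>0 by (simp add: eq_divide_eq)
    then show ?thesis by (simp add: lam_def \<mu>_def diff_divide_distrib algebra_simps)
  qed
  have qs: "q w = lam * \<psi> w" "s w = - \<mu> * \<psi> w" if w: "w \<in> proj0 ?C" for w
  proof -
    have "(q w - lam * \<psi> w) * h v + (s w + \<mu> * \<psi> w) * g v = 0" if v: "v \<in> proj1 ?C" for v
    proof -
      have "(a * snd v + b * fst v) * \<psi> w = - h v * q w - s w * g v"
        using E1[OF w v] unfolding pp[OF w] by (simp add: algebra_simps)
      then show ?thesis unfolding rel[OF v, symmetric] by (simp add: algebra_simps)
    qed
    from indep[OF this] show "q w = lam * \<psi> w" "s w = - \<mu> * \<psi> w" by auto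
  qed
  obtain x0 k1 x2 k3 where X: "X = (x0, k1, x2, k3)" by (cases X)
  define Y0 where "Y0 = (zz, k1, yy, k3)"
  have Y0: "Y0 \<in> ?C" using w0(1) r unfolding X Y0_def in_proj0_cube[OF r] by (simp add: in_cube)
  have pull: "continuous_on ?C (\<lambda>Y. k (fst Y, fst (snd (snd Y))))" if "continuous_on (proj0 ?C) k" for k :: "real \<times> real \<Rightarrow> real"
  proof (rule continuous_on_compose2[OF that])
    show "continuous_on ?C (\<lambda>Y. (fst Y, fst (snd (snd Y))))" by (intro continuous_intros)
    show "(\<lambda>Y. (fst Y, fst (snd (snd Y)))) ` ?C \<subseteq> proj0 ?C" by (force simp: proj0_def)
  qed
  have ce: "continuous_on ?C (\<lambda>Y. min (\<psi> (fst Y, fst (snd (snd Y))) * \<psi>0) ((p (fst Y, fst (snd (snd Y))))\<^sup>2))"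
    by (intro continuous_on_min continuous_on_mult continuous_on_power continuous_on_const pull c\<psi> smooth_on_continuous[OF sm(1)])
  have pos: "0 < min (\<psi> (fst Y0, fst (snd (snd Y0))) * \<psi>0) ((p (fst Y0, fst (snd (snd Y0))))\<^sup>2)"
    using \<psi>0 w0(3) unfolding Y0_def \<psi>0_def by (auto simp: zero_less_mult_iff linorder_neq_iff)
  obtain R where R: "0 < R" "cube Y0 R \<subseteq> ?C"
    "\<And>Y. Y \<in> cube Y0 R \<Longrightarrow> 0 < min (\<psi> (fst Y, fst (snd (snd Y))) * \<psi>0) ((p (fst Y, fst (snd (snd Y))))\<^sup>2)"
    by (rule positive_on_cube[OF oC Y0 ce pos]) blast
  \<comment> \<open>Half the size, so that the line through \<open>(zz, yy)\<close> along which \<open>\<phi>\<close> is defined stays inside.\<close>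
  define D where "D = cube Y0 (R / 2)"
  have R2: "0 < R / 2" using R(1) by simp
  have D: "open D" "is_domain D" "D \<subseteq> ?C"
  proof -
    show "open D" unfolding D_def by (rule open_cube)
    show "is_domain D" unfolding D_def by (rule is_domain_cube[OF R2])
    have "cube Y0 (R / 2) \<subseteq> cube Y0 R" by (rule cube_mono) (use R(1) in simp)
    then show "D \<subseteq> ?C" using R(2) unfolding D_def by blast
  qed
  have projD: "proj0 D \<subseteq> proj0 ?C" "proj1 D \<subseteq> proj1 ?C"
    using D(3) unfolding proj0_def proj1_def by (simp_all only: image_mono)
  have pos': "0 < \<psi> (z, y) * \<psi>0" "p (z, y) \<noteq> 0" if "(z, y) \<in> proj0 D" for z y
  proof -
    have "(z, k1, y, k3) \<in> cube Y0 R"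
      using that R(1) unfolding D_def Y0_def in_proj0_cube[OF R2] by (simp add: in_cube)
    from R(3)[OF this] show "0 < \<psi> (z, y) * \<psi>0" "p (z, y) \<noteq> 0" by auto
  qed
  have ab: "a \<noteq> 0 \<or> b \<noteq> 0" using n by (auto simp: n_def)
  define \<xi>0 where "\<xi>0 = a * yy + b * zz"
  define \<phi> where "\<phi> \<xi> = p (zz + (\<xi> - \<xi>0) * (b / n), yy + (\<xi> - \<xi>0) * (a / n))" for \<xi>
  note oT = open_xi_range[OF D(1) ab]
  have on_line: "(zz + (a * y + b * z - \<xi>0) * (b / n), yy + (a * y + b * z - \<xi>0) * (a / n)) \<in> proj0 (cube Y0 R)"
    if "(z, y) \<in> proj0 D" for z y
  proof -
    define Z where "Z = z - zz"
    define Y where "Y = y - yy"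
    define M where "M = max \<bar>Z\<bar> \<bar>Y\<bar>"
    have M: "0 \<le> M" "2 * M < R"
      using that unfolding D_def Y0_def in_proj0_cube[OF R2] by (auto simp: Z_def Y_def M_def)
    have \<xi>: "a * y + b * z - \<xi>0 = a * Y + b * Z" by (simp add: \<xi>0_def Z_def Y_def algebra_simps)
    have "\<bar>a * Y\<bar> \<le> \<bar>a\<bar> * M" "\<bar>b * Z\<bar> \<le> \<bar>b\<bar> * M" by (intro abs_mult_le; simp add: M_def)+
    then have le: "\<bar>a * Y + b * Z\<bar> \<le> (\<bar>a\<bar> + \<bar>b\<bar>) * M" using abs_triangle_ineq[of "a * Y" "b * Z"] by (simp add: distrib_right)
    have "\<bar>(a * Y + b * Z) * (k / n)\<bar> < R" if k: "k = a \<or> k = b" for k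
    proof -
      have "2 * (\<bar>a\<bar> * \<bar>b\<bar>) \<le> a\<^sup>2 + b\<^sup>2" using sum_squares_bound[of "\<bar>a\<bar>" "\<bar>b\<bar>"] by simp
      moreover have "u + v \<le> 2 * (u + u')" if "2 * v \<le> u + u'" "0 \<le> u" "0 \<le> u'" for u u' v :: real
        using that unfolding distrib_left by linarith
      ultimately have "a\<^sup>2 + \<bar>a\<bar> * \<bar>b\<bar> \<le> 2 * n" "b\<^sup>2 + \<bar>a\<bar> * \<bar>b\<bar> \<le> 2 * n"
        unfolding n_def by (metis zero_le_power2 add.commute)+
      moreover have "(\<bar>a\<bar> + \<bar>b\<bar>) * \<bar>a\<bar> = a\<^sup>2 + \<bar>a\<bar> * \<bar>b\<bar>" "(\<bar>a\<bar> + \<bar>b\<bar>) * \<bar>b\<bar> = b\<^sup>2 + \<bar>a\<bar> * \<bar>b\<bar>"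
        by (simp_all add: algebra_simps power2_eq_square)
      ultimately have "(\<bar>a\<bar> + \<bar>b\<bar>) * \<bar>k\<bar> \<le> 2 * n" using k by metis
      then have "((\<bar>a\<bar> + \<bar>b\<bar>) * \<bar>k\<bar>) * M \<le> 2 * n * M" using M(1) by (rule mult_right_mono)
      moreover have "\<bar>a * Y + b * Z\<bar> * \<bar>k\<bar> \<le> (\<bar>a\<bar> + \<bar>b\<bar>) * M * \<bar>k\<bar>" using le by (rule mult_right_mono) simp
      ultimately have "\<bar>a * Y + b * Z\<bar> * \<bar>k\<bar> \<le> n * (2 * M)" by (simp add: algebra_simps)
      then have "\<bar>a * Y + b * Z\<bar> * \<bar>k\<bar> / n \<le> 2 * M" using n by (simp add: pos_divide_le_eq mult.commute)
      then show ?thesis using M(2) n by (simp add: abs_mult)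
    qed
    then show ?thesis unfolding \<xi> Y0_def in_proj0_cube[OF R(1)] by simp
  qed
  have projR: "proj0 (cube Y0 R) \<subseteq> proj0 ?C" using R(2) unfolding proj0_def by (simp only: image_mono)
  have sm\<phi>: "smooth_on \<phi> (xi_range a b D)"
    unfolding \<phi>_def
  proof (rule smooth_on_compose_pair[OF oT _ smooth_on_subset[OF sm(1) projR]])
    show "(zz + (\<xi> - \<xi>0) * (b / n), yy + (\<xi> - \<xi>0) * (a / n)) \<in> proj0 (cube Y0 R)" if \<xi>: "\<xi> \<in> xi_range a b D" for \<xi>
    proof -
      obtain z z1 y y1 where "(z, z1, y, y1) \<in> D" "\<xi> = a * y + b * z" using \<xi> by (auto simp: xi_range_def)
      moreover from this have "(z, y) \<in> proj0 D" by (force simp: proj0_def)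
      ultimately show ?thesis using on_line by simp
    qed
    show "smooth_on (\<lambda>\<xi>. zz + (\<xi> - \<xi>0) * (b / n)) (xi_range a b D)" "smooth_on (\<lambda>\<xi>. yy + (\<xi> - \<xi>0) * (a / n)) (xi_range a b D)"
      by (intro smooth_on_add smooth_on_mult smooth_on_diff smooth_on_const smooth_on_linear bounded_linear_ident oT)+
  qed
  have p\<phi>: "p (z, y) = \<phi> (a * y + b * z)" if zy: "(z, y) \<in> proj0 D" for z y
    unfolding \<phi>_def
  proof (rule equal_along_null_direction[OF convex_proj0_cube[of Y0 R]])
    show "p differentiable (at v)" if "v \<in> proj0 (cube Y0 R)" for v
      using smooth_on_differentiable[OF sm(1)] that projR by blast
    show "(zz + (a * y + b * z - \<xi>0) * (b / n), yy + (a * y + b * z - \<xi>0) * (a / n)) \<in> proj0 (cube Y0 R)"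
      by (rule on_line[OF zy])
    show "(z, y) \<in> proj0 (cube Y0 R)"
      using zy R(1) unfolding D_def Y0_def in_proj0_cube[OF R2] in_proj0_cube[OF R(1)] by simp
    define t where "t = (a * (z - zz) - b * (y - yy)) / n"
    have "z - (zz + (a * y + b * z - \<xi>0) * (b / n)) = (n * (z - zz) - (a * (y - yy) + b * (z - zz)) * b) / n"
      "y - (yy + (a * y + b * z - \<xi>0) * (a / n)) = (n * (y - yy) - (a * (y - yy) + b * (z - zz)) * a) / n"
      using n by (simp_all add: \<xi>0_def field_simps)
    moreover have "n * (z - zz) - (a * (y - yy) + b * (z - zz)) * b = a * (a * (z - zz) - b * (y - yy))"
      "n * (y - yy) - (a * (y - yy) + b * (z - zz)) * a = - b * (a * (z - zz) - b * (y - yy))"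
      by (simp_all add: n_def power2_eq_square algebra_simps)
    ultimately have diff: "(z, y) - (zz + (a * y + b * z - \<xi>0) * (b / n), yy + (a * y + b * z - \<xi>0) * (a / n)) = (a * t, - b * t)"
      by (simp add: t_def)
    fix v assume "v \<in> proj0 (cube Y0 R)"
    then have v: "v \<in> proj0 ?C" using projR by blast
    show "fd p v ((z, y) - (zz + (a * y + b * z - \<xi>0) * (b / n), yy + (a * y + b * z - \<xi>0) * (a / n))) = 0"
      unfolding diff fd_prod2[OF smooth_on_differentiable[OF sm(1) v]] pp[OF v] by simp
  qed
  have d\<phi>: "deriv \<phi> (a * y + b * z) = \<psi> (z, y)" if zy: "(z, y) \<in> proj0 D" for z y
  proof -
    have d: "(\<lambda>w. \<phi> (a * snd w + b * fst w)) differentiable (at (z, y))"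
      by (rule smooth_on_differentiable[OF smooth_on_xi[OF D(1) ab sm\<phi>] zy])
    have eq: "p w = \<phi> (a * snd w + b * fst w)" if "w \<in> proj0 D" for w using p\<phi>[of "fst w" "snd w"] that by simp
    have "b * deriv \<phi> (a * y + b * z) = b * \<psi> (z, y)" "a * deriv \<phi> (a * y + b * z) = a * \<psi> (z, y)"
      using pd1_cong[OF open_proj0[OF D(1)] zy eq d] pd2_cong[OF open_proj0[OF D(1)] zy eq d]
        pd1_xi[OF D(1) ab sm\<phi> zy] pd2_xi[OF D(1) ab sm\<phi> zy] pp[of "(z, y)"] zy projD(1) by auto
    then show ?thesis using ab by auto
  qed
  have mono: "strict_mono_on (xi_range a b D) \<phi> \<or> strict_antimono_on (xi_range a b D) \<phi>"
  proof (rule strict_mono_or_antimono_of_deriv[where \<phi>' = "deriv \<phi>" and k = \<psi>0])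
    have "bounded_linear (\<lambda>Y :: jet_pt. a * fst (snd (snd Y)) + b * fst Y)"
      by (intro bounded_linear_add bounded_linear_const_mult bounded_linear_fst bounded_linear_compose[OF bounded_linear_fst]
          bounded_linear_compose[OF bounded_linear_snd] bounded_linear_snd)
    then have "convex ((\<lambda>Y :: jet_pt. a * fst (snd (snd Y)) + b * fst Y) ` D)"
      by (intro convex_linear_image bounded_linear.linear) (auto simp: D_def convex_cube)
    moreover have "(\<lambda>Y :: jet_pt. a * fst (snd (snd Y)) + b * fst Y) ` D = xi_range a b D"
      unfolding xi_range_def by (rule image_cong) auto
    ultimately show "convex (xi_range a b D)" by simp
    fix \<xi> assume \<xi>: "\<xi> \<in> xi_range a b D"
    then show "(\<phi> has_real_derivative deriv \<phi> \<xi>) (at \<xi>)" by (rule smooth_on_DERIV[OF sm\<phi>])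
    obtain z z1 y y1 where *: "(z, z1, y, y1) \<in> D" "\<xi> = a * y + b * z" using \<xi> by (auto simp: xi_range_def)
    then have "(z, y) \<in> proj0 D" by (force simp: proj0_def)
    then show "0 < deriv \<phi> \<xi> * \<psi>0" unfolding *(2) using d\<phi> pos' by simp
  qed
  have \<mu>lam: "\<mu>\<^sup>2 + lam\<^sup>2 \<noteq> 0"
  proof
    assume "\<mu>\<^sup>2 + lam\<^sup>2 = 0"
    then have "\<mu> = 0" "lam = 0" by (simp_all add: sum_power2_eq_zero_iff)
    then have "b * fst v + a * snd v + 0 = 0" if "v \<in> proj1 ?C" for v using rel[OF that] by simp
    then show False using affine_zero[OF o1 ne(1), of b a 0] ab by blast
  qed
  have assoc: "assoc_i \<eta> D f a b \<mu> lam g h \<phi>"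
    unfolding assoc_i_def Let_def
  proof (clarify, intro conjI)
    fix z z1 y y1 assume Y: "(z, z1, y, y1) \<in> D"
    then have zy: "(z, y) \<in> proj0 D" by (force simp: proj0_def)
    note f = sep[unfolded separated_def, THEN conjunct2, THEN conjunct2, THEN conjunct2, THEN conjunct2, THEN conjunct2, rule_format, OF subsetD[OF D(3) Y]]
    show "f 1 1 (z, z1, y, y1) = \<eta>" "f 1 2 (z, z1, y, y1) = \<phi> (a * y + b * z)"
      "f 2 1 (z, z1, y, y1) = g (z1, y1)" "f 3 1 (z, z1, y, y1) = - h (z1, y1)"
      "f 2 2 (z, z1, y, y1) = lam * deriv \<phi> (a * y + b * z)" "f 3 2 (z, z1, y, y1) = - \<mu> * deriv \<phi> (a * y + b * z)"
      using f p\<phi>[OF zy] d\<phi>[OF zy] qs[OF subsetD[OF projD(1) zy]] by simp_all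
  qed
  have smD: "smooth_on g (proj1 D)" "smooth_on h (proj1 D)" using smooth_on_subset sm projD by blast+
  have WD: "Wdet g h (z1, y1) \<noteq> 0" and relD: "\<mu> * g (z1, y1) - lam * h (z1, y1) = a * y1 + b * z1"
    if "(z1, y1) \<in> proj1 D" for z1 y1
    using W rel[of "(z1, y1)"] that projD(2) by auto
  have data: "data_i \<eta> D a b \<mu> lam g h \<phi>"
    unfolding data_i_def
  proof (intro conjI)
    show "generically_nonzero D (\<lambda>(z, z1, y, y1). Wdet g h (z1, y1))"
      by (rule generically_nonzeroI) (use WD in \<open>force simp: proj1_def\<close>)
    show "generically_nonzero D (\<lambda>(z, z1, y, y1).
       let \<xi> = a * y + b * z in g (z1, y1) - lam * \<eta> * (deriv \<phi> \<xi> / \<phi> \<xi>))"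
    proof (rule generically_nonzeroI)
      fix Y assume Y: "Y \<in> D"
      obtain z z1 y y1 where Y': "Y = (z, z1, y, y1)" by (cases Y)
      have zy: "(z, y) \<in> proj0 D" using Y Y' by (force simp: proj0_def)
      have \<phi>0: "\<phi> (a * y + b * z) \<noteq> 0" using pos'(2)[OF zy] p\<phi>[OF zy] by simp
      have "\<eta> * (lam * deriv \<phi> (a * y + b * z)) - \<phi> (a * y + b * z) * g (z1, y1) \<noteq> 0"
      proof -
        have YD: "(z, z1, y, y1) \<in> D" using Y Y' by simp
        have "f 1 1 (z, z1, y, y1) = \<eta> \<and> f 1 2 (z, z1, y, y1) = \<phi> (a * y + b * z) \<and>
            f 2 1 (z, z1, y, y1) = g (z1, y1) \<and> f 2 2 (z, z1, y, y1) = lam * deriv \<phi> (a * y + b * z)"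
          using bspec[OF assoc[unfolded assoc_i_def Let_def] YD] by simp
        then show ?thesis using det[OF subsetD[OF D(3) YD]] by simp
      qed
      moreover have "\<eta> * (lam * deriv \<phi> (a * y + b * z)) - \<phi> (a * y + b * z) * g (z1, y1)
        = - \<phi> (a * y + b * z) * (g (z1, y1) - lam * \<eta> * (deriv \<phi> (a * y + b * z) / \<phi> (a * y + b * z)))"
        using \<phi>0 by (simp add: algebra_simps)
      ultimately show "(case Y of (z, z1, y, y1) \<Rightarrow>
         let \<xi> = a * y + b * z in g (z1, y1) - lam * \<eta> * (deriv \<phi> \<xi> / \<phi> \<xi>)) \<noteq> 0"
        unfolding Y' Let_def case_prod_conv by (metis mult_zero_right)
    qed
    show "a\<^sup>2 + b\<^sup>2 \<noteq> 0" using n unfolding n_def by (metis less_irrefl)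
  qed (use smD sm\<phi> mono \<mu>lam relD in auto)
  have "system_i \<delta> \<eta> D F G a b \<mu> lam g h \<phi>"
  proof -
    have sepD: "separated \<eta> D f (\<lambda>w. \<phi> (a * snd w + b * fst w)) (\<lambda>w. lam * deriv \<phi> (a * snd w + b * fst w))
      (\<lambda>w. - \<mu> * deriv \<phi> (a * snd w + b * fst w)) g h"
      using separated_i[OF D(1) ab sm\<phi> smD] assoc by blast
    have "(F Y, G Y) = rhs_i \<delta> \<eta> a b \<mu> lam g h \<phi> Y" if Y: "Y \<in> D" for Y
    proof -
      obtain z z1 y y1 where Y': "Y = (z, z1, y, y1)" by (cases Y)
      have YD: "(z, z1, y, y1) \<in> D" using Y Y' by simp
      then have v: "(z1, y1) \<in> proj1 D" by (force simp: proj1_def)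
      show ?thesis
        using st[OF subsetD[OF D(3) YD]] unfolding structure_at_separated[OF D(1) sepD YD] Y'
        using solve_i[OF D(1) ab sm\<phi> smD relD refl refl refl YD WD[OF v]] by blast
    qed
    then show ?thesis unfolding system_i_def rhs_i_def Let_def by auto
  qed
  then show ?thesis using data assoc D(2,3) unfolding after_shrinking_def by blast
qed

lemma after_shrinking_trans:
  assumes "after_shrinking D' P" "D' \<subseteq> D" shows "after_shrinking D P"
  using assms unfolding after_shrinking_def by blast

lemma after_shrinkingI: "is_domain D' \<Longrightarrow> D' \<subseteq> D \<Longrightarrow> P D' \<Longrightarrow> after_shrinking D P"
  unfolding after_shrinking_def by blast

lemma after_shrinking_mono: "after_shrinking D P \<Longrightarrow> (\<And>D'. P D' \<Longrightarrow> Q D') \<Longrightarrow> after_shrinking D Q"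
  unfolding after_shrinking_def by blast

text \<open>The functions are separated on a cube where \<open>f\<^sub>1\<^sub>1 f\<^sub>2\<^sub>2 - f\<^sub>1\<^sub>2 f\<^sub>2\<^sub>1\<close> has no zeros, and a smaller cube
  avoids the zeros of \<open>W\<close>. There the two normal forms correspond to the linear independence
  and dependence of the partial derivatives of \<open>p\<close>.\<close>

lemma describes_surfaces_normal_forms:
  assumes dom: "is_domain D" and F: "smooth_on F D" and G: "smooth_on G D"
    and gen: "generically_nonzero D (\<lambda>X. (pdz F X)\<^sup>2 + (pdy F X)\<^sup>2 + (pdz G X)\<^sup>2 + (pdy G X)\<^sup>2)"
    and ds: "describes_surfaces \<delta> D F G f" and \<eta>: "\<forall>X\<in>D. f 1 1 X = \<eta>"
  shows "after_shrinking D (\<lambda>D'.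
        (\<exists>a b \<mu> lam g h \<phi>. data_i \<eta> D' a b \<mu> lam g h \<phi> \<and> system_i \<delta> \<eta> D' F G a b \<mu> lam g h \<phi> \<and>
           assoc_i \<eta> D' f a b \<mu> lam g h \<phi>) \<or>
        (\<exists>a1 b1 a3 b3 p. data_ii D' a1 b1 a3 b3 p \<and> system_ii \<delta> \<eta> D' F G a1 b1 a3 b3 p \<and>
           assoc_ii \<eta> D' f a1 b1 a3 b3 p))" (is "after_shrinking D ?P")
proof -
  have D: "open D" "D \<noteq> {}" using dom by (auto simp: is_domain_def)
  have sm: "smooth_on (f i j) D" if "i \<in> {1,2,3}" "j \<in> {1,2}" for i j
    using ds that unfolding describes_surfaces_def by blast
  define e where "e X = f 1 1 X * f 2 2 X - f 1 2 X * f 2 1 X" for X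
  have ge: "generically_nonzero D e" using ds unfolding describes_surfaces_def e_def by blast
  have ce: "continuous_on D e"
    unfolding e_def by (intro continuous_intros smooth_on_continuous sm) auto
  obtain X0 where X0: "X0 \<in> D" "e X0 \<noteq> 0"
    by (rule generically_nonzero_point[OF ge D(1) subset_refl D(2)])
  obtain r0 where r0: "0 < r0" "cube X0 r0 \<subseteq> D" "\<And>Y. Y \<in> cube X0 r0 \<Longrightarrow> e Y \<noteq> 0"
    by (rule nonzero_on_cube[OF D(1) X0(1) ce X0(2)]) blast
  have F0: "smooth_on F (cube X0 r0)" and G0: "smooth_on G (cube X0 r0)" using F G r0(2) smooth_on_subset by blast+
  have ds0: "describes_surfaces \<delta> (cube X0 r0) F G f" by (rule describes_surfaces_subset[OF ds r0(2)])
  have \<eta>0: "\<forall>X\<in>cube X0 r0. f 1 1 X = \<eta>" using \<eta> r0(2) by blast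
  obtain p q s g h where sep0: "separated \<eta> (cube X0 r0) f p q s g h"
    by (rule describes_surfaces_separated[OF r0(1) F0 G0 ds0 \<eta>0])
  have ne: "cube X0 r0 \<noteq> {}" using centre_in_cube[OF r0(1)] by blast
  obtain X1 where X1: "X1 \<in> cube X0 r0" "(case X1 of (z, z1, y, y1) \<Rightarrow> Wdet g h (z1, y1)) \<noteq> 0"
    by (rule describes_surfaces_Wdet_nonzero[OF open_cube ne F0 G0 ds0 sep0])
  have cW: "continuous_on (cube X0 r0) (\<lambda>(z, z1, y, y1). Wdet g h (z1, y1))"
    by (rule continuous_on_Wdet[OF open_cube]) (use sep0 in \<open>auto simp: separated_def\<close>)
  obtain r where r: "0 < r" "cube X1 r \<subseteq> cube X0 r0"
    "\<And>Y. Y \<in> cube X1 r \<Longrightarrow> (case Y of (z, z1, y, y1) \<Rightarrow> Wdet g h (z1, y1)) \<noteq> 0"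
    by (rule nonzero_on_cube[OF open_cube X1(1) cW X1(2)]) blast
  let ?C = "cube X1 r"
  have CD: "?C \<subseteq> D" using r(2) r0(2) by blast
  have sep: "separated \<eta> ?C f p q s g h" by (rule separated_subset[OF sep0 r(2)])
  have W: "Wdet g h w \<noteq> 0" if "w \<in> proj1 ?C" for w using r(3) that by (force simp: proj1_def)
  have st: "structure_at \<delta> f (z, z1, y, y1) (z1, 0, y1, 0) (0, F (z, z1, y, y1), 0, G (z, z1, y, y1))"
    if "(z, z1, y, y1) \<in> ?C" for z z1 y y1
    by (rule describes_surfaces_pointwise[OF D(1) F G ds]) (use that CD in blast)
  have det: "f 1 1 Y * f 2 2 Y - f 1 2 Y * f 2 1 Y \<noteq> 0" if "Y \<in> ?C" for Y
    using r0(3)[of Y] that r(2) by (auto simp: e_def)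
  have "negligible {X \<in> D. (pdz F X)\<^sup>2 + (pdy F X)\<^sup>2 + (pdz G X)\<^sup>2 + (pdy G X)\<^sup>2 = 0}"
    using gen unfolding generically_nonzero_def .
  then have genC: "generically_nonzero ?C (\<lambda>X. (pdz F X)\<^sup>2 + (pdy F X)\<^sup>2 + (pdz G X)\<^sup>2 + (pdy G X)\<^sup>2)"
    unfolding generically_nonzero_def by (rule negligible_subset) (use CD in blast)
  have "after_shrinking ?C ?P"
  proof (cases "\<forall>c d. (\<forall>w\<in>proj0 ?C. c * pd1 p w + d * pd2 p w = 0) \<longrightarrow> c = 0 \<and> d = 0")
    case True
    then have indep: "c = 0 \<and> d = 0" if "\<forall>w\<in>proj0 ?C. c * pd1 p w + d * pd2 p w = 0" for c d
      using that by blast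
    show ?thesis
      by (rule after_shrinkingI[OF is_domain_cube[OF r(1)] subset_refl])
        (rule disjI2, rule ii_from_independence[OF r(1) sep st W indep])
  next
    case False
    then obtain c d where dep: "c \<noteq> 0 \<or> d \<noteq> 0" "\<And>w. w \<in> proj0 ?C \<Longrightarrow> c * pd1 p w + d * pd2 p w = 0" by blast
    show ?thesis
      by (rule after_shrinking_mono[OF i_from_dependence[OF r(1) sep st W det genC dep]]) (assumption | rule disjI1)+
  qed
  then show ?thesis by (rule after_shrinking_trans[OF _ CD])
qed

lemma ex_assoc_i: "\<exists>f. assoc_i \<eta> D f a b \<mu> lam g h \<phi>"
proof
  show "assoc_i \<eta> D (\<lambda>i j (z, z1, y, y1). let \<xi> = a * y + b * z in
      if i = 1 then if j = 1 then \<eta> else \<phi> \<xi>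
      else if i = 2 then if j = 1 then g (z1, y1) else lam * deriv \<phi> \<xi>
      else if j = 1 then - h (z1, y1) else - \<mu> * deriv \<phi> \<xi>) a b \<mu> lam g h \<phi>"
    by (auto simp: assoc_i_def Let_def)
qed

lemma ex_assoc_ii: "\<exists>f. assoc_ii \<eta> D f a1 b1 a3 b3 p"
proof
  show "assoc_ii \<eta> D (\<lambda>i j (z, z1, y, y1). let \<gamma> = a1 * b3 - b1 * a3 in
      if i = 1 then if j = 1 then \<eta> else p (z, y)
      else if i = 2 then if j = 1 then a1 * z1 + b1 * y1 else 1 / \<gamma> * (b1 * pd1 p (z, y) - a1 * pd2 p (z, y))
      else if j = 1 then - a3 * z1 - b3 * y1 else - (1 / \<gamma>) * (b3 * pd1 p (z, y) - a3 * pd2 p (z, y))) a1 b1 a3 b3 p"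
    by (auto simp: assoc_ii_def Let_def)
qed

section \<open>The classification\<close>

theorem theorem3p13:
  fixes \<delta> \<eta> :: real and D :: "jet_pt set" and F G :: "jet_pt \<Rightarrow> real"
  assumes "\<delta> = 1 \<or> \<delta> = -1"
    and "is_domain D"
    and "smooth_on F D" and "smooth_on G D"
    and "generically_nonzero D (\<lambda>X. (pdz F X)\<^sup>2 + (pdy F X)\<^sup>2 + (pdz G X)\<^sup>2 + (pdy G X)\<^sup>2)"
  shows
    "(after_shrinking D (\<lambda>D'. \<exists>f. describes_surfaces \<delta> D' F G f \<and> (\<forall>X\<in>D'. f 1 1 X = \<eta>))
      \<longleftrightarrow>
      after_shrinking D (\<lambda>D'.
        (\<exists>a b \<mu> lam g h \<phi>. data_i \<eta> D' a b \<mu> lam g h \<phi> \<and> system_i \<delta> \<eta> D' F G a b \<mu> lam g h \<phi>) \<or>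
        (\<exists>a1 b1 a3 b3 p. data_ii D' a1 b1 a3 b3 p \<and> system_ii \<delta> \<eta> D' F G a1 b1 a3 b3 p)))
     \<and>
     (\<forall>f.
      after_shrinking D (\<lambda>D'. describes_surfaces \<delta> D' F G f \<and> (\<forall>X\<in>D'. f 1 1 X = \<eta>))
      \<longleftrightarrow>
      after_shrinking D (\<lambda>D'.
        (\<exists>a b \<mu> lam g h \<phi>. data_i \<eta> D' a b \<mu> lam g h \<phi> \<and> system_i \<delta> \<eta> D' F G a b \<mu> lam g h \<phi> \<and>
           assoc_i \<eta> D' f a b \<mu> lam g h \<phi>) \<or>
        (\<exists>a1 b1 a3 b3 p. data_ii D' a1 b1 a3 b3 p \<and> system_ii \<delta> \<eta> D' F G a1 b1 a3 b3 p \<and>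
           assoc_ii \<eta> D' f a1 b1 a3 b3 p)))"
proof -
  let ?S = "\<lambda>f D'. describes_surfaces \<delta> D' F G f \<and> (\<forall>X\<in>D'. f 1 1 X = \<eta>)"
  let ?i = "\<lambda>f D'. \<exists>a b \<mu> lam g h \<phi>. data_i \<eta> D' a b \<mu> lam g h \<phi> \<and> system_i \<delta> \<eta> D' F G a b \<mu> lam g h \<phi> \<and>
           assoc_i \<eta> D' f a b \<mu> lam g h \<phi>"
  let ?ii = "\<lambda>f D'. \<exists>a1 b1 a3 b3 p. data_ii D' a1 b1 a3 b3 p \<and> system_ii \<delta> \<eta> D' F G a1 b1 a3 b3 p \<and>
           assoc_ii \<eta> D' f a1 b1 a3 b3 p"
  let ?N = "\<lambda>D'. (\<exists>a b \<mu> lam g h \<phi>. data_i \<eta> D' a b \<mu> lam g h \<phi> \<and> system_i \<delta> \<eta> D' F G a b \<mu> lam g h \<phi>) \<or>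
        (\<exists>a1 b1 a3 b3 p. data_ii D' a1 b1 a3 b3 p \<and> system_ii \<delta> \<eta> D' F G a1 b1 a3 b3 p)"
  have to_normal: "after_shrinking D (\<lambda>D'. ?i f D' \<or> ?ii f D')" if surf: "after_shrinking D (?S f)" for f
  proof -
    obtain D' where D': "is_domain D'" "D' \<subseteq> D" "describes_surfaces \<delta> D' F G f" "\<forall>X\<in>D'. f 1 1 X = \<eta>"
      using surf unfolding after_shrinking_def by blast
    have FG: "smooth_on F D'" "smooth_on G D'" using assms(3,4) D'(2) smooth_on_subset by blast+
    have "negligible {X \<in> D. (pdz F X)\<^sup>2 + (pdy F X)\<^sup>2 + (pdz G X)\<^sup>2 + (pdy G X)\<^sup>2 = 0}"
      using assms(5) unfolding generically_nonzero_def .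
    then have "generically_nonzero D' (\<lambda>X. (pdz F X)\<^sup>2 + (pdy F X)\<^sup>2 + (pdz G X)\<^sup>2 + (pdy G X)\<^sup>2)"
      unfolding generically_nonzero_def by (rule negligible_subset) (use D'(2) in blast)
    from describes_surfaces_normal_forms[OF D'(1) FG this D'(3,4)] show ?thesis
      by (rule after_shrinking_trans[OF _ D'(2)])
  qed
  have to_surface: "after_shrinking D (?S f)" if fam: "after_shrinking D (\<lambda>D'. ?i f D' \<or> ?ii f D')" for f
  proof -
    obtain D' where D': "is_domain D'" "D' \<subseteq> D" "?i f D' \<or> ?ii f D'"
      using fam unfolding after_shrinking_def by blast
    from D'(3) have "after_shrinking D' (?S f)"
      by (elim disjE exE conjE)
        (rule case_i_describes_surfaces[OF D'(1)] case_ii_describes_surfaces[OF D'(1)]; assumption)+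
    then show ?thesis by (rule after_shrinking_trans[OF _ D'(2)])
  qed
  have "after_shrinking D (\<lambda>D'. \<exists>f. ?S f D') \<longleftrightarrow> after_shrinking D ?N"
  proof
    assume "after_shrinking D (\<lambda>D'. \<exists>f. ?S f D')"
    then obtain f where "after_shrinking D (?S f)" unfolding after_shrinking_def by blast
    from to_normal[OF this] show "after_shrinking D ?N" by (rule after_shrinking_mono) blast
  next
    assume "after_shrinking D ?N"
    then obtain D' where D': "is_domain D'" "D' \<subseteq> D" "?N D'" unfolding after_shrinking_def by blast
    then obtain f where "?i f D' \<or> ?ii f D'" using ex_assoc_i ex_assoc_ii by meson
    then have "after_shrinking D (\<lambda>D'. ?i f D' \<or> ?ii f D')"
      by (rule after_shrinkingI[OF D'(1,2)])
    from to_surface[OF this] show "after_shrinking D (\<lambda>D'. \<exists>f. ?S f D')" by (rule after_shrinking_mono) blast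
  qed
  then show ?thesis using to_normal to_surface by blast
qed

end
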